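(* Let $G$ be a finite elementary abelian $p$-group and let $\triangleleft$ be an action of $C_p$ on $G$ by automorphisms. Then there is a bijection between the set of orbits of $\mathbb{A}(\triangleleft)$ in $H^2_{\mathrm{cc}}(\triangleleft)$ and the set of isomorphism classes of cocommutative Hopf algebras in $\mathrm{Ext}_{[\triangleleft]}(\Bbbk C_p,\Bbbk^G)$.
   Context: $\Bbbk$ is an algebraically closed field of characteristic $0$, $p$ a prime, $C_p$ the cyclic group of order $p$, $\Bbbk^G$ the Hopf algebra of functions on $G$ (dual of $\Bbbk G$) with basis $\{p_a\}_{a\in G}$ of delta functions. Actions of $C_p$ on $G$ are right actions by group automorphisms; automorphisms of $G$ are written on the right. Put $(x\bullet f)(a)=f(a\triangleleft x)$ for $f\in\Bbbk^G$. Cochains are normalized (value $1$ if some argument is the identity). $Z^2_c(\triangleleft)$ is the group of $\tau:C_p\times G\times G\to\Bbbk^\times$ with $\tau(x,a,bc)\tau(x,b,c)=\tau(x,ab,c)\tau(x,a,b)$ and $\tau(xy,a,b)=\tau(x,a,b)\tau(y,a\triangleleft x,b\triangleleft x)$. For $\eta:C_p\times G\to\Bbbk^\times$ let $(\delta_G\eta)(x,a,b)=\eta(x,a)\eta(x,b)\eta(x,ab)^{-1}$. $B^2_c(\triangleleft)=\{\delta_G\eta : \eta(xy,a)=\eta(x,a)\eta(y,a\triangleleft x)\}$, $B^2_{\mathrm{cc}}(\triangleleft)=\{\delta_G\eta\}\cap Z^2_c(\triangleleft)$ ($\eta$ an arbitrary normalized function), $H^2_c(\triangleleft)=Z^2_c(\triangleleft)/B^2_c(\triangleleft)$,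 $H^2_{\mathrm{cc}}(\triangleleft)=B^2_{\mathrm{cc}}(\triangleleft)/B^2_c(\triangleleft)\subseteq H^2_c(\triangleleft)$. An extension of $\Bbbk C_p$ by $\Bbbk^G$ is a sequence of Hopf maps $\Bbbk^G\xrightarrow{\iota}H\xrightarrow{\pi}\Bbbk C_p$ with $\iota$ injective, $\pi$ surjective, $\iota(\Bbbk^G)$ normal in $H$ and $\ker\pi=\iota(\Bbbk^G)^+H$; equivalences are Hopf isomorphisms compatible with $\iota$ and $\pi$. For $\tau\in Z^2_c(\triangleleft)$, $H(\tau,\triangleleft)$ is the extension with underlying space $\bigoplus_{x\in C_p}\Bbbk^G\bar x$, multiplication $(f\bar x)(f'\bar y)=f(x\bullet f')\overline{xy}$, comultiplication $\Delta(f\bar x)=\sum_{a,b\in G}\tau(x,a,b)f_1p_a\bar x\otimes f_2p_b\bar x$ and counit $\varepsilon(f\bar x)=f(1)$. Every extension of $\Bbbk C_p$ by $\Bbbk^G$ is equivalent to some $H(\tau,\triangleleft)$, and $H(\tau,\triangleleft)$, $H(\tau',\triangleleft')$ are equivalent iff $\triangleleft=\triangleleft'$ and $\tau=\tau'$ in $H^2_c(\triangleleft)$. For $\alpha\in\mathrm{Aut}(C_p)$, $a\triangleleft^\alpha x:=a\triangleleft\alpha(x)$. $[\triangleleft]$ is the set of actions $\triangleleft'$ of $C_p$ on $G$ such that $(G,\triangleleft')\simeq(G,\triangleleft^\alpha)$ as $C_p$-modules for some $\alpha\in\mathrm{Aut}(C_p)$; $\mathrm{Ext}_{[\triangleleft]}(\Bbbk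 C_p,\Bbbk^G)$ is the set of equivalence classes of extensions $H(\tau,\triangleleft')$ with $\triangleleft'\in[\triangleleft]$. Isomorphism classes are with respect to isomorphism of Hopf algebras. $\mathbb{A}(\triangleleft)$ is the group of $C_p$-linear automorphisms of $(G,\triangleleft)$, acting by $(\tau.\lambda)(x,a,b)=\tau(x,a\lambda^{-1},b\lambda^{-1})$. *)

theory Defs
  imports
    "HOL-Algebra.Group_Action"
    "HOL-Computational_Algebra.Polynomial"
    "HOL-Library.Function_Algebras"
    "HOL-Library.Cardinality"
begin

section \<open>Group actions and cohomology\<close>

text \<open>
  The groups \<open>G\<close> and \<open>C\<^sub>p\<close> are the finite types \<open>'g\<close> and \<open>'c\<close>. Their operation is written
  additively, so \<open>0\<close> is the identity element and \<open>a + b\<close> is the product of \<open>a\<close> and \<open>b\<close>.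
  The term \<open>act a x\<close> stands for the right action of \<open>x\<close> on \<open>a\<close>.
\<close>

definition elementary_abelian :: "nat \<Rightarrow> 'g::ab_group_add itself \<Rightarrow> bool" where
  "elementary_abelian p _ \<longleftrightarrow> (\<forall>a::'g. (\<Sum>i<p. a) = 0)"

definition group_auts :: "('a::group_add \<Rightarrow> 'a) set" where
  "group_auts = {f. bij f \<and> (\<forall>a b. f (a + b) = f a + f b)}"

definition is_action :: "('g::group_add \<Rightarrow> 'c::group_add \<Rightarrow> 'g) \<Rightarrow> bool" where
  "is_action act \<longleftrightarrow>
     (\<forall>a. act a 0 = a) \<and>
     (\<forall>a x y. act a (x + y) = act (act a x) y) \<and>
     (\<forall>a b x. act (a + b) x = act a x + act b x)"

definition act_twist :: "('g \<Rightarrow> 'c \<Rightarrow> 'g) \<Rightarrow> ('c \<Rightarrow> 'c) \<Rightarrow> 'g \<Rightarrow> 'c \<Rightarrow> 'g" where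
  "act_twist act \<alpha> a x = act a (\<alpha> x)"

definition module_isomorphic ::
  "('g::group_add \<Rightarrow> 'c::group_add \<Rightarrow> 'g) \<Rightarrow> ('g \<Rightarrow> 'c \<Rightarrow> 'g) \<Rightarrow> bool" where
  "module_isomorphic act act' \<longleftrightarrow>
     (\<exists>\<psi>\<in>group_auts. \<forall>a x. \<psi> (act a x) = act' (\<psi> a) x)"

definition act_class ::
  "('g::group_add \<Rightarrow> 'c::group_add \<Rightarrow> 'g) \<Rightarrow> ('g \<Rightarrow> 'c \<Rightarrow> 'g) set" where
  "act_class act =
     {act'. is_action act' \<and> (\<exists>\<alpha>\<in>group_auts. module_isomorphic act' (act_twist act \<alpha>))}"

definition Z2c ::
  "('g::group_add \<Rightarrow> 'c::group_add \<Rightarrow> 'g) \<Rightarrow> ('c \<Rightarrow> 'g \<Rightarrow> 'g \<Rightarrow> 'k::field) set" where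
  "Z2c act = {\<tau>.
     (\<forall>x a b. \<tau> x a b \<noteq> 0) \<and>
     (\<forall>x a b. x = 0 \<or> a = 0 \<or> b = 0 \<longrightarrow> \<tau> x a b = 1) \<and>
     (\<forall>x a b c. \<tau> x a (b + c) * \<tau> x b c = \<tau> x (a + b) c * \<tau> x a b) \<and>
     (\<forall>x y a b. \<tau> (x + y) a b = \<tau> x a b * \<tau> y (act a x) (act b x))}"

definition cochains1 :: "('c::group_add \<Rightarrow> 'g::group_add \<Rightarrow> 'k::field) set" where
  "cochains1 = {\<eta>. (\<forall>x a. \<eta> x a \<noteq> 0) \<and> (\<forall>x a. x = 0 \<or> a = 0 \<longrightarrow> \<eta> x a = 1)}"

definition delta_G :: "('c \<Rightarrow> 'g::group_add \<Rightarrow> 'k::field) \<Rightarrow> 'c \<Rightarrow> 'g \<Rightarrow> 'g \<Rightarrow> 'k" where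
  "delta_G \<eta> x a b = \<eta> x a * \<eta> x b * inverse (\<eta> x (a + b))"

definition B2c ::
  "('g::group_add \<Rightarrow> 'c::group_add \<Rightarrow> 'g) \<Rightarrow> ('c \<Rightarrow> 'g \<Rightarrow> 'g \<Rightarrow> 'k::field) set" where
  "B2c act = delta_G ` {\<eta> \<in> cochains1. \<forall>x y a. \<eta> (x + y) a = \<eta> x a * \<eta> y (act a x)}"

definition B2cc ::
  "('g::group_add \<Rightarrow> 'c::group_add \<Rightarrow> 'g) \<Rightarrow> ('c \<Rightarrow> 'g \<Rightarrow> 'g \<Rightarrow> 'k::field) set" where
  "B2cc act = delta_G ` cochains1 \<inter> Z2c act"

definition Z2c_group ::
  "('g::group_add \<Rightarrow> 'c::group_add \<Rightarrow> 'g) \<Rightarrow> ('c \<Rightarrow> 'g \<Rightarrow> 'g \<Rightarrow> 'k::field) monoid" where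
  "Z2c_group act = \<lparr>carrier = Z2c act, monoid.mult = (*), one = 1\<rparr>"

definition H2c ::
  "('g::group_add \<Rightarrow> 'c::group_add \<Rightarrow> 'g) \<Rightarrow> ('c \<Rightarrow> 'g \<Rightarrow> 'g \<Rightarrow> 'k::field) set monoid" where
  "H2c act = Z2c_group act Mod B2c act"

definition H2cc ::
  "('g::group_add \<Rightarrow> 'c::group_add \<Rightarrow> 'g) \<Rightarrow> ('c \<Rightarrow> 'g \<Rightarrow> 'g \<Rightarrow> 'k::field) set monoid" where
  "H2cc act = (Z2c_group act)\<lparr>carrier := B2cc act\<rparr> Mod B2c act"

lemma carrier_H2cc_subset: "carrier (H2cc act) \<subseteq> carrier (H2c act)"
  by (auto simp: H2cc_def H2c_def FactGroup_def RCOSETS_def r_coset_def B2cc_def Z2c_group_def)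

text \<open>
  Composition \<open>(\<circ>)\<close> is the opposite of the product of automorphisms written on the right, which
  makes \<open>twist\<close> a left action of \<open>aut_group act\<close>. Its orbits are those of the right action
  \<open>\<tau>.\<lambda>\<close>.
\<close>

definition aut_group ::
  "('g::group_add \<Rightarrow> 'c::group_add \<Rightarrow> 'g) \<Rightarrow> ('g \<Rightarrow> 'g) monoid" where
  "aut_group act =
     \<lparr>carrier = {l \<in> group_auts. \<forall>a x. l (act a x) = act (l a) x}, monoid.mult = (\<circ>), one = id\<rparr>"

definition twist ::
  "('g \<Rightarrow> 'g) \<Rightarrow> ('c \<Rightarrow> 'g \<Rightarrow> 'g \<Rightarrow> 'k) \<Rightarrow> 'c \<Rightarrow> 'g \<Rightarrow> 'g \<Rightarrow> 'k" where
  "twist l \<tau> x a b = \<tau> x (inv_into UNIV l a) (inv_into UNIV l b)"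

definition H2cc_orbits ::
  "('g::group_add \<Rightarrow> 'c::group_add \<Rightarrow> 'g) \<Rightarrow> ('c \<Rightarrow> 'g \<Rightarrow> 'g \<Rightarrow> 'k::field) set set set" where
  "H2cc_orbits act =
     orbits (aut_group act) (carrier (H2cc act)) (\<lambda>l. image (twist l))"


section \<open>Finite-dimensional Hopf algebras\<close>

text \<open>
  A vector space with a chosen finite basis indexed by \<open>'b\<close> is the space \<open>'b \<Rightarrow> 'k\<close>. The tensor
  product of \<open>'b \<Rightarrow> 'k\<close> and \<open>'d \<Rightarrow> 'k\<close> is \<open>'b \<times> 'd \<Rightarrow> 'k\<close>, where \<open>u \<otimes> v\<close> is \<open>tensor u v\<close>.
\<close>

definition scale :: "'k::field \<Rightarrow> ('b \<Rightarrow> 'k) \<Rightarrow> 'b \<Rightarrow> 'k" where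
  "scale r u = (\<lambda>i. r * u i)"

definition basis_vec :: "'b \<Rightarrow> 'b \<Rightarrow> 'k::field" where
  "basis_vec i = (\<lambda>j. if j = i then 1 else 0)"

abbreviation klinear :: "(('b \<Rightarrow> 'k::field) \<Rightarrow> ('d \<Rightarrow> 'k)) \<Rightarrow> bool" where
  "klinear \<equiv> Vector_Spaces.linear scale scale"

abbreviation klinear_form :: "(('b \<Rightarrow> 'k::field) \<Rightarrow> 'k) \<Rightarrow> bool" where
  "klinear_form \<equiv> Vector_Spaces.linear scale (*)"

definition tensor :: "('b \<Rightarrow> 'k::field) \<Rightarrow> ('d \<Rightarrow> 'k) \<Rightarrow> 'b \<times> 'd \<Rightarrow> 'k" where
  "tensor u v = (\<lambda>(i, j). u i * v j)"

text \<open>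
  The linear map on the tensor product that is induced by a bilinear map \<open>\<beta>\<close>.
\<close>

definition tensor_lift ::
  "(('b::finite \<Rightarrow> 'k::field) \<Rightarrow> ('d::finite \<Rightarrow> 'k) \<Rightarrow> 'e \<Rightarrow> 'k) \<Rightarrow> ('b \<times> 'd \<Rightarrow> 'k) \<Rightarrow> 'e \<Rightarrow> 'k" where
  "tensor_lift \<beta> t =
     (\<Sum>i\<in>UNIV. \<Sum>j\<in>UNIV. scale (t (i, j)) (\<beta> (basis_vec i) (basis_vec j)))"

definition tensor_map ::
  "(('b::finite \<Rightarrow> 'k::field) \<Rightarrow> 'b' \<Rightarrow> 'k) \<Rightarrow> (('d::finite \<Rightarrow> 'k) \<Rightarrow> 'd' \<Rightarrow> 'k) \<Rightarrow>
     ('b \<times> 'd \<Rightarrow> 'k) \<Rightarrow> 'b' \<times> 'd' \<Rightarrow> 'k" where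
  "tensor_map F F' = tensor_lift (\<lambda>u v. tensor (F u) (F' v))"

definition tensor_assoc :: "(('b \<times> 'd) \<times> 'e \<Rightarrow> 'k) \<Rightarrow> 'b \<times> ('d \<times> 'e) \<Rightarrow> 'k" where
  "tensor_assoc t = (\<lambda>(i, (j, l)). t ((i, j), l))"

definition tensor_swap :: "('b \<times> 'd \<Rightarrow> 'k) \<Rightarrow> 'd \<times> 'b \<Rightarrow> 'k" where
  "tensor_swap t = (\<lambda>(j, i). t (i, j))"

record ('b, 'k) hopf =
  hmul :: "('b \<Rightarrow> 'k) \<Rightarrow> ('b \<Rightarrow> 'k) \<Rightarrow> 'b \<Rightarrow> 'k"
  hone :: "'b \<Rightarrow> 'k"
  hcomul :: "('b \<Rightarrow> 'k) \<Rightarrow> 'b \<times> 'b \<Rightarrow> 'k"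
  hcounit :: "('b \<Rightarrow> 'k) \<Rightarrow> 'k"

definition tensor_mul ::
  "('b::finite, 'k::field) hopf \<Rightarrow> ('b \<times> 'b \<Rightarrow> 'k) \<Rightarrow> ('b \<times> 'b \<Rightarrow> 'k) \<Rightarrow> 'b \<times> 'b \<Rightarrow> 'k" where
  "tensor_mul H s t =
     tensor_lift (\<lambda>u v. tensor_lift (\<lambda>u' v'. tensor (hmul H u u') (hmul H v v')) t) s"

definition is_algebra :: "('b::finite, 'k::field) hopf \<Rightarrow> bool" where
  "is_algebra H \<longleftrightarrow>
     (\<forall>u. klinear (hmul H u)) \<and> (\<forall>v. klinear (\<lambda>u. hmul H u v)) \<and>
     (\<forall>u v w. hmul H (hmul H u v) w = hmul H u (hmul H v w)) \<and>
     (\<forall>u. hmul H (hone H) u = u) \<and> (\<forall>u. hmul H u (hone H) = u)"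

definition is_coalgebra :: "('b::finite, 'k::field) hopf \<Rightarrow> bool" where
  "is_coalgebra H \<longleftrightarrow>
     klinear (hcomul H) \<and> klinear_form (hcounit H) \<and>
     (\<forall>u. tensor_assoc (tensor_map (hcomul H) id (hcomul H u)) =
          tensor_map id (hcomul H) (hcomul H u)) \<and>
     (\<forall>u. tensor_lift (\<lambda>v w. scale (hcounit H v) w) (hcomul H u) = u) \<and>
     (\<forall>u. tensor_lift (\<lambda>v w. scale (hcounit H w) v) (hcomul H u) = u)"

definition is_antipode ::
  "('b::finite, 'k::field) hopf \<Rightarrow> (('b \<Rightarrow> 'k) \<Rightarrow> 'b \<Rightarrow> 'k) \<Rightarrow> bool" where
  "is_antipode H S \<longleftrightarrow>
     klinear S \<and>
     (\<forall>u. tensor_lift (\<lambda>v w. hmul H (S v) w) (hcomul H u) = scale (hcounit H u) (hone H)) \<and>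
     (\<forall>u. tensor_lift (\<lambda>v w. hmul H v (S w)) (hcomul H u) = scale (hcounit H u) (hone H))"

definition is_hopf_algebra :: "('b::finite, 'k::field) hopf \<Rightarrow> bool" where
  "is_hopf_algebra H \<longleftrightarrow>
     is_algebra H \<and> is_coalgebra H \<and>
     (\<forall>u v. hcomul H (hmul H u v) = tensor_mul H (hcomul H u) (hcomul H v)) \<and>
     hcomul H (hone H) = tensor (hone H) (hone H) \<and>
     (\<forall>u v. hcounit H (hmul H u v) = hcounit H u * hcounit H v) \<and>
     hcounit H (hone H) = 1 \<and>
     (\<exists>S. is_antipode H S)"

definition cocommutative :: "('b::finite, 'k::field) hopf \<Rightarrow> bool" where
  "cocommutative H \<longleftrightarrow> (\<forall>u. tensor_swap (hcomul H u) = hcomul H u)"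

definition hopf_hom ::
  "('b::finite, 'k::field) hopf \<Rightarrow> ('d::finite, 'k) hopf \<Rightarrow> (('b \<Rightarrow> 'k) \<Rightarrow> 'd \<Rightarrow> 'k) set" where
  "hopf_hom H H' = {F.
     klinear F \<and>
     (\<forall>u v. F (hmul H u v) = hmul H' (F u) (F v)) \<and> F (hone H) = hone H' \<and>
     (\<forall>u. hcomul H' (F u) = tensor_map F F (hcomul H u)) \<and> (\<forall>u. hcounit H' (F u) = hcounit H u)}"

definition hopf_iso ::
  "('b::finite, 'k::field) hopf \<Rightarrow> ('d::finite, 'k) hopf \<Rightarrow> (('b \<Rightarrow> 'k) \<Rightarrow> 'd \<Rightarrow> 'k) set" where
  "hopf_iso H H' = {F \<in> hopf_hom H H'. bij F}"

definition fun_hopf :: "('g::{finite, group_add}, 'k::field) hopf" where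
  "fun_hopf = \<lparr>
     hmul = (*),
     hone = 1,
     hcomul = (\<lambda>f (a, b). f (a + b)),
     hcounit = (\<lambda>f. f 0)\<rparr>"

definition group_hopf :: "('c::{finite, group_add}, 'k::field) hopf" where
  "group_hopf = \<lparr>
     hmul = (\<lambda>f f'. \<Sum>x\<in>UNIV. \<Sum>y\<in>UNIV. scale (f x * f' y) (basis_vec (x + y))),
     hone = basis_vec 0,
     hcomul = (\<lambda>f. \<Sum>x\<in>UNIV. scale (f x) (tensor (basis_vec x) (basis_vec x))),
     hcounit = (\<lambda>f. \<Sum>x\<in>UNIV. f x)\<rparr>"


section \<open>Extensions of the group algebra of \<open>C\<^sub>p\<close> by the function algebra of \<open>G\<close>\<close>

text \<open>
  The middle term of such an extension has dimension \<open>|C\<^sub>p| |G|\<close>, so a basis indexed by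
  \<open>'c \<times> 'g\<close> can be chosen for it.
\<close>

record ('c, 'g, 'k) hopf_ext =
  ext_hopf :: "('c \<times> 'g, 'k) hopf"
  ext_inc :: "('g \<Rightarrow> 'k) \<Rightarrow> 'c \<times> 'g \<Rightarrow> 'k"
  ext_proj :: "('c \<times> 'g \<Rightarrow> 'k) \<Rightarrow> 'c \<Rightarrow> 'k"

text \<open>
  Stability under the left and right adjoint actions. The antipode is unique, so the quantifier
  over \<open>S\<close> only gives it a name.
\<close>

definition hopf_normal :: "('b::finite, 'k::field) hopf \<Rightarrow> ('b \<Rightarrow> 'k) set \<Rightarrow> bool" where
  "hopf_normal H A \<longleftrightarrow>
     (\<exists>S. is_antipode H S \<and>
       (\<forall>h. \<forall>a\<in>A.
         tensor_lift (\<lambda>v w. hmul H (hmul H v a) (S w)) (hcomul H h) \<in> A \<and>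
         tensor_lift (\<lambda>v w. hmul H (hmul H (S v) a) w) (hcomul H h) \<in> A))"

definition aug_ideal :: "('b::finite, 'k::field) hopf \<Rightarrow> ('b \<Rightarrow> 'k) set \<Rightarrow> ('b \<Rightarrow> 'k) set" where
  "aug_ideal H A = module.span scale {hmul H a h | a h. a \<in> A \<and> hcounit H a = 0}"

definition is_extension ::
  "('c::{finite, group_add}, 'g::{finite, group_add}, 'k::field) hopf_ext \<Rightarrow> bool" where
  "is_extension E \<longleftrightarrow>
     is_hopf_algebra (ext_hopf E) \<and>
     ext_inc E \<in> hopf_hom fun_hopf (ext_hopf E) \<and> inj (ext_inc E) \<and>
     ext_proj E \<in> hopf_hom (ext_hopf E) group_hopf \<and> surj (ext_proj E) \<and>
     hopf_normal (ext_hopf E) (range (ext_inc E)) \<and>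
     {u. ext_proj E u = 0} = aug_ideal (ext_hopf E) (range (ext_inc E))"

definition ext_equiv ::
  "(('c::{finite, group_add}, 'g::{finite, group_add}, 'k::field) hopf_ext \<times> ('c, 'g, 'k) hopf_ext) set"
  where
  "ext_equiv = {(E, E'). is_extension E \<and> is_extension E' \<and>
     (\<exists>F\<in>hopf_iso (ext_hopf E) (ext_hopf E').
        F \<circ> ext_inc E = ext_inc E' \<and> ext_proj E' \<circ> F = ext_proj E)}"

text \<open>The element \<open>f x\<close> of the crossed product, for \<open>f\<close> in the function algebra.\<close>

definition bar :: "('g \<Rightarrow> 'k::field) \<Rightarrow> 'c \<Rightarrow> 'c \<times> 'g \<Rightarrow> 'k" where
  "bar f x = (\<lambda>(y, a). if y = x then f a else 0)"

definition coeff_at :: "('c \<times> 'g \<Rightarrow> 'k) \<Rightarrow> 'c \<Rightarrow> 'g \<Rightarrow> 'k" where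
  "coeff_at u x = (\<lambda>a. u (x, a))"

definition bullet :: "('g \<Rightarrow> 'c \<Rightarrow> 'g) \<Rightarrow> 'c \<Rightarrow> ('g \<Rightarrow> 'k) \<Rightarrow> 'g \<Rightarrow> 'k" where
  "bullet act x f = (\<lambda>a. f (act a x))"

text \<open>
  In the comultiplication, the scalar \<open>u (x, a + b)\<close> comes from
  \<open>f\<^sub>1 p\<^sub>a \<otimes> f\<^sub>2 p\<^sub>b = f (a + b) \<cdot> p\<^sub>a \<otimes> p\<^sub>b\<close>.
\<close>

definition crossed_hopf ::
  "('c::{finite, group_add} \<Rightarrow> 'g::{finite, group_add} \<Rightarrow> 'g \<Rightarrow> 'k::field) \<Rightarrow>
     ('g \<Rightarrow> 'c \<Rightarrow> 'g) \<Rightarrow> ('c \<times> 'g, 'k) hopf" where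
  "crossed_hopf \<tau> act = \<lparr>
     hmul = (\<lambda>u v. \<Sum>x\<in>UNIV. \<Sum>y\<in>UNIV.
       bar (coeff_at u x * bullet act x (coeff_at v y)) (x + y)),
     hone = bar 1 0,
     hcomul = (\<lambda>u. \<Sum>x\<in>UNIV. \<Sum>a\<in>UNIV. \<Sum>b\<in>UNIV.
       scale (\<tau> x a b * u (x, a + b)) (tensor (bar (basis_vec a) x) (bar (basis_vec b) x))),
     hcounit = (\<lambda>u. \<Sum>x\<in>UNIV. u (x, 0))\<rparr>"

definition crossed_ext ::
  "('c::{finite, group_add} \<Rightarrow> 'g::{finite, group_add} \<Rightarrow> 'g \<Rightarrow> 'k::field) \<Rightarrow>
     ('g \<Rightarrow> 'c \<Rightarrow> 'g) \<Rightarrow> ('c, 'g, 'k) hopf_ext" where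
  "crossed_ext \<tau> act = \<lparr>
     ext_hopf = crossed_hopf \<tau> act,
     ext_inc = (\<lambda>f. bar f 0),
     ext_proj = (\<lambda>u x. u (x, 0))\<rparr>"

definition Ext_class ::
  "('g::{finite, group_add} \<Rightarrow> 'c::{finite, group_add} \<Rightarrow> 'g) \<Rightarrow>
     ('c, 'g, 'k::field) hopf_ext set set" where
  "Ext_class act =
     {ext_equiv `` {crossed_ext \<tau> act'} | \<tau> act'. act' \<in> act_class act \<and> \<tau> \<in> Z2c act'}"

definition cocomm_Ext_class ::
  "('g::{finite, group_add} \<Rightarrow> 'c::{finite, group_add} \<Rightarrow> 'g) \<Rightarrow>
     ('c, 'g, 'k::field) hopf_ext set set" where
  "cocomm_Ext_class act = {X \<in> Ext_class act. \<exists>E\<in>X. cocommutative (ext_hopf E)}"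

definition ext_isomorphic ::
  "(('c::finite, 'g::finite, 'k::field) hopf_ext set \<times> ('c, 'g, 'k) hopf_ext set) set" where
  "ext_isomorphic =
     {(X, Y). \<exists>E\<in>X. \<exists>E'\<in>Y. hopf_iso (ext_hopf E) (ext_hopf E') \<noteq> {}}"

definition cocomm_iso_classes ::
  "('g::{finite, group_add} \<Rightarrow> 'c::{finite, group_add} \<Rightarrow> 'g) \<Rightarrow>
     ('c, 'g, 'k::field) hopf_ext set set set" where
  "cocomm_iso_classes act =
     cocomm_Ext_class act //
       (ext_isomorphic \<inter> cocomm_Ext_class act \<times> cocomm_Ext_class act)"

end

theory Submission
  imports Defs "HOL-Computational_Algebra.Primes"
begin

text \<open>
  A cocommutative crossed product is controlled by its group-like elements: pairs of
  \<open>x \<in> C\<^sub>p\<close> and a function \<open>w\<close> on \<open>G\<close> whose coboundary is \<open>\<tau>(x, -, -)\<close>. They form a group extension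
  of \<open>C\<^sub>p\<close> by the character group of \<open>G\<close>. Fix a generator \<open>g\<close> of \<open>C\<^sub>p\<close>. The \<open>p\<close>-th power
  of a lift of \<open>g\<close> is an invariant character, and it determines the class of \<open>\<tau>\<close>. An isomorphism
  that does not preserve the characters makes both extensions split, because a lift of a
  generator then has \<open>p\<close>-th power \<open>1\<close>. An isomorphism that preserves them preserves the height of this
  invariant character with respect to \<open>N = g - 1\<close>, although it may replace \<open>g\<close> by a multiple of \<open>g\<close>.
  Finally, two invariant characters of the same height differ by a \<open>C\<^sub>p\<close>-linear automorphism of \<open>G\<close>.
\<close>

section \<open>Multiples in groups of prime exponent, and symmetric cocycles\<close>

text \<open>The obstacle is that a Hopf algebra isomorphism need not respect the inclusion and the
  projection of the extensions, so it does not directly induce a map of cohomology classes. The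
  proof uses what survives any isomorphism: group-like elements, their products and their powers. In
  the cocommutative case there are lifts over every element of C_p, because the cocycle is then
  symmetric on \<open>G\<close>, and over an algebraically closed field a symmetric cocycle is a
  coboundary. The same eigenvector argument extends characters from subgroups of \<open>G\<close>.
  The \<open>p\<close>-th power of a lift is not unique: another lift multiplies it by a norm. The
  proof therefore follows one lift and its image under the isomorphism. Powers of \<open>N\<close>
  are the right measure because, with C_p written multiplicatively, g^k - 1 is a multiple of g - 1
  in the group ring, and because \<open>N\<close> is nilpotent on a group of exponent
  \<open>p\<close>.\<close>

definition nmul :: "nat \<Rightarrow> 'a::ab_group_add \<Rightarrow> 'a" where
  "nmul n a = (\<Sum>i<n. a)"

lemma nmul_0 [simp]: "nmul 0 a = 0"
  and nmul_Suc: "nmul (Suc n) a = nmul n a + a"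
  and nmul_1 [simp]: "nmul (Suc 0) a = a"
  and nmul_zero [simp]: "nmul n 0 = 0"
  and nmul_plus_right: "nmul n (a + b) = nmul n a + nmul n b"
  by (simp_all add: nmul_def sum.distrib)

lemma nmul_plus_left: "nmul (m + n) a = nmul m a + nmul n a"
  by (induction n) (simp_all add: nmul_Suc add.assoc)

lemma nmul_mult: "nmul (m * n) a = nmul m (nmul n a)"
  by (induction m) (simp_all add: nmul_Suc nmul_plus_left add.commute)

lemma nmul_mod:
  assumes "nmul p a = 0"
  shows "nmul (n mod p) a = nmul n a"
proof -
  have "nmul n a = nmul (n div p * p + n mod p) a" by simp
  also have "\<dots> = nmul (n mod p) a"
    by (simp only: nmul_plus_left nmul_mult assms nmul_zero add_0)
  finally show ?thesis ..
qed

lemma additive_zero: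
  fixes f :: "'a::ab_group_add \<Rightarrow> 'b::ab_group_add"
  assumes "\<And>a b. f (a + b) = f a + f b"
  shows "f 0 = 0"
  using assms[of 0 0] by simp

lemma additive_nmul:
  assumes "\<And>a b. f (a + b) = f a + f b"
  shows "f (nmul n a) = nmul n (f a)"
  by (induction n) (simp_all add: nmul_Suc assms additive_zero[of f, OF assms])

lemma nmul_eq_0_dvd:
  assumes "prime p" "nmul p a = 0" "nmul n a = 0" "a \<noteq> 0"
  shows "p dvd n"
proof (rule ccontr)
  assume "\<not> p dvd n"
  then have "coprime n p"
    using prime_imp_coprime[OF assms(1)] coprime_commute[of n p] by simp
  moreover have "n \<noteq> 0"
  proof
    assume "n = 0"
    then show False using \<open>\<not> p dvd n\<close> by simp
  qed
  ultimately obtain x y where "n * x = p * y + 1"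
    using bezout_nat[of n p] by auto
  then have "nmul (x * n) a = nmul (y * p + 1) a" by (simp add: mult.commute)
  then show False
    by (simp add: nmul_plus_left nmul_mult nmul_Suc assms)
qed

lemma inverse_mod_prime:
  assumes "prime (p::nat)" "\<not> p dvd n"
  obtains k where "k * n mod p = 1"
proof -
  have "coprime n p"
    using prime_imp_coprime[OF assms] coprime_commute[of n p] by simp
  moreover have "n \<noteq> 0"
  proof
    assume "n = 0"
    then show False using assms(2) by simp
  qed
  ultimately obtain x y where "n * x = p * y + 1"
    using bezout_nat[of n p] by auto
  then have "x * n mod p = 1"
    by (simp only: mult.commute[of x] mod_mult_self4)
      (use prime_gt_1_nat[OF assms(1)] in simp)
  then show ?thesis by (rule that)
qed

text \<open>Translation by \<open>x\<close> permutes the finite group, so the sum of all elements is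
  unchanged when every summand is increased by \<open>x\<close>; cancelling that sum leaves the
  multiple of \<open>x\<close>.\<close>

lemma nmul_CARD: "nmul CARD('a) (x::'a::{finite,ab_group_add}) = 0"
proof -
  have "(\<Sum>y\<in>(UNIV::'a set). y + x) = (\<Sum>y\<in>(UNIV::'a set). y)"
    by (rule sum.reindex_bij_witness[of _ "\<lambda>y. y - x" "\<lambda>y. y + x"]) auto
  then have "(\<Sum>y\<in>(UNIV::'a set). x) = 0" by (simp add: sum.distrib)
  moreover have "(\<Sum>y\<in>(UNIV::'a set). x) = nmul CARD('a) x"
  proof -
    \<comment> \<open>An enumeration of the type turns the constant sum over its elements into the
      sum over an initial segment that defines \<open>nmul\<close>.\<close>
    obtain h where h: "bij_betw h {..<CARD('a)} (UNIV::'a set)"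
      using ex_bij_betw_nat_finite[of "UNIV::'a set"] by (auto simp: atLeast0LessThan)
    show ?thesis unfolding nmul_def using sum.reindex_bij_betw[OF h, of "\<lambda>_. x"] by simp
  qed
  ultimately show ?thesis by simp
qed

lemma nmul_eq_imp_mod_eq:
  assumes "prime p" "nmul p a = 0" "a \<noteq> 0" "nmul m a = nmul n a"
  shows "m mod p = n mod p"
proof -
  have *: "m mod p = n mod p" if "nmul m a = nmul n a" "m \<le> n" for m n
  proof -
    have "nmul n a = nmul m a + nmul (n - m) a"
      using that(2) by (metis le_add_diff_inverse nmul_plus_left)
    then have "p dvd n - m"
      using nmul_eq_0_dvd[OF assms(1,2) _ assms(3)] that(1) by simp
    then show ?thesis using that(2) by (metis mod_eq_dvd_iff_nat)
  qed
  show ?thesis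
  proof (cases "m \<le> n")
    case True
    then show ?thesis by (rule *[OF assms(4)])
  next
    case False
    then show ?thesis using *[OF assms(4)[symmetric]] by simp
  qed
qed

text \<open>The multiples of \<open>g\<close> by numbers below the prime order are pairwise
  distinct, so by counting they exhaust the group.\<close>

lemma prime_card_generated:
  fixes g :: "'c::{finite,ab_group_add}"
  assumes "prime CARD('c)" "g \<noteq> 0"
  obtains i where "nmul i g = x"
proof -
  let ?h = "\<lambda>i. nmul i g"
  have "inj_on ?h {..<CARD('c)}"
    by (rule inj_onI) (use nmul_eq_imp_mod_eq[OF assms(1) nmul_CARD assms(2)] in fastforce)
  then have "card (?h ` {..<CARD('c)}) = CARD('c)" by (simp add: card_image)
  then have "?h ` {..<CARD('c)} = UNIV" by (simp add: card_eq_UNIV_imp_eq_UNIV)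
  then show ?thesis using that by (metis UNIV_I imageE)
qed

section \<open>Twisted translations, their common eigenvectors and symmetric cocycles\<close>

definition twisted_shift :: "('g::ab_group_add \<Rightarrow> 'g \<Rightarrow> 'k::field) \<Rightarrow> 'g \<Rightarrow> ('g \<Rightarrow> 'k) \<Rightarrow> 'g \<Rightarrow> 'k" where
  "twisted_shift f a v = (\<lambda>b. f a b * v (a + b))"

definition symmetric_cocycle :: "('g::ab_group_add \<Rightarrow> 'g \<Rightarrow> 'k::field) \<Rightarrow> bool" where
  "symmetric_cocycle f \<longleftrightarrow>
     (\<forall>a b. f a b \<noteq> 0) \<and> (\<forall>a. f 0 a = 1) \<and> (\<forall>a b. f a b = f b a) \<and>
     (\<forall>a b c. f a (b + c) * f b c = f (a + b) c * f a b)"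

text \<open>A minimal polynomial argument: a nonzero polynomial \<open>h\<close> of least degree
  that annihilates \<open>v\<close> under \<open>L\<close> is not constant. Splitting off a root
  \<open>r\<close> leaves \<open>h'\<close>; then h'(L) v is nonzero by minimality and is an
  eigenvector for \<open>r\<close>. The predicate \<open>W\<close> stands for an
  \<open>L\<close>-invariant subspace containing \<open>v\<close>. In the application it keeps the
  eigenvalues already found for other operators.\<close>

lemma eigenvector_of_annihilator:
  fixes L :: "('g \<Rightarrow> 'k::alg_closed_field) \<Rightarrow> 'g \<Rightarrow> 'k"
  assumes add: "\<And>u v. L (\<lambda>b. u b + v b) = (\<lambda>b. L u b + L v b)"
    and scl: "\<And>r u. L (\<lambda>b. r * u b) = (\<lambda>b. r * L u b)"
    and ann: "(L ^^ n) v = (\<lambda>b. q * v b)" "0 < n"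
    and v: "v b0 \<noteq> 0"
    and W: "W v" "\<And>u w. W u \<Longrightarrow> W w \<Longrightarrow> W (\<lambda>b. u b + w b)" "\<And>r u. W u \<Longrightarrow> W (\<lambda>b. r * u b)"
      "\<And>u. W u \<Longrightarrow> W (L u)"
  obtains r w where "W w" "L w = (\<lambda>b. r * w b)" "w \<noteq> (\<lambda>_. 0)"
proof -
  \<comment> \<open>\<open>A h\<close> is h(L) v. The fixed summation range makes it linear in
    \<open>h\<close> term by term, but it sees all coefficients only if
    \<open>degree h \<le> n\<close>, hence the bound in \<open>P\<close>.\<close>
  define A where "A h = (\<lambda>b. \<Sum>i\<le>n. coeff h i * (L ^^ i) v b)" for h :: "'k poly"
  have Lsum: "L (\<lambda>b. \<Sum>i\<le>m. c i * u i b) = (\<lambda>b. \<Sum>i\<le>m. c i * L (u i) b)" for m c and u :: "nat \<Rightarrow> 'g \<Rightarrow> 'k"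
  proof (induction m)
    case (Suc m)
    have "L (\<lambda>b. \<Sum>i\<le>Suc m. c i * u i b) = L (\<lambda>b. (\<Sum>i\<le>m. c i * u i b) + c (Suc m) * u (Suc m) b)"
      by (simp only: sum.atMost_Suc)
    also have "\<dots> = (\<lambda>b. L (\<lambda>b. \<Sum>i\<le>m. c i * u i b) b + L (\<lambda>b. c (Suc m) * u (Suc m) b) b)"
      by (rule add)
    finally show ?case by (simp only: Suc scl sum.atMost_Suc)
  qed (simp add: scl)
  have LA: "L (A h) = A (pCons 0 h)" if "degree h < n" for h
  proof -
    obtain m where m: "n = Suc m" using ann(2) by (cases n) auto
    have "coeff h (Suc m) = 0" using that by (simp add: coeff_eq_0 m)
    then have "L (A h) = (\<lambda>b. \<Sum>i\<le>m. coeff h i * L ((L ^^ i) v) b)"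
      unfolding A_def Lsum by (simp add: m)
    also have "\<dots> = A (pCons 0 h)"
      unfolding A_def m sum.atMost_Suc_shift by simp
    finally show ?thesis .
  qed
  define P where "P h \<longleftrightarrow> h \<noteq> 0 \<and> degree h \<le> n \<and> A h = (\<lambda>_. 0)" for h
  \<comment> \<open>The hypothesis on the \<open>n\<close>-th iterate says that X^n - q annihilates
    \<open>v\<close>.\<close>
  have "P (monom 1 n - [:q:])"
  proof -
    have "coeff (monom 1 n - [:q:]) n = 1" using ann(2) by (cases n) auto
    then have "monom 1 n - [:q:] \<noteq> 0" by (metis coeff_0 zero_neq_one)
    moreover have "degree (monom 1 n - [:q:]) \<le> n"
      by (rule degree_diff_le) (simp_all add: degree_monom_eq)
    moreover have "A (monom 1 n - [:q:]) = (\<lambda>_. 0)"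
    proof
      fix b
      have "A (monom 1 n - [:q:]) b =
          (\<Sum>i\<le>n. (if i = n then (L ^^ i) v b else 0)) - (\<Sum>i\<le>n. (if i = 0 then q * (L ^^ i) v b else 0))"
        unfolding A_def sum_subtractf[symmetric]
        by (intro sum.cong) (auto simp: coeff_pCons algebra_simps split: nat.splits)
      then show "A (monom 1 n - [:q:]) b = 0" by (simp add: ann)
    qed
    ultimately show ?thesis by (simp add: P_def)
  qed
  from ex_has_least_nat[of P, OF this, of degree]
  obtain h where h: "P h" and min: "\<And>h'. P h' \<Longrightarrow> degree h \<le> degree h'"
    by blast
  have "degree h > 0"
  proof (rule ccontr)
    assume "\<not> degree h > 0"
    then obtain c where c: "h = [:c:]" using degree_eq_zeroE by auto
    then have "A h b0 = (\<Sum>i\<le>n. if i = 0 then c * v b0 else 0)"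
      unfolding A_def by (intro sum.cong) (auto simp: coeff_pCons split: nat.splits)
    then show False using h c v by (simp add: P_def)
  qed
  then obtain r where r: "poly h r = 0" using alg_closed_imp_poly_has_root by blast
  then obtain h' where h': "h = [:- r, 1:] * h'" unfolding poly_eq_0_iff_dvd by (elim dvdE)
  have "h' \<noteq> 0" using h h' by (auto simp: P_def)
  then have deg: "degree h = Suc (degree h')" unfolding h' by (subst degree_mult_eq) auto
  have nz: "A h' \<noteq> (\<lambda>_. 0)"
    using min[of h'] deg h \<open>h' \<noteq> 0\<close> by (auto simp: P_def)
  have hh: "h = pCons 0 h' - smult r h'" unfolding h' by (simp add: algebra_simps)
  have "A h = (\<lambda>b. A (pCons 0 h') b - r * A h' b)"
    unfolding A_def hh
    by (simp add: sum_subtractf sum_distrib_left algebra_simps)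
  then have "L (A h') = (\<lambda>b. r * A h' b)"
    using LA[of h'] h deg by (auto simp: P_def fun_eq_iff)
  moreover have "W (A h')"
  proof -
    have it: "W ((L ^^ i) v)" for i by (induction i) (use W in auto)
    have "W (\<lambda>b. \<Sum>i\<le>m. coeff h' i * (L ^^ i) v b)" for m
    proof (induction m)
      case 0
      show ?case using W(3)[OF it[of 0], of "coeff h' 0"] by simp
    next
      case (Suc m)
      show ?case
        using W(2)[OF Suc W(3)[OF it[of "Suc m"], of "coeff h' (Suc m)"]]
        by (simp only: sum.atMost_Suc)
    qed
    then show ?thesis by (simp add: A_def)
  qed
  ultimately show ?thesis using nz by (intro that[of "A h'" r])
qed

text \<open>The twisted translations commute because \<open>f\<close> is symmetric, and the eigenvalues of a
  common eigenvector are the values of \<open>\<eta>\<close>.\<close>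

lemma symmetric_cocycle_extension:
  fixes f :: "'g::{finite,ab_group_add} \<Rightarrow> 'g \<Rightarrow> 'k::alg_closed_field"
  assumes f: "symmetric_cocycle f"
    and S: "0 \<in> S" "\<And>s t. s \<in> S \<Longrightarrow> t \<in> S \<Longrightarrow> s + t \<in> S" "\<And>s. s \<in> S \<Longrightarrow> - s \<in> S"
    and \<psi>: "\<psi> 0 = 1" "\<And>s t. s \<in> S \<Longrightarrow> t \<in> S \<Longrightarrow> \<psi> s * \<psi> t = f s t * \<psi> (s + t)"
  obtains \<eta> where "\<eta> 0 = 1" "\<And>a b. \<eta> a * \<eta> b = f a b * \<eta> (a + b)" "\<And>s. s \<in> S \<Longrightarrow> \<eta> s = \<psi> s"
proof -
  let ?L = "twisted_shift f"
  have f0: "f a b \<noteq> 0" and f1: "f 0 a = 1" and fs: "f a b = f b a"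
    and fc: "f a (b + c) * f b c = f (a + b) c * f a b" for a b c
    using f unfolding symmetric_cocycle_def by blast+
  \<comment> \<open>The cocycle identity makes the shifts a projective representation, the regular
    one of the twisted group algebra.\<close>
  have comp: "?L a (?L b v) = (\<lambda>c. f a b * ?L (a + b) v c)" for a b v
  proof
    fix c
    have "?L a (?L b v) c = (f b (a + c) * f a c) * v (b + (a + c))"
      by (simp add: twisted_shift_def)
    also have "f b (a + c) * f a c = f (b + a) c * f b a" by (rule fc)
    finally show "?L a (?L b v) c = f a b * ?L (a + b) v c"
      by (simp add: twisted_shift_def fs[of b a] algebra_simps)
  qed
  have comm: "?L a (?L b v) = ?L b (?L a v)" for a b v
    unfolding comp fs[of a b] by (simp add: add.commute)
  have L0: "?L 0 v = v" for v by (simp add: twisted_shift_def f1)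
  have scl: "?L a (\<lambda>b. r * u b) = (\<lambda>b. r * ?L a u b)" for a r u
    by (simp add: twisted_shift_def algebra_simps)
  have add: "?L a (\<lambda>b. u b + w b) = (\<lambda>b. ?L a u b + ?L a w b)" for a u w
    by (simp add: twisted_shift_def algebra_simps)
  have pow: "\<exists>q. (?L a ^^ n) v = (\<lambda>b. q * ?L (nmul n a) v b)" for a n v
  proof (induction n)
    case 0
    then show ?case by (auto intro: exI[of _ 1] simp: L0)
  next
    case (Suc n)
    then obtain q where "(?L a ^^ n) v = (\<lambda>b. q * ?L (nmul n a) v b)" by blast
    then have "(?L a ^^ Suc n) v = (\<lambda>b. (q * f a (nmul n a)) * ?L (nmul (Suc n) a) v b)"
      by (simp add: scl comp nmul_Suc add.commute mult.assoc)
    then show ?case by blast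
  qed
  define good where "good T \<mu> v \<longleftrightarrow> (\<exists>b. v b \<noteq> 0) \<and> (\<forall>a\<in>T. ?L a v = (\<lambda>b. \<mu> a * v b))"
    for T and \<mu> :: "'g \<Rightarrow> 'k" and v
  \<comment> \<open>Extended by zero outside the subgroup \<open>S\<close>, the function
    \<open>\<psi>\<close> is a common eigenvector of the shifts by \<open>S\<close>, with its own
    values as eigenvalues.\<close>
  have start: "good S \<psi> (\<lambda>b. if b \<in> S then \<psi> b else 0)"
  proof -
    have iff: "s + b \<in> S \<longleftrightarrow> b \<in> S" if "s \<in> S" for s b
      using S(2)[OF that, of b] S(2)[OF S(3)[OF that], of "s + b"] by auto
    show ?thesis
      unfolding good_def twisted_shift_def
      using S(1) \<psi> iff by (auto simp: fun_eq_iff intro!: exI[of _ 0])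
  qed
  \<comment> \<open>One shift is added at a time. It commutes with the earlier ones, so it acts on
    their joint eigenspace and has an eigenvector there. The case distinction below protects the
    prescribed values: an element of \<open>S\<close> must not receive a new eigenvalue.\<close>
  have "\<exists>\<mu> v. good (S \<union> T) \<mu> v \<and> (\<forall>s\<in>S. \<mu> s = \<psi> s)" for T
  proof (induction T rule: finite_induct[OF finite])
    case 1
    have "\<exists>v. good (S \<union> {}) \<psi> v \<and> (\<forall>s\<in>S. \<psi> s = \<psi> s)"
      unfolding Un_empty_right using start by blast
    then show ?case by (rule exI[of _ \<psi>])
  next
    case (2 a T)
    then obtain \<mu> v where g: "good (S \<union> T) \<mu> v" and l: "\<forall>s\<in>S. \<mu> s = \<psi> s" by blast
    show ?case
    proof (cases "a \<in> S")
      case True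
      then have "S \<union> insert a T = S \<union> T" by blast
      then have "\<exists>v. good (S \<union> insert a T) \<mu> v \<and> (\<forall>s\<in>S. \<mu> s = \<psi> s)"
        using g l by auto
      then show ?thesis by (rule exI[of _ \<mu>])
    next
      case False
      obtain b0 where b0: "v b0 \<noteq> 0" using g by (auto simp: good_def)
      \<comment> \<open>The group order annihilates \<open>a\<close>, so this power of the shift is
        a scalar, as \<open>eigenvector_of_annihilator\<close> requires.\<close>
      obtain q where "(?L a ^^ CARD('g)) v = (\<lambda>b. q * ?L (nmul CARD('g) a) v b)" using pow by blast
      then have q: "(?L a ^^ CARD('g)) v = (\<lambda>b. q * v b)" by (simp add: nmul_CARD L0)
      obtain r w where w: "\<forall>c\<in>S\<union>T. ?L c w = (\<lambda>b. \<mu> c * w b)" "?L a w = (\<lambda>b. r * w b)" "w \<noteq> (\<lambda>_. 0)"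
      proof (rule eigenvector_of_annihilator[where L = "?L a" and W = "\<lambda>w. \<forall>c\<in>S\<union>T. ?L c w = (\<lambda>b. \<mu> c * w b)"
            and v = v and n = "CARD('g)" and q = q])
        show "\<forall>c\<in>S\<union>T. ?L c v = (\<lambda>b. \<mu> c * v b)" using g by (simp add: good_def)
        show "\<forall>c\<in>S\<union>T. ?L c (?L a u) = (\<lambda>b. \<mu> c * ?L a u b)"
          if "\<forall>c\<in>S\<union>T. ?L c u = (\<lambda>b. \<mu> c * u b)" for u
          using that comm[of _ a u] by (simp add: scl)
      qed (use q b0 in \<open>auto simp: add scl algebra_simps\<close>)
      have "good (S \<union> insert a T) (\<mu>(a := r)) w"
        using w by (auto simp: good_def fun_eq_iff)
      moreover have "\<forall>s\<in>S. (\<mu>(a := r)) s = \<psi> s" using l False by auto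
      ultimately have "good (S \<union> insert a T) (\<mu>(a := r)) w \<and> (\<forall>s\<in>S. (\<mu>(a := r)) s = \<psi> s)"
        by (rule conjI)
      then have "\<exists>v. good (S \<union> insert a T) (\<mu>(a := r)) v \<and> (\<forall>s\<in>S. (\<mu>(a := r)) s = \<psi> s)"
        by (rule exI[of _ w])
      then show ?thesis by (rule exI[of _ "\<mu>(a := r)"])
    qed
  qed
  from this[of UNIV] obtain \<mu> v where g: "good (S \<union> UNIV) \<mu> v" and l: "\<forall>s\<in>S. \<mu> s = \<psi> s" by blast
  obtain b where b: "v b \<noteq> 0" using g unfolding good_def by blast
  have ev: "?L a v = (\<lambda>b. \<mu> a * v b)" for a using g unfolding good_def by blast
  have ev': "\<mu> a * \<mu> b' = f a b' * \<mu> (a + b')" for a b'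
  proof -
    \<comment> \<open>The double shift is evaluated in two ways at a point where \<open>v\<close>
      does not vanish, which allows \<open>v b\<close> to be cancelled.\<close>
    have "?L a (?L b' v) b = \<mu> a * \<mu> b' * v b" by (simp only: ev scl mult.assoc mult.left_commute)
    moreover have "?L a (?L b' v) b = f a b' * \<mu> (a + b') * v b" by (subst comp) (simp only: ev mult.assoc)
    ultimately show ?thesis using b by simp
  qed
  have "\<mu> 0 = 1" using l S(1) \<psi>(1) by simp
  moreover have "\<mu> s = \<psi> s" if "s \<in> S" for s using l that by blast
  ultimately show ?thesis using ev' by (intro that[of \<mu>])
qed

section \<open>Linear maps in coordinates\<close>

lemma sum_fun_apply: "(\<Sum>i\<in>A. f i) x = (\<Sum>i\<in>A. f i x)"
  by (induction A rule: infinite_finite_induct) auto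

lemma vector_space_scale: "vector_space (scale :: 'k::field \<Rightarrow> ('b \<Rightarrow> 'k) \<Rightarrow> 'b \<Rightarrow> 'k)"
  by unfold_locales (auto simp: scale_def algebra_simps)

lemma vector_space_mult: "vector_space ((*) :: 'k::field \<Rightarrow> 'k \<Rightarrow> 'k)"
  by unfold_locales (auto simp: algebra_simps)

lemma klinear_iff:
  "klinear F \<longleftrightarrow> (\<forall>u v. F (u + v) = F u + F v) \<and> (\<forall>r u. F (scale r u) = scale r (F u))"
  by (simp add: Vector_Spaces.linear_iff vector_space_scale)

lemma klinear_form_iff:
  "klinear_form F \<longleftrightarrow> (\<forall>u v. F (u + v) = F u + F v) \<and> (\<forall>r u. F (scale r u) = r * F u)"
  by (simp add: Vector_Spaces.linear_iff vector_space_scale vector_space_mult)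

lemma klinear_zero:
  assumes "klinear F"
  shows "F 0 = 0"
proof -
  have "F (scale 0 0) = scale 0 (F 0)" using assms unfolding klinear_iff by blast
  then show ?thesis by (simp add: scale_def zero_fun_def)
qed

lemma klinear_sum:
  assumes "klinear F"
  shows "F (\<Sum>i\<in>A. scale (r i) (u i)) = (\<Sum>i\<in>A. scale (r i) (F (u i)))"
  using assms klinear_zero[OF assms]
  by (induction A rule: infinite_finite_induct) (auto simp: klinear_iff)

lemma basis_expansion: "(\<Sum>i\<in>UNIV. scale (u i) (basis_vec i)) = (u :: 'b::finite \<Rightarrow> 'k::field)"
proof
  fix j
  have "(\<Sum>i\<in>UNIV. scale (u i) (basis_vec i)) j = (\<Sum>i\<in>UNIV. if i = j then u i else 0)"
    unfolding sum_fun_apply by (intro sum.cong) (auto simp: scale_def basis_vec_def)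
  then show "(\<Sum>i\<in>UNIV. scale (u i) (basis_vec i)) j = u j" by simp
qed

lemma klinear_expansion:
  assumes "klinear F"
  shows "(\<Sum>i\<in>UNIV. u i * F (basis_vec i) k) = F (u :: 'b::finite \<Rightarrow> 'k::field) k"
proof -
  have "F u k = F (\<Sum>i\<in>UNIV. scale (u i) (basis_vec i)) k" by (simp add: basis_expansion)
  also have "\<dots> = (\<Sum>i\<in>UNIV. u i * F (basis_vec i) k)"
    unfolding klinear_sum[OF assms] sum_fun_apply by (simp add: scale_def)
  finally show ?thesis ..
qed

lemma tensor_eqI: "(\<And>k l. s (k, l) = t (k, l)) \<Longrightarrow> s = t"
  by auto

lemma tensor_lift_apply:
  "tensor_lift \<beta> t e = (\<Sum>i\<in>UNIV. \<Sum>j\<in>UNIV. t (i, j) * \<beta> (basis_vec i) (basis_vec j) e)"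
  by (simp add: tensor_lift_def sum_fun_apply scale_def)

lemma tensor_map_apply:
  "tensor_map F F' t (k, l) =
     (\<Sum>i\<in>UNIV. \<Sum>j\<in>UNIV. t (i, j) * (F (basis_vec i) k * F' (basis_vec j) l))"
  by (simp add: tensor_map_def tensor_lift_apply tensor_def)

lemma tensor_map_tensor:
  assumes "klinear F" "klinear F'"
  shows "tensor_map F F' (tensor u v) = tensor (F u) (F' v)"
proof (rule tensor_eqI)
  fix k l
  have "tensor_map F F' (tensor u v) (k, l) =
      (\<Sum>i\<in>UNIV. u i * F (basis_vec i) k) * (\<Sum>j\<in>UNIV. v j * F' (basis_vec j) l)"
    unfolding tensor_map_apply sum_product tensor_def
    by (intro sum.cong) (auto simp: algebra_simps)
  then show "tensor_map F F' (tensor u v) (k, l) = tensor (F u) (F' v) (k, l)"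
    by (simp add: klinear_expansion[OF assms(1)] klinear_expansion[OF assms(2)] tensor_def)
qed

lemma sum_swap3: "(\<Sum>n\<in>C. \<Sum>i\<in>A. \<Sum>j\<in>B. g n i j) = (\<Sum>i\<in>A. \<Sum>j\<in>B. \<Sum>n\<in>C. g n i j)"
  by (subst sum.swap) (intro sum.cong refl sum.swap)

lemma sum_swap4:
  "(\<Sum>m\<in>A. \<Sum>n\<in>B. \<Sum>i\<in>C. \<Sum>j\<in>D. h m n i j) = (\<Sum>i\<in>C. \<Sum>j\<in>D. \<Sum>m\<in>A. \<Sum>n\<in>B. h m n i j)"
proof -
  have "(\<Sum>m\<in>A. \<Sum>n\<in>B. \<Sum>i\<in>C. \<Sum>j\<in>D. h m n i j) = (\<Sum>m\<in>A. \<Sum>i\<in>C. \<Sum>j\<in>D. \<Sum>n\<in>B. h m n i j)"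
    by (intro sum.cong refl sum_swap3)
  also have "\<dots> = (\<Sum>i\<in>C. \<Sum>j\<in>D. \<Sum>m\<in>A. \<Sum>n\<in>B. h m n i j)"
    by (rule sum_swap3)
  finally show ?thesis .
qed

text \<open>Linearity of the outer maps collapses the sums over the intermediate bases to the values
  of the composites on basis vectors.\<close>

lemma tensor_map_comp:
  assumes "klinear G" "klinear G'"
  shows "tensor_map G G' (tensor_map F F' t) = tensor_map (G \<circ> F) (G' \<circ> F') t"
proof (rule tensor_eqI)
  fix k l
  let ?e = basis_vec
  have "tensor_map G G' (tensor_map F F' t) (k, l) =
    (\<Sum>m\<in>UNIV. \<Sum>n\<in>UNIV. \<Sum>i\<in>UNIV. \<Sum>j\<in>UNIV.
       t (i, j) * (F (?e i) m * F' (?e j) n) * (G (?e m) k * G' (?e n) l))"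
    by (simp add: tensor_map_apply sum_distrib_right)
  also have "\<dots> = (\<Sum>i\<in>UNIV. \<Sum>j\<in>UNIV. \<Sum>m\<in>UNIV. \<Sum>n\<in>UNIV.
       t (i, j) * (F (?e i) m * F' (?e j) n) * (G (?e m) k * G' (?e n) l))"
    by (rule sum_swap4)
  also have "\<dots> = (\<Sum>i\<in>UNIV. \<Sum>j\<in>UNIV. t (i, j) *
      ((\<Sum>m\<in>UNIV. F (?e i) m * G (?e m) k) * (\<Sum>n\<in>UNIV. F' (?e j) n * G' (?e n) l)))"
    unfolding sum_product by (simp add: sum_distrib_left algebra_simps)
  also have "\<dots> = tensor_map (G \<circ> F) (G' \<circ> F') t (k, l)"
    by (simp add: tensor_map_apply klinear_expansion[OF assms(1)] klinear_expansion[OF assms(2)])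
  finally show "tensor_map G G' (tensor_map F F' t) (k, l) = tensor_map (G \<circ> F) (G' \<circ> F') t (k, l)"
    by simp
qed

lemma sum_delta_mult:
  fixes f :: "'a::finite \<Rightarrow> 'k::field"
  shows "(\<Sum>i\<in>UNIV. f i * (if i = j then c else 0)) = f j * c"
    and "(\<Sum>i\<in>UNIV. f i * (if j = i then c else 0)) = f j * c"
  by (simp_all add: if_distrib[of "(*) _"] cong: if_cong)

lemma tensor_map_id: "tensor_map id id t = t"
proof (rule tensor_eqI)
  fix k l
  have "tensor_map id id t (k, l) =
     (\<Sum>i\<in>UNIV. (\<Sum>j\<in>UNIV. t (i, j) * (if j = l then 1 else 0)) * (if i = k then 1 else 0))"
    unfolding tensor_map_apply sum_distrib_right
    by (intro sum.cong) (auto simp: basis_vec_def)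
  then show "tensor_map id id t (k, l) = t (k, l)" by (simp add: sum_delta_mult)
qed

lemma tensor_swap_map: "tensor_swap (tensor_map F F' t) = tensor_map F' F (tensor_swap t)"
proof (rule tensor_eqI)
  fix k l
  have "tensor_map F F' t (l, k) = tensor_map F' F (tensor_swap t) (k, l)"
    unfolding tensor_map_apply tensor_swap_def by (subst sum.swap) (simp add: mult.commute)
  then show "tensor_swap (tensor_map F F' t) (k, l) = tensor_map F' F (tensor_swap t) (k, l)"
    by (simp add: tensor_swap_def)
qed

section \<open>Hopf algebra isomorphisms: inverses, composites and transport of
  cocommutativity\<close>

lemma hopf_isoD:
  assumes "F \<in> hopf_iso H H'"
  shows "klinear F" "F (hmul H u v) = hmul H' (F u) (F v)" "F (hone H) = hone H'"
    "hcomul H' (F u) = tensor_map F F (hcomul H u)" "hcounit H' (F u) = hcounit H u" "bij F"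
  using assms unfolding hopf_iso_def hopf_hom_def by blast+

lemma hopf_isoI:
  assumes "klinear F" "\<And>u v. F (hmul H u v) = hmul H' (F u) (F v)" "F (hone H) = hone H'"
    "\<And>u. hcomul H' (F u) = tensor_map F F (hcomul H u)" "\<And>u. hcounit H' (F u) = hcounit H u" "bij F"
  shows "F \<in> hopf_iso H H'"
  using assms unfolding hopf_iso_def hopf_hom_def by blast

lemma hopf_iso_id: "id \<in> hopf_iso H H"
  by (rule hopf_isoI) (auto simp: klinear_iff tensor_map_id)

lemma hopf_iso_inv:
  assumes "F \<in> hopf_iso H H'"
  shows "inv_into UNIV F \<in> hopf_iso H' H"
proof -
  let ?G = "inv_into UNIV F"
  note F = hopf_isoD[OF assms]
  have FG: "F (?G u) = u" for u by (simp add: F(6) bij_is_surj surj_f_inv_f)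
  have GF: "?G (F u) = u" for u by (simp add: F(6) bij_is_inj inv_f_f)
  \<comment> \<open>Linearity, product and unit of the inverse are checked after applying the
    injective \<open>F\<close>.\<close>
  have eq: "u = v" if "F u = F v" for u v using that GF by metis
  have lin: "klinear ?G"
    unfolding klinear_iff
    by (intro conjI allI eq) (use F(1) in \<open>simp_all add: FG klinear_iff\<close>)
  show ?thesis
  proof (rule hopf_isoI)
    show "klinear ?G" by (rule lin)
    show "?G (hmul H' u v) = hmul H (?G u) (?G v)" for u v by (rule eq) (simp add: F FG)
    show "?G (hone H') = hone H" by (rule eq) (simp add: F FG)
    show "hcounit H (?G u) = hcounit H' u" for u using F(5)[of "?G u"] by (simp add: FG)
    show "bij ?G" by (rule bij_imp_bij_inv[OF F(6)])
    show "hcomul H (?G u) = tensor_map ?G ?G (hcomul H' u)" for u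
    proof -
      have "tensor_map ?G ?G (hcomul H' u) = tensor_map ?G ?G (hcomul H' (F (?G u)))"
        by (simp add: FG)
      also have "\<dots> = tensor_map id id (hcomul H (?G u))"
        by (simp add: F(4) tensor_map_comp[OF lin lin] inv_o_cancel bij_is_inj[OF F(6)])
      finally show ?thesis by (simp add: tensor_map_id)
    qed
  qed
qed

lemma hopf_iso_comp:
  assumes "F \<in> hopf_iso H H'" "G \<in> hopf_iso H' H''"
  shows "G \<circ> F \<in> hopf_iso H H''"
proof -
  note F = hopf_isoD[OF assms(1)] and G = hopf_isoD[OF assms(2)]
  show ?thesis
    by (rule hopf_isoI)
      (use F(1) G(1) in \<open>auto simp: F G tensor_map_comp klinear_iff bij_comp\<close>)
qed

lemma cocommutative_hopf_iso:
  assumes "F \<in> hopf_iso H H'" "cocommutative H'"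
  shows "cocommutative H"
  unfolding cocommutative_def
proof
  fix u
  let ?G = "inv_into UNIV F"
  note F = hopf_isoD[OF assms(1)] and G = hopf_isoD[OF hopf_iso_inv[OF assms(1)]]
  have u: "u = ?G (F u)" by (simp add: F(6) bij_is_inj inv_f_f)
  show "tensor_swap (hcomul H u) = hcomul H u"
    by (subst (1 2) u) (use assms(2) in \<open>simp add: G(4) tensor_swap_map cocommutative_def\<close>)
qed

section \<open>The Hopf algebra structure of a crossed product\<close>

lemma sum_delta_if:
  fixes f :: "'a::finite \<Rightarrow> 'k::comm_monoid_add"
  shows "(\<Sum>i\<in>UNIV. if i = j then f i else 0) = f j"
    and "(\<Sum>i\<in>UNIV. if j = i then f i else 0) = f j"
  by simp_all

lemma sum_UNIV_prod:
  "(\<Sum>i\<in>UNIV. f i) = (\<Sum>x\<in>UNIV. \<Sum>a\<in>UNIV. f (x, a))" for f :: "'c::finite \<times> 'g::finite \<Rightarrow> 'k::comm_monoid_add"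
  by (simp add: sum.cartesian_product flip: UNIV_Times_UNIV)

lemma eq_add_iff_minus_add: "z = x + y \<longleftrightarrow> - x + z = y" for x y z :: "'a::group_add"
  by (metis add.assoc add.left_neutral left_minus right_minus)

lemma scale_apply: "scale r u i = r * u i"
  by (simp add: scale_def)

lemma bar_apply: "bar f x (y, a) = (if y = x then f a else 0)"
  by (simp add: bar_def)

lemma bar_basis_vec: "bar (basis_vec a) x = basis_vec (x, a)"
  by (auto simp: bar_def basis_vec_def fun_eq_iff)

lemma hone_crossed: "hone (crossed_hopf \<tau> act) = bar 1 0"
  and hcounit_crossed: "hcounit (crossed_hopf \<tau> act) u = (\<Sum>x\<in>UNIV. u (x, 0))"
  by (simp_all add: crossed_hopf_def)

lemma hcounit_basis_vec:
  "hcounit (crossed_hopf \<tau> act) (basis_vec (x, a)) = (if a = 0 then 1 else 0)"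
proof -
  have "hcounit (crossed_hopf \<tau> act) (basis_vec (x, a)) =
      (\<Sum>y\<in>UNIV. if y = x then if a = 0 then 1 else 0 else 0)"
    unfolding hcounit_crossed by (intro sum.cong refl) (auto simp: basis_vec_def)
  then show ?thesis by simp
qed

lemma hmul_crossed:
  "hmul (crossed_hopf \<tau> act) u v (z, a) = (\<Sum>x\<in>UNIV. u (x, a) * v (- x + z, act a x))"
proof -
  have "hmul (crossed_hopf \<tau> act) u v (z, a) =
      (\<Sum>x\<in>UNIV. \<Sum>y\<in>UNIV. if - x + z = y then u (x, a) * v (y, act a x) else 0)"
    unfolding crossed_hopf_def hopf.simps sum_fun_apply
    by (intro sum.cong refl) (auto simp: bar_apply coeff_at_def bullet_def eq_add_iff_minus_add)
  then show ?thesis by simp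
qed

lemma hcomul_crossed:
  "hcomul (crossed_hopf \<tau> act) u ((x, a), (y, b)) = (if x = y then \<tau> x a b * u (x, a + b) else 0)"
proof -
  have "hcomul (crossed_hopf \<tau> act) u ((x, a), (y, b)) =
      (\<Sum>z\<in>UNIV. \<Sum>c\<in>UNIV. \<Sum>d\<in>UNIV. if d = b then
         if c = a then if z = x then if x = y then \<tau> x a b * u (x, a + b) else 0 else 0 else 0 else 0)"
    unfolding crossed_hopf_def hopf.simps sum_fun_apply
    by (intro sum.cong refl) (auto simp: scale_def tensor_def bar_apply basis_vec_def)
  then show ?thesis by (simp only: sum_delta_if)
qed

lemma hmul_bar:
  "hmul (crossed_hopf \<tau> act) (bar f x) (bar f' y) = bar (f * bullet act x f') (x + y)"
proof (rule tensor_eqI)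
  fix z a
  have "hmul (crossed_hopf \<tau> act) (bar f x) (bar f' y) (z, a) =
      (\<Sum>w\<in>UNIV. if w = x then bar (f * bullet act x f') (x + y) (z, a) else 0)"
    unfolding hmul_crossed by (intro sum.cong refl) (auto simp: bar_apply bullet_def eq_add_iff_minus_add)
  then show "hmul (crossed_hopf \<tau> act) (bar f x) (bar f' y) (z, a) = bar (f * bullet act x f') (x + y) (z, a)"
    by simp
qed

lemma tensor_lift_crossed:
  "tensor_lift \<beta> (hcomul (crossed_hopf \<tau> act) u) e =
     (\<Sum>x\<in>UNIV. \<Sum>a\<in>UNIV. \<Sum>b\<in>UNIV.
        \<tau> x a b * u (x, a + b) * \<beta> (basis_vec (x, a)) (basis_vec (x, b)) e)"
proof -
  have "tensor_lift \<beta> (hcomul (crossed_hopf \<tau> act) u) e =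
     (\<Sum>x\<in>UNIV. \<Sum>a\<in>UNIV. \<Sum>y\<in>UNIV. if x = y then
        \<Sum>b\<in>UNIV. \<tau> x a b * u (x, a + b) * \<beta> (basis_vec (x, a)) (basis_vec (x, b)) e else 0)"
    unfolding tensor_lift_apply sum_UNIV_prod hcomul_crossed
    by (intro sum.cong refl) auto
  then show ?thesis by simp
qed

lemma basis_vec_apply: "basis_vec i j = (if j = i then 1 else 0)"
  by (simp add: basis_vec_def)

locale right_action =
  fixes act :: "'g::{finite, ab_group_add} \<Rightarrow> 'c::{finite, ab_group_add} \<Rightarrow> 'g"
  assumes act: "is_action act"
begin

lemma act_0 [simp]: "act a 0 = a" and act_plus: "act a (x + y) = act (act a x) y"
  and act_add: "act (a + b) x = act a x + act b x"
  using act unfolding is_action_def by blast+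

lemma act_zero [simp]: "act 0 x = 0"
  using act_add[of 0 0] by simp

lemma act_minus: "act (- a) x = - act a x"
  using act_add[of a "- a" x] by (simp add: eq_neg_iff_add_eq_0 add.commute)

lemma act_act_minus [simp]: "act (act a x) (- x) = a" "act (act a (- x)) x = a"
  by (simp_all flip: act_plus)

end

locale crossed_cocycle = right_action act
  for act :: "'g::{finite, ab_group_add} \<Rightarrow> 'c::{finite, ab_group_add} \<Rightarrow> 'g" +
  fixes \<tau> :: "'c \<Rightarrow> 'g \<Rightarrow> 'g \<Rightarrow> 'k::field"
  assumes \<tau>: "\<tau> \<in> Z2c act"
begin

lemma tau_nonzero: "\<tau> x a b \<noteq> 0"
  and tau_1 [simp]: "\<tau> 0 a b = 1" "\<tau> x 0 b = 1" "\<tau> x a 0 = 1"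
  and tau_cocycle: "\<tau> x a (b + c) * \<tau> x b c = \<tau> x (a + b) c * \<tau> x a b"
  and tau_plus: "\<tau> (x + y) a b = \<tau> x a b * \<tau> y (act a x) (act b x)"
  using \<tau> unfolding Z2c_def by blast+

abbreviation "H \<equiv> crossed_hopf \<tau> act"

lemma crossed_algebra: "is_algebra H"
  unfolding is_algebra_def klinear_iff
proof (intro conjI allI)
  fix u v w and r
  show "hmul H u (v + w) = hmul H u v + hmul H u w"
    "hmul H (v + w) u = hmul H v u + hmul H w u"
    "hmul H u (scale r v) = scale r (hmul H u v)"
    "hmul H (scale r v) u = scale r (hmul H v u)"
    by (rule tensor_eqI, simp add: hmul_crossed scale_def algebra_simps sum.distrib sum_distrib_left)+
  show "hmul H (hmul H u v) w = hmul H u (hmul H v w)"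
  proof (rule tensor_eqI)
    fix z a
    have "hmul H (hmul H u v) w (z, a) =
        (\<Sum>y\<in>UNIV. \<Sum>x\<in>UNIV. u (y, a) * v (- y + x, act a y) * w (- x + z, act a x))"
      by (subst sum.swap) (simp add: hmul_crossed sum_distrib_right)
    also have "\<dots> = (\<Sum>y\<in>UNIV. \<Sum>x\<in>UNIV. u (y, a) * v (x, act a y) * w (- x + (- y + z), act (act a y) x))"
    proof (rule sum.cong[OF refl])
      fix y
      show "(\<Sum>x\<in>UNIV. u (y, a) * v (- y + x, act a y) * w (- x + z, act a x)) =
        (\<Sum>x\<in>UNIV. u (y, a) * v (x, act a y) * w (- x + (- y + z), act (act a y) x))"
        by (rule sum.reindex_bij_witness[of _ "\<lambda>x. y + x" "\<lambda>x. - y + x"])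
          (auto simp: algebra_simps simp flip: act_plus)
    qed
    also have "\<dots> = hmul H u (hmul H v w) (z, a)"
      by (simp add: hmul_crossed sum_distrib_left mult.assoc)
    finally show "hmul H (hmul H u v) w (z, a) = hmul H u (hmul H v w) (z, a)" .
  qed
  show "hmul H (hone H) u = u"
  proof (rule tensor_eqI)
    fix z a
    have "hmul H (hone H) u (z, a) = (\<Sum>x\<in>UNIV. if x = (0::'c) then u (z, a) else 0)"
      unfolding hmul_crossed hone_crossed by (intro sum.cong refl) (auto simp: bar_apply)
    then show "hmul H (hone H) u (z, a) = u (z, a)" by simp
  qed
  show "hmul H u (hone H) = u"
  proof (rule tensor_eqI)
    fix z a
    have "hmul H u (hone H) (z, a) = (\<Sum>x\<in>UNIV. if x = z then u (z, a) else 0)"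
      unfolding hmul_crossed hone_crossed
      by (intro sum.cong refl) (auto simp: bar_apply)
    then show "hmul H u (hone H) (z, a) = u (z, a)" by simp
  qed
qed

lemma klinear_hcomul: "klinear (hcomul H)"
  unfolding klinear_iff
  by (auto intro!: tensor_eqI simp: hcomul_crossed scale_def algebra_simps)

text \<open>Both iterated coproducts are supported on triples over a single \<open>x\<close>.
  Comparing coefficients there leaves exactly \<open>tau_cocycle\<close>, and the counit laws come
  from the normalization of \<open>\<tau>\<close> in its \<open>G\<close> arguments.\<close>

lemma crossed_coalgebra: "is_coalgebra H"
  unfolding is_coalgebra_def
proof (intro conjI allI klinear_hcomul)
  show "klinear_form (hcounit H)"
    by (simp add: klinear_form_iff hcounit_crossed sum.distrib scale_def sum_distrib_left)
  fix u
  show "tensor_assoc (tensor_map (hcomul H) id (hcomul H u)) = tensor_map id (hcomul H) (hcomul H u)"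
  proof (rule tensor_eqI)
    fix k :: "'c \<times> 'g" and yz :: "('c \<times> 'g) \<times> 'c \<times> 'g"
    obtain x a y b z c where k: "k = (x, a)" "yz = ((y, b), (z, c))" by (metis surj_pair)
    have "tensor_map (hcomul H) id (hcomul H u) (((x, a), (y, b)), (z, c)) =
      (\<Sum>i\<in>UNIV. (\<Sum>j\<in>UNIV. hcomul H u (i, j) * (if j = (z, c) then 1 else 0)) *
         hcomul H (basis_vec i) ((x, a), (y, b)))"
      unfolding tensor_map_apply sum_distrib_right
      by (intro sum.cong refl) (auto simp: basis_vec_apply)
    also have "\<dots> = (\<Sum>i\<in>UNIV. (if x = y then \<tau> x a b * hcomul H u (i, (z, c)) else 0) *
        (if i = (x, a + b) then 1 else 0))"
      by (intro sum.cong refl) (auto simp: sum_delta_mult hcomul_crossed basis_vec_apply)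
    also have "\<dots> = (if x = y \<and> y = z then \<tau> x a b * (\<tau> x (a + b) c * u (x, a + b + c)) else 0)"
      unfolding sum_delta_mult by (simp add: hcomul_crossed)
    finally have 1: "tensor_map (hcomul H) id (hcomul H u) (((x, a), (y, b)), (z, c)) =
      (if x = y \<and> y = z then \<tau> x a b * (\<tau> x (a + b) c * u (x, a + b + c)) else 0)" .
    have "tensor_map id (hcomul H) (hcomul H u) ((x, a), ((y, b), (z, c))) =
      (\<Sum>j\<in>UNIV. (\<Sum>i\<in>UNIV. hcomul H u (i, j) * (if i = (x, a) then 1 else 0)) *
         hcomul H (basis_vec j) ((y, b), (z, c)))"
      unfolding tensor_map_apply sum_distrib_right
      by (subst sum.swap, intro sum.cong refl) (auto simp: basis_vec_apply)
    also have "\<dots> = (\<Sum>j\<in>UNIV. (if y = z then \<tau> y b c * hcomul H u ((x, a), j) else 0) *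
        (if j = (y, b + c) then 1 else 0))"
      by (intro sum.cong refl) (auto simp: sum_delta_mult hcomul_crossed basis_vec_apply)
    also have "\<dots> = (if x = y \<and> y = z then \<tau> x b c * (\<tau> x a (b + c) * u (x, a + (b + c))) else 0)"
      unfolding sum_delta_mult by (simp add: hcomul_crossed)
    finally have 2: "tensor_map id (hcomul H) (hcomul H u) ((x, a), ((y, b), (z, c))) =
      (if x = y \<and> y = z then \<tau> x b c * (\<tau> x a (b + c) * u (x, a + (b + c))) else 0)" .
    show "tensor_assoc (tensor_map (hcomul H) id (hcomul H u)) (k, yz) =
        tensor_map id (hcomul H) (hcomul H u) (k, yz)"
      unfolding k tensor_assoc_def prod.case 1 2
      using tau_cocycle[of z a b c] by (auto simp: algebra_simps)
  qed
  show "tensor_lift (\<lambda>v w. scale (hcounit H v) w) (hcomul H u) = u"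
  proof (rule tensor_eqI)
    fix z c
    have "tensor_lift (\<lambda>v w. scale (hcounit H v) w) (hcomul H u) (z, c) =
      (\<Sum>x\<in>UNIV. \<Sum>a\<in>UNIV. \<Sum>b\<in>UNIV. if c = b then if a = (0::'g) then if x = z then u (z, c) else 0 else 0 else 0)"
      unfolding tensor_lift_crossed
      by (intro sum.cong refl) (auto simp: scale_def hcounit_basis_vec basis_vec_apply)
    then show "tensor_lift (\<lambda>v w. scale (hcounit H v) w) (hcomul H u) (z, c) = u (z, c)" by simp
  qed
  show "tensor_lift (\<lambda>v w. scale (hcounit H w) v) (hcomul H u) = u"
  proof (rule tensor_eqI)
    fix z c
    have "tensor_lift (\<lambda>v w. scale (hcounit H w) v) (hcomul H u) (z, c) =
      (\<Sum>x\<in>UNIV. \<Sum>a\<in>UNIV. \<Sum>b\<in>UNIV. if b = (0::'g) then if c = a then if x = z then u (z, c) else 0 else 0 else 0)"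
      unfolding tensor_lift_crossed
      by (intro sum.cong refl) (auto simp: scale_def hcounit_basis_vec basis_vec_apply)
    then show "tensor_lift (\<lambda>v w. scale (hcounit H w) v) (hcomul H u) (z, c) = u (z, c)" by simp
  qed
qed

lemma hmul_basis_vec:
  "hmul H (basis_vec (x, a)) (basis_vec (y, b)) k = (if b = act a x \<and> k = (x + y, a) then 1 else 0)"
proof (cases k)
  case (Pair z c)
  show ?thesis
    unfolding Pair bar_basis_vec[symmetric] hmul_bar
    by (auto simp: bar_apply bullet_def basis_vec_apply)
qed

text \<open>In the product of the two coproducts, the summand for \<open>x\<close> at a target over
  \<open>z\<close> carries the values of \<open>\<tau>\<close> at \<open>x\<close> and, after the
  action of \<open>x\<close>, at \<open>- x + z\<close>. By \<open>tau_plus\<close> they multiply to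
  the value at \<open>z\<close>, which no longer depends on \<open>x\<close>.\<close>

lemma crossed_comul_mul: "hcomul H (hmul H u v) = tensor_mul H (hcomul H u) (hcomul H v)"
proof (rule tensor_eqI)
  fix k l :: "'c \<times> 'g"
  obtain z a w b where k: "k = (z, a)" "l = (w, b)" by (metis surj_pair)
  have "tensor_mul H (hcomul H u) (hcomul H v) (k, l) =
    (\<Sum>x\<in>UNIV. \<Sum>a'\<in>UNIV. \<Sum>b'\<in>UNIV. \<tau> x a' b' * u (x, a' + b') *
       (\<Sum>y\<in>UNIV. \<Sum>c\<in>UNIV. \<Sum>d\<in>UNIV. \<tau> y c d * v (y, c + d) *
         (hmul H (basis_vec (x, a')) (basis_vec (y, c)) k * hmul H (basis_vec (x, b')) (basis_vec (y, d)) l)))"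
    by (simp add: tensor_mul_def tensor_lift_crossed tensor_def)
  also have "\<dots> = (\<Sum>x\<in>UNIV. \<Sum>a'\<in>UNIV. \<Sum>b'\<in>UNIV. \<tau> x a' b' * u (x, a' + b') *
       (\<Sum>y\<in>UNIV. \<Sum>c\<in>UNIV. \<Sum>d\<in>UNIV. if d = act b' x then if c = act a' x then if y = - x + z then
          if a' = a \<and> b' = b \<and> z = w then \<tau> (- x + z) (act a x) (act b x) * v (- x + z, act (a + b) x)
          else 0 else 0 else 0 else 0))"
    by (intro sum.cong refl arg_cong2[where f = "(*)"])
      (auto simp: k hmul_basis_vec act_add algebra_simps)
  also have "\<dots> = (\<Sum>x\<in>UNIV. \<Sum>a'\<in>UNIV. \<Sum>b'\<in>UNIV. if b' = b then if a' = a then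
      if z = w then \<tau> x a b * u (x, a + b) * (\<tau> (- x + z) (act a x) (act b x) * v (- x + z, act (a + b) x))
      else 0 else 0 else 0)"
    by (intro sum.cong refl) auto
  also have "\<dots> = (\<Sum>x\<in>UNIV. if z = w then (\<tau> x a b * \<tau> (- x + z) (act a x) (act b x)) *
      (u (x, a + b) * v (- x + z, act (a + b) x)) else 0)"
    unfolding sum_delta_if by (intro sum.cong refl) (auto simp: algebra_simps)
  also have "\<dots> = (if z = w then \<tau> z a b * hmul H u v (z, a + b) else 0)"
    by (simp add: hmul_crossed sum_distrib_left flip: tau_plus)
  finally show "hcomul H (hmul H u v) (k, l) = tensor_mul H (hcomul H u) (hcomul H v) (k, l)"
    by (simp add: k hcomul_crossed)
qed

lemma crossed_counit_mul: "hcounit H (hmul H u v) = hcounit H u * hcounit H v"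
proof -
  have "hcounit H (hmul H u v) = (\<Sum>x\<in>UNIV. \<Sum>z\<in>UNIV. u (x, 0) * v (- x + z, 0))"
    by (subst sum.swap) (simp add: hcounit_crossed hmul_crossed)
  also have "\<dots> = (\<Sum>x\<in>UNIV. \<Sum>z\<in>UNIV. u (x, 0) * v (z, 0))"
  proof (rule sum.cong[OF refl])
    fix x :: 'c
    show "(\<Sum>z\<in>UNIV. u (x, 0) * v (- x + z, 0)) = (\<Sum>z\<in>UNIV. u (x, 0) * v (z, 0))"
      by (rule sum.reindex_bij_witness[of _ "\<lambda>z. x + z" "\<lambda>z. - x + z"]) auto
  qed
  also have "\<dots> = hcounit H u * hcounit H v"
    by (simp add: hcounit_crossed sum_product)
  finally show ?thesis .
qed

text \<open>The basis vector at \<open>(x, a)\<close> must go to a multiple of the one at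
  \<open>(- x, - act a x)\<close>, with a scalar that cancels \<open>\<tau> x a (- a)\<close>. The
  body is this rule read at the target \<open>(y, c)\<close>, so that \<open>x = - y\<close> and
  \<open>a = - act c y\<close>.\<close>

definition crossed_antipode :: "('c \<times> 'g \<Rightarrow> 'k) \<Rightarrow> 'c \<times> 'g \<Rightarrow> 'k" where
  "crossed_antipode u = (\<lambda>(y, c). u (- y, - act c y) / \<tau> (- y) (- act c y) (act c y))"

text \<open>In the second antipode equation the scalar appears with its two \<open>G\<close>
  arguments interchanged; this symmetry makes it cancel there too.\<close>

lemma tau_minus: "\<tau> x a (- a) = \<tau> x (- a) a"
  using tau_cocycle[of x a "- a" a] by simp

lemma crossed_antipode_basis:
  "crossed_antipode (basis_vec (x, a)) = scale (1 / \<tau> x a (- a)) (basis_vec (- x, - act a x))"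
proof (rule tensor_eqI)
  fix y c
  have "- y = x \<and> - act c y = a \<longleftrightarrow> y = - x \<and> c = - act a x"
    by (auto simp: act_minus)
  then show "crossed_antipode (basis_vec (x, a)) (y, c) = scale (1 / \<tau> x a (- a)) (basis_vec (- x, - act a x)) (y, c)"
    by (auto simp: crossed_antipode_def basis_vec_apply scale_def act_minus)
qed

lemma hmul_scale: "hmul H (scale r u) v = scale r (hmul H u v)" "hmul H u (scale r v) = scale r (hmul H u v)"
  using crossed_algebra by (auto simp: is_algebra_def klinear_iff)

lemma crossed_antipode: "is_antipode H crossed_antipode"
  unfolding is_antipode_def
proof (intro conjI allI)
  show "klinear crossed_antipode"
    by (auto intro!: tensor_eqI simp: klinear_iff crossed_antipode_def scale_def add_divide_distrib)
  fix u
  show "tensor_lift (\<lambda>v w. hmul H (crossed_antipode v) w) (hcomul H u) = scale (hcounit H u) (hone H)"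
  proof (rule tensor_eqI)
    fix z c
    have "tensor_lift (\<lambda>v w. hmul H (crossed_antipode v) w) (hcomul H u) (z, c) =
      (\<Sum>x\<in>UNIV. \<Sum>a\<in>UNIV. \<Sum>b\<in>UNIV. if b = - a then if a = - act c (- x) then
         if z = 0 then u (x, 0) else 0 else 0 else 0)"
      unfolding tensor_lift_crossed
      by (intro sum.cong refl)
        (auto simp: crossed_antipode_basis hmul_scale hmul_basis_vec scale_apply tau_nonzero act_minus)
    also have "\<dots> = scale (hcounit H u) (hone H) (z, c)"
      unfolding sum_delta_if by (auto simp: scale_def hcounit_crossed hone_crossed bar_apply)
    finally show "tensor_lift (\<lambda>v w. hmul H (crossed_antipode v) w) (hcomul H u) (z, c) =
      scale (hcounit H u) (hone H) (z, c)" .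
  qed
  show "tensor_lift (\<lambda>v w. hmul H v (crossed_antipode w)) (hcomul H u) = scale (hcounit H u) (hone H)"
  proof (rule tensor_eqI)
    fix z c
    have "tensor_lift (\<lambda>v w. hmul H v (crossed_antipode w)) (hcomul H u) (z, c) =
      (\<Sum>x\<in>UNIV. \<Sum>a\<in>UNIV. \<Sum>b\<in>UNIV. if b = - a then if a = c then
         if z = 0 then u (x, 0) else 0 else 0 else 0)"
      unfolding tensor_lift_crossed
    proof (intro sum.cong refl)
      fix x a b
      have "- act b x = act a x \<longleftrightarrow> b = - a"
        by (metis act_act_minus(1) act_minus minus_minus)
      then show "\<tau> x a b * u (x, a + b) * hmul H (basis_vec (x, a)) (crossed_antipode (basis_vec (x, b))) (z, c) =
        (if b = - a then if a = c then if z = 0 then u (x, 0) else 0 else 0 else 0)"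
        by (auto simp: crossed_antipode_basis hmul_scale hmul_basis_vec scale_apply tau_nonzero tau_minus)
    qed
    also have "\<dots> = scale (hcounit H u) (hone H) (z, c)"
      unfolding sum_delta_if by (auto simp: scale_def hcounit_crossed hone_crossed bar_apply)
    finally show "tensor_lift (\<lambda>v w. hmul H v (crossed_antipode w)) (hcomul H u) (z, c) =
      scale (hcounit H u) (hone H) (z, c)" .
  qed
qed

lemma crossed_is_hopf: "is_hopf_algebra H"
  unfolding is_hopf_algebra_def
proof (intro conjI allI crossed_algebra crossed_coalgebra crossed_comul_mul crossed_counit_mul)
  show "hcomul H (hone H) = tensor (hone H) (hone H)"
    by (intro tensor_eqI) (auto simp: hcomul_crossed hone_crossed tensor_def bar_apply split: prod.splits)
  show "hcounit H (hone H) = 1"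
    by (simp add: hcounit_crossed hone_crossed bar_apply)
  show "\<exists>S. is_antipode H S" using crossed_antipode by blast
qed

end

lemma (in right_action) crossed_cocycleI: "\<tau> \<in> Z2c act \<Longrightarrow> crossed_cocycle act \<tau>"
  by (intro crossed_cocycle.intro crossed_cocycle_axioms.intro right_action_axioms)

section \<open>Crossed products as extensions\<close>

lemma hmul_group: "hmul group_hopf f f' z = (\<Sum>x\<in>UNIV. f x * f' (- x + z))"
proof -
  have "hmul group_hopf f f' z = (\<Sum>x\<in>UNIV. \<Sum>y\<in>UNIV. if - x + z = y then f x * f' y else 0)"
    unfolding group_hopf_def hopf.simps sum_fun_apply
    by (intro sum.cong refl) (auto simp: scale_def basis_vec_def eq_add_iff_minus_add)
  then show ?thesis by simp
qed

lemma hcomul_group: "hcomul group_hopf f (x, y) = (if x = y then f x else 0)"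
proof -
  have "hcomul group_hopf f (x, y) = (\<Sum>z\<in>UNIV. if z = x then if x = y then f x else 0 else 0)"
    unfolding group_hopf_def hopf.simps sum_fun_apply
    by (intro sum.cong refl) (auto simp: scale_def tensor_def basis_vec_def)
  then show ?thesis by simp
qed

text \<open>If the relevant coordinates of \<open>F\<close> and \<open>F'\<close> are dual basis
  functionals on basis vectors, the tensor map reads off one coefficient. The inclusion and the
  projection of the crossed product are of this kind.\<close>

lemma tensor_map_delta:
  fixes t :: "'b::finite \<times> 'd::finite \<Rightarrow> 'k::field"
  assumes "\<And>i. F (basis_vec i) k = (if i = i0 then 1 else 0)"
    and "\<And>j. F' (basis_vec j) l = (if j = j0 then 1 else 0)"
  shows "tensor_map F F' t (k, l) = t (i0, j0)"
proof -
  have "tensor_map F F' t (k, l) =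
      (\<Sum>i\<in>UNIV. (\<Sum>j\<in>UNIV. t (i, j) * (if j = j0 then 1 else 0)) * (if i = i0 then 1 else 0))"
    unfolding tensor_map_apply assms sum_distrib_right by (intro sum.cong refl) auto
  then show ?thesis by (simp add: sum_delta_mult)
qed

text \<open>Homogeneity for the C_p-grading of the crossed product. Its part of degree zero is the
  image of the function algebra, so normality reduces to adding degrees.\<close>

definition supported_at :: "'c \<Rightarrow> ('c \<times> 'g \<Rightarrow> 'k::field) \<Rightarrow> bool" where
  "supported_at x u \<longleftrightarrow> (\<forall>y a. y \<noteq> x \<longrightarrow> u (y, a) = 0)"

lemma supported_at_zero_iff: "supported_at 0 u \<longleftrightarrow> u \<in> range (\<lambda>f. bar f 0)"
proof
  assume "supported_at 0 u"
  then have "u = bar (\<lambda>a. u (0, a)) 0"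
    by (intro tensor_eqI) (auto simp: supported_at_def bar_apply)
  then show "u \<in> range (\<lambda>f. bar f 0)" by blast
qed (auto simp: supported_at_def bar_apply)

lemma supported_at_hmul:
  assumes "supported_at x u" "supported_at y v"
  shows "supported_at (x + y) (hmul (crossed_hopf \<tau> act) u v)"
  unfolding supported_at_def
proof (intro allI impI)
  fix z a
  assume z: "z \<noteq> x + y"
  have "u (w, a) * v (- w + z, act a w) = 0" for w
  proof (cases "w = x")
    case True
    then have "- w + z \<noteq> y" using z by (auto simp flip: eq_add_iff_minus_add)
    then show ?thesis using assms by (simp add: supported_at_def)
  next
    case False
    then show ?thesis using assms by (simp add: supported_at_def)
  qed
  then show "hmul (crossed_hopf \<tau> act) u v (z, a) = 0"
    unfolding hmul_crossed by (intro sum.neutral ballI)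
qed

lemma supported_at_basis_vec: "supported_at x (basis_vec (x, a))"
  by (simp add: supported_at_def basis_vec_def)

context crossed_cocycle
begin

lemma supported_at_antipode: "supported_at (- x) (crossed_antipode (basis_vec (x, a)))"
  unfolding crossed_antipode_basis by (simp add: supported_at_def scale_def basis_vec_def)

lemma crossed_inc: "(\<lambda>f. bar f 0) \<in> hopf_hom fun_hopf H"
  unfolding hopf_hom_def mem_Collect_eq
proof (intro conjI allI)
  show "klinear (\<lambda>f. bar f 0 :: 'c \<times> 'g \<Rightarrow> 'k)"
    unfolding klinear_iff by (auto intro!: tensor_eqI simp: bar_apply scale_def)
  fix f f' :: "'g \<Rightarrow> 'k"
  show "bar (hmul fun_hopf f f') 0 = hmul H (bar f 0) (bar f' 0)"
    unfolding hmul_bar by (simp add: fun_hopf_def bullet_def)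
  show "bar (hone fun_hopf) 0 = hone H"
    by (simp add: fun_hopf_def hone_crossed)
  show "hcounit H (bar f 0) = hcounit fun_hopf f"
    by (simp add: hcounit_crossed fun_hopf_def bar_apply)
  show "hcomul H (bar f 0) = tensor_map (\<lambda>f. bar f 0) (\<lambda>f. bar f 0) (hcomul fun_hopf f)"
  proof (rule tensor_eqI)
    fix k l :: "'c \<times> 'g"
    obtain x a y b where k: "k = (x, a)" "l = (y, b)" by (metis surj_pair)
    show "hcomul H (bar f 0) (k, l) =
      tensor_map (\<lambda>f. bar f 0) (\<lambda>f. bar f 0) (hcomul fun_hopf f) (k, l)"
    proof (cases "x = 0 \<and> y = 0")
      case True
      have "tensor_map (\<lambda>f. bar f 0) (\<lambda>f. bar f 0) (hcomul fun_hopf f) (k, l) = hcomul fun_hopf f (a, b)"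
        by (rule tensor_map_delta) (auto simp: k True bar_apply basis_vec_def)
      then show ?thesis using True by (simp add: k hcomul_crossed bar_apply fun_hopf_def)
    next
      case False
      then show ?thesis
        by (auto simp: k hcomul_crossed bar_apply tensor_map_apply)
    qed
  qed
qed

lemma crossed_proj: "(\<lambda>u x. u (x, 0)) \<in> hopf_hom H group_hopf"
  unfolding hopf_hom_def mem_Collect_eq
proof (intro conjI allI)
  show "klinear (\<lambda>(u :: 'c \<times> 'g \<Rightarrow> 'k) x. u (x, 0))"
    unfolding klinear_iff by (auto simp: scale_def)
  fix u v :: "'c \<times> 'g \<Rightarrow> 'k"
  show "(\<lambda>x. hmul H u v (x, 0)) = hmul group_hopf (\<lambda>x. u (x, 0)) (\<lambda>x. v (x, 0))"
    by (simp add: fun_eq_iff hmul_crossed hmul_group)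
  show "(\<lambda>x. hone H (x, 0)) = hone group_hopf"
    by (auto simp: fun_eq_iff hone_crossed group_hopf_def bar_apply basis_vec_def)
  show "hcounit group_hopf (\<lambda>x. u (x, 0)) = hcounit H u"
    by (simp add: hcounit_crossed group_hopf_def)
  show "hcomul group_hopf (\<lambda>x. u (x, 0)) = tensor_map (\<lambda>u x. u (x, 0)) (\<lambda>u x. u (x, 0)) (hcomul H u)"
  proof (rule tensor_eqI)
    fix x y :: 'c
    have "tensor_map (\<lambda>u x. u (x, 0)) (\<lambda>u x. u (x, 0)) (hcomul H u) (x, y) = hcomul H u ((x, 0), (y, 0))"
      by (rule tensor_map_delta) (auto simp: basis_vec_def)
    then show "hcomul group_hopf (\<lambda>x. u (x, 0)) (x, y) =
        tensor_map (\<lambda>u x. u (x, 0)) (\<lambda>u x. u (x, 0)) (hcomul H u) (x, y)"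
      by (simp add: hcomul_crossed hcomul_group)
  qed
qed

lemma supported_at_zero_tensor_lift:
  assumes "\<And>x a b. supported_at 0 (\<beta> (basis_vec (x, a)) (basis_vec (x, b)))"
  shows "tensor_lift \<beta> (hcomul H h) \<in> range (\<lambda>f. bar f 0)"
  using assms unfolding supported_at_zero_iff[symmetric] supported_at_def tensor_lift_crossed by simp

lemma crossed_normal: "hopf_normal H (range (\<lambda>f. bar f 0))"
  unfolding hopf_normal_def
proof (intro exI[of _ crossed_antipode] conjI allI ballI crossed_antipode supported_at_zero_tensor_lift)
  fix u x a b
  assume "u \<in> range (\<lambda>f. bar f 0 :: 'c \<times> 'g \<Rightarrow> 'k)"
  then have u: "supported_at 0 u" by (simp add: supported_at_zero_iff)
  have "supported_at (x + 0 + - x) (hmul H (hmul H (basis_vec (x, a)) u) (crossed_antipode (basis_vec (x, b))))"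
    by (intro supported_at_hmul supported_at_basis_vec u supported_at_antipode)
  then show "supported_at 0 (hmul H (hmul H (basis_vec (x, a)) u) (crossed_antipode (basis_vec (x, b))))"
    by simp
  have "supported_at (- x + 0 + x) (hmul H (hmul H (crossed_antipode (basis_vec (x, a))) u) (basis_vec (x, b)))"
    by (intro supported_at_hmul supported_at_basis_vec u supported_at_antipode)
  then show "supported_at 0 (hmul H (hmul H (crossed_antipode (basis_vec (x, a))) u) (basis_vec (x, b)))"
    by simp
qed

lemma hmul_bar_zero: "hmul H (bar f 0) h (z, a) = f a * h (z, a)"
proof -
  have "hmul H (bar f 0) h (z, a) = (\<Sum>x\<in>UNIV. if x = (0::'c) then f a * h (z, a) else 0)"
    unfolding hmul_crossed by (intro sum.cong refl) (auto simp: bar_apply)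
  then show ?thesis by simp
qed

lemma crossed_kernel: "{u. (\<lambda>x. u (x, 0)) = (0 :: 'c \<Rightarrow> 'k)} = aug_ideal H (range (\<lambda>f. bar f 0))"
proof -
  interpret vs: vector_space "scale :: 'k \<Rightarrow> ('c \<times> 'g \<Rightarrow> 'k) \<Rightarrow> 'c \<times> 'g \<Rightarrow> 'k"
    by (rule vector_space_scale)
  have "vs.subspace {u. (\<lambda>x. u (x, 0)) = (0 :: 'c \<Rightarrow> 'k)}"
    by (rule vs.subspaceI) (auto simp: fun_eq_iff scale_def)
  moreover have "{hmul H a h | a h. a \<in> range (\<lambda>f. bar f 0) \<and> hcounit H a = 0} \<subseteq> {u. (\<lambda>x. u (x, 0)) = 0}"
    by (auto simp: fun_eq_iff hmul_bar_zero hcounit_crossed bar_apply)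
  ultimately have "aug_ideal H (range (\<lambda>f. bar f 0)) \<subseteq> {u. (\<lambda>x. u (x, 0)) = 0}"
    unfolding aug_ideal_def by (rule vs.span_minimal[rotated])
  moreover have "u \<in> aug_ideal H (range (\<lambda>f. bar f 0))" if "(\<lambda>x. u (x, 0)) = (0 :: 'c \<Rightarrow> 'k)" for u
    unfolding aug_ideal_def
  proof (rule vs.span_base, rule CollectI, intro exI conjI)
    \<comment> \<open>The left factor is the function 1 - p_0. It has counit zero and fixes every
      \<open>u\<close> that vanishes at all points \<open>(x, 0)\<close>.\<close>
    show "u = hmul H (bar (\<lambda>a. if a = 0 then 0 else 1) 0) u"
    proof (rule tensor_eqI)
      fix x a
      have "u (x, 0) = 0" using that by (metis zero_fun_apply)
      then show "u (x, a) = hmul H (bar (\<lambda>a. if a = 0 then 0 else 1) 0) u (x, a)"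
        by (auto simp: hmul_bar_zero)
    qed
    show "hcounit H (bar (\<lambda>a. if a = 0 then 0 else 1) 0) = 0"
      by (simp add: hcounit_crossed bar_apply)
  qed blast
  ultimately show ?thesis by blast
qed

lemma crossed_is_extension: "is_extension (crossed_ext \<tau> act)"
  unfolding is_extension_def crossed_ext_def hopf_ext.simps
proof (intro conjI crossed_is_hopf crossed_inc crossed_proj crossed_normal crossed_kernel)
  show "inj (\<lambda>f. bar f 0 :: 'c \<times> 'g \<Rightarrow> 'k)"
  proof (rule injI)
    fix f f' :: "'g \<Rightarrow> 'k"
    assume "(bar f 0 :: 'c \<times> 'g \<Rightarrow> 'k) = bar f' 0"
    then have "(bar f 0 :: 'c \<times> 'g \<Rightarrow> 'k) (0, a) = (bar f' 0 :: 'c \<times> 'g \<Rightarrow> 'k) (0, a)" for a by (rule fun_cong)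
    then show "f = f'" by (auto simp: bar_apply)
  qed
  show "surj (\<lambda>(u :: 'c \<times> 'g \<Rightarrow> 'k) x. u (x, 0))"
    by (rule surjI[of _ "\<lambda>f (x, a). f x"]) simp
qed

end

text \<open>The crossed homomorphism identity for \<open>\<eta>\<close> makes the map
  multiplicative, and \<open>delta_G \<eta>\<close> absorbs its effect on the comultiplication. The
  combination of \<open>\<eta>\<close>, \<open>\<alpha>\<close> and \<open>\<psi>\<close> serves
  both the passage between cocycles in one orbit and, with trivial \<open>\<eta>\<close>, the
  passage to another action of the same class.\<close>

lemma hopf_iso_crossed:
  fixes act act' :: "'g::{finite, ab_group_add} \<Rightarrow> 'c::{finite, ab_group_add} \<Rightarrow> 'g"
    and \<tau> \<tau>' :: "'c \<Rightarrow> 'g \<Rightarrow> 'g \<Rightarrow> 'k::field"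
  assumes \<alpha>: "\<alpha> \<in> group_auts" and \<psi>: "\<psi> \<in> group_auts"
    and equivariant: "\<And>a x. \<psi> (act' a x) = act (\<psi> a) (\<alpha> x)"
    and \<eta>: "\<eta> \<in> cochains1" "\<And>x y a. \<eta> (x + y) a = \<eta> x a * \<eta> y (act' a x)"
    and \<tau>': "\<And>x a b. \<tau>' x a b = delta_G \<eta> x a b * \<tau> (\<alpha> x) (\<psi> a) (\<psi> b)"
  shows "(\<lambda>u (x, a). \<eta> x a * u (\<alpha> x, \<psi> a)) \<in> hopf_iso (crossed_hopf \<tau> act) (crossed_hopf \<tau>' act')"
    (is "?T \<in> hopf_iso ?H ?H'")
proof (rule hopf_isoI)
  have \<alpha>_add: "\<alpha> (x + y) = \<alpha> x + \<alpha> y" and \<psi>_add: "\<psi> (a + b) = \<psi> a + \<psi> b"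
    and bij: "bij \<alpha>" "bij \<psi>" for x y a b
    using \<alpha> \<psi> by (auto simp: group_auts_def)
  have zero: "\<alpha> 0 = 0" "\<psi> 0 = 0" using \<alpha>_add[of 0 0] \<psi>_add[of 0 0] by simp_all
  have \<alpha>_minus: "\<alpha> (- x) = - \<alpha> x" for x
    using \<alpha>_add[of x "- x"] by (simp add: zero eq_neg_iff_add_eq_0 add.commute)
  have \<alpha>_diff: "\<alpha> (y - x) = \<alpha> y - \<alpha> x" for x y
    using \<alpha>_add[of y "- x"] by (simp add: \<alpha>_minus)
  have inj: "\<alpha> x = \<alpha> y \<longleftrightarrow> x = y" "\<psi> a = \<psi> b \<longleftrightarrow> a = b" for x y a b
    using bij by (auto simp: bij_def dest: injD)
  have \<eta>0: "\<eta> x a \<noteq> 0" and \<eta>1: "\<eta> 0 a = 1" "\<eta> x 0 = 1" for x a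
    using \<eta>(1) by (auto simp: cochains1_def)
  have reindex: "(\<Sum>x\<in>UNIV. f (\<alpha> x)) = (\<Sum>x\<in>UNIV. f x)" for f :: "'c \<Rightarrow> 'k"
    by (rule sum.reindex_bij_betw[OF bij(1)])
  have T: "?T u (x, a) = \<eta> x a * u (\<alpha> x, \<psi> a)" for u x a by simp
  show lin: "klinear ?T"
    unfolding klinear_iff by (auto simp: fun_eq_iff scale_def algebra_simps)
  show "?T (hmul ?H u v) = hmul ?H' (?T u) (?T v)" for u v
  proof (rule tensor_eqI)
    fix z a
    have "?T (hmul ?H u v) (z, a) =
        \<eta> z a * (\<Sum>x\<in>UNIV. u (\<alpha> x, \<psi> a) * v (- \<alpha> x + \<alpha> z, act (\<psi> a) (\<alpha> x)))"
      unfolding prod.case hmul_crossed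
      by (subst reindex[symmetric, where f = "\<lambda>x. u (x, \<psi> a) * v (- x + \<alpha> z, act (\<psi> a) x)"]) (rule refl)
    also have "\<dots> = hmul ?H' (?T u) (?T v) (z, a)"
      unfolding hmul_crossed sum_distrib_left
    proof (rule sum.cong[OF refl])
      fix x
      have "\<eta> z a = \<eta> x a * \<eta> (- x + z) (act' a x)" using \<eta>(2)[of x "- x + z" a] by simp
      then show "\<eta> z a * (u (\<alpha> x, \<psi> a) * v (- \<alpha> x + \<alpha> z, act (\<psi> a) (\<alpha> x))) =
          ?T u (x, a) * ?T v (- x + z, act' a x)"
        by (simp add: equivariant \<alpha>_diff)
    qed
    finally show "?T (hmul ?H u v) (z, a) = hmul ?H' (?T u) (?T v) (z, a)" .
  qed
  show "?T (hone ?H) = hone ?H'"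
    by (rule tensor_eqI) (use inj(1)[of _ 0] in \<open>auto simp: hone_crossed bar_apply \<eta>1 zero\<close>)
  show "hcounit ?H' (?T u) = hcounit ?H u" for u
    by (simp add: hcounit_crossed \<eta>1 zero reindex[of "\<lambda>x. u (x, 0)"])
  show "hcomul ?H' (?T u) = tensor_map ?T ?T (hcomul ?H u)" for u
  proof (rule tensor_eqI)
    fix k l :: "'c \<times> 'g"
    obtain x a y b where k: "k = (x, a)" "l = (y, b)" by (metis surj_pair)
    have "tensor_map ?T ?T (hcomul ?H u) (k, l) =
      (\<Sum>i\<in>UNIV. (\<Sum>j\<in>UNIV. hcomul ?H u (i, j) * (if j = (\<alpha> y, \<psi> b) then \<eta> x a * \<eta> y b else 0)) *
        (if i = (\<alpha> x, \<psi> a) then 1 else 0))"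
      unfolding tensor_map_apply sum_distrib_right
      by (intro sum.cong refl) (auto simp: k basis_vec_def)
    also have "\<dots> = hcomul ?H u ((\<alpha> x, \<psi> a), (\<alpha> y, \<psi> b)) * (\<eta> x a * \<eta> y b)"
      by (simp add: sum_delta_mult)
    finally show "hcomul ?H' (?T u) (k, l) = tensor_map ?T ?T (hcomul ?H u) (k, l)"
      by (auto simp: k hcomul_crossed inj \<tau>' delta_G_def \<psi>_add \<eta>0)
  qed
  show "bij ?T"
  proof (rule o_bij)
    let ?R = "\<lambda>u (x, a). u (inv_into UNIV \<alpha> x, inv_into UNIV \<psi> a) / \<eta> (inv_into UNIV \<alpha> x) (inv_into UNIV \<psi> a)"
    show "?R \<circ> ?T = id" "?T \<circ> ?R = id"
      using bij \<eta>0 by (auto simp: fun_eq_iff bij_is_surj surj_f_inv_f bij_is_inj inv_f_f)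
  qed
qed

section \<open>Characters and their heights\<close>

lemma power_eq_1_dvd:
  fixes \<zeta> :: "'k::field"
  assumes "prime p" "\<zeta> ^ p = 1" "\<zeta> ^ n = 1" "\<zeta> \<noteq> 1"
  shows "p dvd n"
proof (rule ccontr)
  assume "\<not> p dvd n"
  from inverse_mod_prime[OF assms(1) this] obtain k where "k * n mod p = 1" .
  then have "k * n = (k * n) div p * p + 1" by (metis div_mult_mod_eq)
  then have "\<zeta> ^ (k * n) = \<zeta> ^ ((k * n) div p * p + 1)" by simp
  moreover have "\<zeta> ^ (k * n) = 1" by (simp add: assms(3) power_mult mult.commute[of k])
  moreover have "\<zeta> ^ ((k * n) div p * p + 1) = \<zeta>"
    using assms(2) by (simp add: power_add power_mult mult.commute[of _ p])
  ultimately show False using assms(4) by simp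
qed

lemma power_eq_imp_mod_eq:
  fixes \<zeta> :: "'k::field"
  assumes "prime p" "\<zeta> ^ p = 1" "\<zeta> \<noteq> 1" "\<zeta> ^ m = \<zeta> ^ n"
  shows "m mod p = n mod p"
proof -
  have nz: "\<zeta> \<noteq> 0" using assms(1,2) by (auto simp: power_0_left)
  have *: "m mod p = n mod p" if eq: "\<zeta> ^ m = \<zeta> ^ n" and "m \<le> n" for m n
  proof -
    have "\<zeta> ^ n = \<zeta> ^ m * \<zeta> ^ (n - m)" using \<open>m \<le> n\<close> by (simp flip: power_add)
    then have "\<zeta> ^ (n - m) = 1" using eq nz by simp
    then have "p dvd n - m" using power_eq_1_dvd assms by blast
    then show ?thesis using \<open>m \<le> n\<close> by (metis mod_eq_dvd_iff_nat)
  qed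
  show ?thesis
  proof (cases "m \<le> n")
    case True
    then show ?thesis by (rule *[OF assms(4)])
  next
    case False
    then show ?thesis using *[OF assms(4)[symmetric]] by simp
  qed
qed

lemma finite_roots_of_unity: "0 < n \<Longrightarrow> finite {z :: 'k::field. z ^ n = 1}"
  and card_roots_of_unity: "0 < n \<Longrightarrow> card {z :: 'k::field. z ^ n = 1} \<le> n"
proof -
  assume n: "0 < n"
  define q where "q = monom (1 :: 'k) n - 1"
  have "coeff q n = 1" using n by (simp add: q_def)
  then have q: "q \<noteq> 0" by auto
  have "{z :: 'k. z ^ n = 1} = {z. poly q z = 0}" by (simp add: q_def poly_monom)
  moreover have "degree q \<le> n"
    unfolding q_def by (rule degree_diff_le) (simp_all add: degree_monom_eq)
  ultimately show "finite {z :: 'k::field. z ^ n = 1}" "card {z :: 'k::field. z ^ n = 1} \<le> n"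
    using poly_roots_finite[OF q] card_poly_roots_bound[OF q] by simp_all
qed

text \<open>A nontrivial root has \<open>p\<close> distinct powers, as many as X^p - 1 can have
  roots. This provides the discrete logarithms of characters.\<close>

lemma root_of_unity_is_power:
  fixes \<zeta> z :: "'k::field"
  assumes "prime p" "\<zeta> ^ p = 1" "\<zeta> \<noteq> 1" "z ^ p = 1"
  obtains i where "\<zeta> ^ i = z"
proof -
  have p: "0 < p" using assms(1) prime_gt_0_nat by blast
  let ?U = "{z :: 'k. z ^ p = 1}"
  have "inj_on (\<lambda>i. \<zeta> ^ i) {..<p}"
    by (rule inj_onI) (use power_eq_imp_mod_eq[OF assms(1-3)] in fastforce)
  then have "card ((\<lambda>i. \<zeta> ^ i) ` {..<p}) = p" by (simp add: card_image)
  moreover have "(\<lambda>i. \<zeta> ^ i) ` {..<p} \<subseteq> ?U"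
    using assms(2) by (auto simp: mult.commute[of _ p] power_mult simp flip: power_mult[of _ _ p])
  ultimately have "(\<lambda>i. \<zeta> ^ i) ` {..<p} = ?U"
    using card_roots_of_unity[OF p, where 'k = 'k] finite_roots_of_unity[OF p, where 'k = 'k]
    by (metis card_seteq)
  then have "z \<in> (\<lambda>i. \<zeta> ^ i) ` {..<p}" using assms(4) by simp
  then show ?thesis using that by blast
qed

text \<open>With \<open>f\<close> the slice \<open>\<tau> x\<close>, this is the condition for
  \<open>bar w x\<close> to be group-like; the constant slice one gives the characters.\<close>

definition grouplike_fun :: "('g::ab_group_add \<Rightarrow> 'g \<Rightarrow> 'k::field) \<Rightarrow> ('g \<Rightarrow> 'k) \<Rightarrow> bool" where
  "grouplike_fun f w \<longleftrightarrow> w 0 = 1 \<and> (\<forall>a b. w a * w b = f a b * w (a + b))"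

lemma grouplike_funD:
  assumes "grouplike_fun f w"
  shows "w 0 = 1" "w a * w b = f a b * w (a + b)"
  using assms by (auto simp: grouplike_fun_def)

lemma grouplike_fun_nonzero:
  assumes "grouplike_fun f w" "\<And>a b. f a b \<noteq> 0"
  shows "w a \<noteq> 0"
proof
  assume "w a = 0"
  then have "f a (- a) * w (a + - a) = 0" using grouplike_funD(2)[OF assms(1), of a "- a"] by simp
  then show False using assms by (simp add: grouplike_funD)
qed

definition characters :: "('g::ab_group_add \<Rightarrow> 'k::field) set" where
  "characters = {\<chi>. grouplike_fun (\<lambda>_ _. 1) \<chi>}"

lemma charactersI: "\<chi> 0 = 1 \<Longrightarrow> (\<And>a b. \<chi> (a + b) = \<chi> a * \<chi> b) \<Longrightarrow> \<chi> \<in> characters"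
  by (simp add: characters_def grouplike_fun_def)

lemma characterD:
  assumes "\<chi> \<in> characters"
  shows "\<chi> 0 = 1" "\<chi> (a + b) = \<chi> a * \<chi> b" "\<chi> a \<noteq> 0"
  using assms grouplike_fun_nonzero[of "\<lambda>_ _. 1" \<chi> a] by (auto simp: characters_def grouplike_fun_def)

lemma character_nmul: "\<chi> \<in> characters \<Longrightarrow> \<chi> (nmul n a) = \<chi> a ^ n"
  by (induction n) (simp_all add: characterD nmul_Suc)

lemma character_diff:
  assumes "\<chi> \<in> characters"
  shows "\<chi> (a - b) = \<chi> a / \<chi> b"
proof -
  have "\<chi> a = \<chi> (a - b) * \<chi> b" using characterD(2)[OF assms, of "a - b" b] by simp
  then show ?thesis using characterD(3)[OF assms] by simp
qed

lemma character_sum: "\<chi> \<in> characters \<Longrightarrow> \<chi> (\<Sum>i\<in>A. f i) = (\<Prod>i\<in>A. \<chi> (f i))"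
  by (induction A rule: infinite_finite_induct) (simp_all add: characterD)

text \<open>The coefficient function of the \<open>n\<close>-th power of \<open>bar w x\<close> in
  the crossed product, by \<open>hpow_bar\<close>. For a generator \<open>x\<close> of C_p and
  \<open>n = p\<close> it is the norm map on characters.\<close>

definition act_prod :: "('g \<Rightarrow> 'c::ab_group_add \<Rightarrow> 'g) \<Rightarrow> nat \<Rightarrow> 'c \<Rightarrow> ('g \<Rightarrow> 'k::field) \<Rightarrow> 'g \<Rightarrow> 'k" where
  "act_prod act n x w a = (\<Prod>i<n. w (act a (nmul i x)))"

context right_action
begin

lemma act_prod_add:
  "act_prod act (m + n) x w a = act_prod act m x w a * act_prod act n x w (act a (nmul m x))"
  by (induction n) (simp_all add: act_prod_def nmul_plus_left mult.assoc flip: act_plus)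

lemma act_prod_0 [simp]: "act_prod act 0 x w a = 1"
  and act_prod_1 [simp]: "act_prod act (Suc 0) x w a = w a"
  by (simp_all add: act_prod_def)

lemma act_prod_trivial: "act_prod act n 0 w a = w a ^ n"
  by (simp add: act_prod_def)

end

context crossed_cocycle
begin

lemma tau_nmul: "\<tau> (nmul n x) a b = (\<Prod>i<n. \<tau> x (act a (nmul i x)) (act b (nmul i x)))"
  by (induction n) (simp_all add: nmul_Suc tau_plus)

text \<open>Powers of group-like elements are group-like; on coefficient functions this holds
  because the slice of \<open>\<tau>\<close> over a multiple of \<open>x\<close> is a product of
  translated slices.\<close>

lemma act_prod_grouplike:
  assumes "grouplike_fun (\<tau> x) w"
  shows "grouplike_fun (\<tau> (nmul n x)) (act_prod act n x w)"
  unfolding grouplike_fun_def act_prod_def tau_nmul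
  using grouplike_funD[OF assms] by (simp add: act_add flip: prod.distrib)

end

section \<open>The operator \<open>N\<close> and the height filtration of the characters\<close>

locale prime_action = right_action act
  for act :: "'g::{finite, ab_group_add} \<Rightarrow> 'c::{finite, ab_group_add} \<Rightarrow> 'g" +
  fixes g :: 'c and p :: nat
  assumes prime_p: "prime p" and card_p: "CARD('c) = p" and g_nonzero: "g \<noteq> 0"
    and exponent: "elementary_abelian p TYPE('g)"
begin

lemma nmul_p_zero [simp]: "nmul p (a :: 'g) = 0" "nmul p (x :: 'c) = 0"
  using exponent nmul_CARD[of x] by (simp_all add: elementary_abelian_def nmul_def[of _ a] card_p)

definition N :: "'g \<Rightarrow> 'g" where "N a = act a g - a"

lemma act_g: "act a g = a + N a" by (simp add: N_def)

lemma N_add: "N (a + b) = N a + N b" by (simp add: N_def act_add)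

lemma N_pow_add: "(N ^^ n) (a + b) = (N ^^ n) a + (N ^^ n) b"
  by (induction n) (simp_all add: N_add)

lemma N_zero [simp]: "N 0 = 0" by (simp add: N_def)

lemma N_pow_zero [simp]: "(N ^^ n) 0 = 0" by (induction n) simp_all

lemma N_sum: "N (\<Sum>i\<in>A. f i) = (\<Sum>i\<in>A. N (f i))"
  by (induction A rule: infinite_finite_induct) (simp_all add: N_add)

lemma N_pow_minus: "(N ^^ n) (- a) = - (N ^^ n) a"
  using N_pow_add[of n a "- a"] by (simp add: eq_neg_iff_add_eq_0 add.commute)

lemma act_binomial: "act a (nmul n g) = (\<Sum>j\<le>n. nmul (n choose j) ((N ^^ j) a))"
proof (induction n)
  case 0
  show ?case by simp
next
  case (Suc n)
  let ?S = "\<lambda>m. \<Sum>j\<le>m. nmul (n choose j) ((N ^^ j) a)"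
  have "act a (nmul (Suc n) g) = ?S n + N (?S n)"
    by (simp only: nmul_Suc act_plus Suc.IH act_g)
  also have "N (?S n) = (\<Sum>j\<le>n. nmul (n choose j) ((N ^^ Suc j) a))"
    by (simp add: N_sum additive_nmul[of N, OF N_add])
  also have "?S n = ?S (Suc n)" by (simp add: binomial_eq_0)
  also have "?S (Suc n) = (N ^^ 0) a + (\<Sum>j\<le>n. nmul (n choose Suc j) ((N ^^ Suc j) a))"
    unfolding sum.atMost_Suc_shift by simp
  also have "\<dots> + (\<Sum>j\<le>n. nmul (n choose j) ((N ^^ Suc j) a)) =
      (\<Sum>j\<le>Suc n. nmul (Suc n choose j) ((N ^^ j) a))"
    unfolding sum.atMost_Suc_shift
    by (simp add: nmul_plus_left sum.distrib add.assoc add.commute del: funpow.simps)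
  finally show ?case .
qed

text \<open>The \<open>p\<close>-th multiple of \<open>g\<close> acts trivially. In its expansion as
  (1 + N)^p the inner binomial coefficients are divisible by \<open>p\<close> and vanish on
  \<open>G\<close>, which leaves a = a + N^p a.\<close>

lemma N_nilpotent: "(N ^^ p) a = 0"
proof -
  have p0: "0 < p" using prime_p prime_gt_0_nat by blast
  have "a = (\<Sum>j\<le>p. nmul (p choose j) ((N ^^ j) a))"
    using act_binomial[of a p] by simp
  also have "\<dots> = (\<Sum>j\<in>{0, p}. nmul (p choose j) ((N ^^ j) a))"
  proof (rule sum.mono_neutral_right)
    show "\<forall>j\<in>{..p} - {0, p}. nmul (p choose j) ((N ^^ j) a) = 0"
    proof
      fix j assume "j \<in> {..p} - {0, p}"
      then have "p dvd p choose j" using prime_p by (intro dvd_choose_prime) auto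
      then show "nmul (p choose j) ((N ^^ j) a) = 0"
        by (elim dvdE) (simp add: mult.commute[of p] nmul_mult)
    qed
  qed auto
  also have "\<dots> = a + (N ^^ p) a" using p0 by simp
  finally show ?thesis by simp
qed

lemma generated_by_g: obtains i where "nmul i g = x"
  using prime_card_generated[OF _ g_nonzero] prime_p card_p by blast

text \<open>Commuting with \<open>N\<close> means commuting with the action of \<open>g\<close>, and
  \<open>g\<close> generates C_p.\<close>

lemma equivariantI:
  assumes "\<And>a. l (N a) = N (l a)" "\<And>a b. l (a + b) = l a + l b"
  shows "l (act a x) = act (l a) x"
proof -
  obtain i where i: "x = nmul i g" using generated_by_g by metis
  have g: "l (act a g) = act (l a) g" for a by (simp add: act_g assms)
  have "l (act a (nmul i g)) = act (l a) (nmul i g)"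
    by (induction i) (simp_all add: nmul_Suc act_plus g)
  then show ?thesis by (simp add: i)
qed

lemma character_pow_p: "\<chi> \<in> characters \<Longrightarrow> \<chi> a ^ p = 1" for \<chi> :: "'g \<Rightarrow> 'k::field"
  using character_nmul[of \<chi> p a] by (simp add: characterD)

text \<open>The image of the \<open>h\<close>-th power of the transpose of \<open>N\<close>. These
  sets form a decreasing filtration from all characters at \<open>h = 0\<close> to the trivial one
  at \<open>h = p\<close>.\<close>

definition height_ge :: "nat \<Rightarrow> ('g \<Rightarrow> 'k::field) set" where
  "height_ge h = {\<xi> \<circ> (N ^^ h) | \<xi>. \<xi> \<in> characters}"

lemma height_ge_0: "height_ge 0 = characters"
  by (simp add: height_ge_def)

lemma height_ge_p: "\<chi> \<in> height_ge p \<Longrightarrow> \<chi> a = 1"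
  by (auto simp: height_ge_def N_nilpotent characterD)

text \<open>Duality: the annihilator of the kernel of N^h is the image of its transpose. A character
  that is trivial on the kernel descends to the range, and the extension lemma for the constant
  cocycle one carries it to all of \<open>G\<close>.\<close>

lemma height_ge_if_trivial_on_kernel:
  fixes \<chi> :: "'g \<Rightarrow> 'k::alg_closed_field"
  assumes \<chi>: "\<chi> \<in> characters" and ker: "\<And>a. (N ^^ h) a = 0 \<Longrightarrow> \<chi> a = 1"
  shows "\<chi> \<in> height_ge h"
proof -
  let ?S = "range (N ^^ h)"
  \<comment> \<open>The chosen preimage does not matter, since two preimages differ by an element of
    the kernel.\<close>
  define \<psi> where "\<psi> s = \<chi> (SOME a. (N ^^ h) a = s)" for s
  have \<psi>: "\<psi> ((N ^^ h) a) = \<chi> a" for a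
  proof -
    let ?b = "SOME b. (N ^^ h) b = (N ^^ h) a"
    have "(N ^^ h) ?b = (N ^^ h) a" by (rule someI) (rule refl)
    then have "(N ^^ h) (?b - a) = 0"
      using N_pow_add[of h ?b "- a"] by (simp add: N_pow_minus)
    from ker[OF this] show ?thesis
      unfolding \<psi>_def character_diff[OF \<chi>] using characterD(3)[OF \<chi>] by simp
  qed
  have "symmetric_cocycle (\<lambda>_ _. 1 :: 'k)" by (simp add: symmetric_cocycle_def)
  then obtain \<xi> where \<xi>: "\<xi> 0 = 1" "\<And>a b. \<xi> a * \<xi> b = 1 * \<xi> (a + b)" "\<And>s. s \<in> ?S \<Longrightarrow> \<xi> s = \<psi> s"
  proof (rule symmetric_cocycle_extension[where S = ?S and \<psi> = \<psi>])
    show "0 \<in> ?S" by (rule range_eqI[of _ _ 0]) simp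
    show "s + t \<in> ?S" if st: "s \<in> ?S" "t \<in> ?S" for s t
    proof -
      obtain a b where "s = (N ^^ h) a" "t = (N ^^ h) b" using st by blast
      then show ?thesis by (intro range_eqI[of _ _ "a + b"]) (simp add: N_pow_add)
    qed
    show "- s \<in> ?S" if "s \<in> ?S" for s
    proof -
      obtain a where "s = (N ^^ h) a" using \<open>s \<in> ?S\<close> by blast
      then show ?thesis by (intro range_eqI[of _ _ "- a"]) (simp add: N_pow_minus)
    qed
    show "\<psi> 0 = 1" using \<psi>[of 0] characterD(1)[OF \<chi>] by simp
    show "\<psi> s * \<psi> t = 1 * \<psi> (s + t)" if st: "s \<in> ?S" "t \<in> ?S" for s t
    proof -
      obtain a b where "s = (N ^^ h) a" "t = (N ^^ h) b" using st by blast
      then show ?thesis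
        using \<psi>[of "a + b"] by (simp add: \<psi> N_pow_add characterD(2)[OF \<chi>])
    qed
    fix \<eta> assume "\<eta> 0 = 1" "\<And>a b. \<eta> a * \<eta> b = 1 * \<eta> (a + b)" "\<And>s. s \<in> ?S \<Longrightarrow> \<eta> s = \<psi> s"
    then show thesis by (rule that)
  qed
  have "\<xi> \<in> characters" by (rule charactersI) (use \<xi> in auto)
  moreover have "\<chi> = \<xi> \<circ> (N ^^ h)" by (auto simp: \<psi> \<xi>)
  ultimately show ?thesis unfolding height_ge_def by blast
qed

text \<open>The automorphism is the transpose of a transvection: it adds to \<open>a\<close> a combination of
  the \<open>N\<^sup>j u\<close> whose coefficients are the discrete logarithms of the character \<open>\<theta>\<close> at the
  \<open>N\<^sup>i a\<close>, where \<open>\<chi>' / \<chi> = \<theta> \<circ> N\<^sup>h\<close>.\<close>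

lemma transvection:
  fixes \<chi> \<chi>' :: "'g \<Rightarrow> 'k::alg_closed_field"
  assumes \<chi>: "\<chi> \<in> characters" "\<And>a. \<chi> (N a) = 1" and \<chi>': "\<chi>' \<in> characters" "\<And>a. \<chi>' (N a) = 1"
    and same: "\<And>h. \<chi> \<in> height_ge h \<longleftrightarrow> \<chi>' \<in> height_ge h"
  obtains l where "l \<in> carrier (aut_group act)" "\<chi>' = \<chi> \<circ> l"
proof (cases "\<chi> \<in> height_ge p")
  case True
  then have "\<chi> a = 1" "\<chi>' a = 1" for a using same height_ge_p by blast+
  then have "\<chi>' = \<chi> \<circ> id" by auto
  moreover have "id \<in> carrier (aut_group act)" by (simp add: aut_group_def group_auts_def)
  ultimately show ?thesis by (rule that[rotated])
next
  case False
  \<comment> \<open>Otherwise membership would climb from height zero to height \<open>p\<close>,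
    which is excluded in this case.\<close>
  have "\<exists>h. \<chi> \<in> height_ge h \<and> \<chi> \<notin> height_ge (Suc h)"
  proof (rule ccontr)
    assume "\<not> ?thesis"
    then have "\<chi> \<in> height_ge h" for h
      by (induction h) (use \<chi>(1) in \<open>auto simp: height_ge_0\<close>)
    then show False using False by blast
  qed
  then obtain h where h: "\<chi> \<in> height_ge h" "\<chi> \<notin> height_ge (Suc h)" by blast
  then have h': "\<chi>' \<in> height_ge h" "\<chi>' \<notin> height_ge (Suc h)" using same by blast+
  obtain \<xi> \<xi>' where \<xi>: "\<xi> \<in> characters" "\<chi> = \<xi> \<circ> (N ^^ h)" and \<xi>': "\<xi>' \<in> characters" "\<chi>' = \<xi>' \<circ> (N ^^ h)"
    using h(1) h'(1) by (auto simp: height_ge_def)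
  obtain u1 where u1: "(N ^^ Suc h) u1 = 0" "\<chi> u1 \<noteq> 1"
    using height_ge_if_trivial_on_kernel[OF \<chi>(1)] h(2) by blast
  obtain u2 where u2: "(N ^^ Suc h) u2 = 0" "\<chi>' u2 \<noteq> 1"
    using height_ge_if_trivial_on_kernel[OF \<chi>'(1)] h'(2) by blast
  \<comment> \<open>If \<open>u1\<close> fails for \<open>\<chi>'\<close> and \<open>u2\<close>
    fails for \<open>\<chi>\<close>, their sum works for both. The value \<open>\<chi> u\<close>
    becomes the base of the logarithms, and \<open>\<chi>' u \<noteq> 1\<close> gives the
    injectivity of \<open>l\<close>.\<close>
  obtain u where u: "(N ^^ Suc h) u = 0" "\<chi> u \<noteq> 1" "\<chi>' u \<noteq> 1"
  proof (cases "\<chi>' u1 = 1")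
    case True
    show ?thesis
    proof (cases "\<chi> u2 = 1")
      case 2: True
      show ?thesis
        by (rule that[of "u1 + u2"]) (use u1 u2 True 2 \<chi>(1) \<chi>'(1) in \<open>simp_all only: N_pow_add characterD, simp_all\<close>)
    next
      case False
      then show ?thesis using u2 that by blast
    qed
  next
    case False
    then show ?thesis using u1 that by blast
  qed
  define \<zeta> where "\<zeta> = \<chi> u"
  have \<zeta>: "\<zeta> ^ p = 1" "\<zeta> \<noteq> 1" "\<zeta> \<noteq> 0"
    using u(2) \<chi>(1) by (simp_all add: \<zeta>_def character_pow_p characterD)
  define \<theta> where "\<theta> a = \<xi>' a / \<xi> a" for a
  have \<theta>: "\<theta> \<in> characters"
    by (rule charactersI) (simp_all add: \<theta>_def characterD[OF \<xi>(1)] characterD[OF \<xi>'(1)])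
  have "\<exists>i. \<zeta> ^ i = \<theta> a" for a
    using root_of_unity_is_power[OF prime_p \<zeta>(1,2) character_pow_p[OF \<theta>]] by metis
  then obtain dlog where dlog: "\<And>a. \<zeta> ^ dlog a = \<theta> a" by metis
  have nmul_eq: "nmul m v = nmul n v" if "\<zeta> ^ m = \<zeta> ^ n" for m n and v :: 'g
    using power_eq_imp_mod_eq[OF prime_p \<zeta>(1,2) that] nmul_mod[of p v] by (metis nmul_p_zero(1))
  \<comment> \<open>The logarithm is determined modulo \<open>p\<close> only, but multiples in
    \<open>G\<close> depend on it only modulo \<open>p\<close>; hence \<open>L\<close> is additive
    in its first argument.\<close>
  define L where "L a v = nmul (dlog a) v" for a and v :: 'g
  have L_add: "L (a + b) v = L a v + L b v" for a b v
    unfolding L_def nmul_plus_left[symmetric]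
    by (rule nmul_eq) (simp add: dlog power_add characterD(2)[OF \<theta>])
  have L_zero: "L a v = 0" if "\<theta> a = 1" for a v
    using nmul_eq[of "dlog a" 0 v] that by (simp add: L_def dlog)
  have \<theta>N: "\<theta> ((N ^^ h) a) = \<chi>' a / \<chi> a" for a by (simp add: \<theta>_def \<xi> \<xi>')
  define T where "T a = (\<Sum>i\<le>h. L ((N ^^ i) a) ((N ^^ (h - i)) u))" for a
  define l where "l a = a + T a" for a
  have l_add: "l (a + b) = l a + l b" for a b
    by (simp add: l_def T_def N_pow_add L_add sum.distrib algebra_simps)
  have l_N: "l (N a) = N (l a)" for a
  proof -
    \<comment> \<open>\<open>T (N a)\<close> and \<open>N (T a)\<close> are sums of \<open>f\<close>
      over ranges shifted by one, so their difference reduces to the two end terms. The term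
      \<open>f 0\<close> vanishes by the choice of \<open>u\<close>, and \<open>f (Suc h)\<close>
      because both characters are invariant.\<close>
    define f where "f i = L ((N ^^ i) a) ((N ^^ (Suc h - i)) u)" for i
    have "T (N a) = (\<Sum>i\<le>h. f (Suc i))"
      unfolding T_def f_def by (simp add: funpow_swap1)
    moreover have "N (T a) = (\<Sum>i\<le>h. f i)"
      unfolding T_def N_sum f_def L_def
      by (intro sum.cong refl) (simp add: additive_nmul[of N, OF N_add] Suc_diff_le)
    moreover have "f 0 + (\<Sum>i\<le>h. f (Suc i)) = (\<Sum>i\<le>h. f i) + f (Suc h)"
      by (simp only: sum.atMost_Suc_shift[symmetric] sum.atMost_Suc)
    moreover have "f 0 = 0" using u(1) by (simp add: f_def L_def)
    moreover have "f (Suc h) = 0"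
    proof -
      have "\<theta> ((N ^^ Suc h) a) = 1"
        using \<theta>N[of "N a"] \<chi>(2) \<chi>'(2) by (simp add: funpow_swap1)
      then show ?thesis by (simp add: f_def L_zero)
    qed
    ultimately show ?thesis by (simp add: l_def N_add)
  qed
  have l_Npow: "l ((N ^^ n) a) = (N ^^ n) (l a)" for n a
    by (induction n) (simp_all add: l_N)
  have ker: "a = 0" if la: "l a = 0" for a
  proof (rule ccontr)
    assume "a \<noteq> 0"
    \<comment> \<open>A nonzero element of the kernel of \<open>l\<close> is replaced by its last
      nonzero iterate under \<open>N\<close>, on which \<open>T\<close> reduces to its term for
      \<open>i = 0\<close>.\<close>
    have "\<exists>j. (N ^^ j) a \<noteq> 0 \<and> (N ^^ Suc j) a = 0"
    proof (rule ccontr)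
      assume *: "\<not> ?thesis"
      have "(N ^^ j) a \<noteq> 0" for j by (induction j) (use * \<open>a \<noteq> 0\<close> in auto)
      then show False using N_nilpotent by blast
    qed
    then obtain j where j: "(N ^^ j) a \<noteq> 0" "(N ^^ Suc j) a = 0" by blast
    define s where "s = (N ^^ j) a"
    have s: "s \<noteq> 0" "N s = 0" "l s = 0" using j la by (simp_all add: s_def l_Npow)
    have Ns: "(N ^^ i) s = 0" if "i \<noteq> 0" for i
      using that s(2) by (cases i) (simp_all add: funpow_swap1)
    have "T s = (\<Sum>i\<le>h. if i = 0 then L s ((N ^^ h) u) else 0)"
      unfolding T_def by (intro sum.cong refl) (auto simp: Ns L_zero characterD(1)[OF \<theta>])
    then have s_sum: "s + nmul (dlog s) ((N ^^ h) u) = 0" using s(3) by (simp add: l_def L_def)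
    \<comment> \<open>Applying \<open>\<theta>\<close> to the relation cancels the base
      \<open>\<zeta>\<close> and leaves \<open>\<chi>' u\<close> to the power \<open>dlog s\<close>,
      so \<open>p\<close> divides this exponent and \<open>s\<close> vanishes.\<close>
    then have "\<theta> s * \<theta> ((N ^^ h) u) ^ dlog s = 1"
      by (metis \<theta> character_nmul characterD(1,2))
    then have "\<zeta> ^ dlog s * (\<chi>' u / \<zeta>) ^ dlog s = 1" by (simp only: \<theta>N dlog \<zeta>_def[symmetric])
    then have "\<chi>' u ^ dlog s = 1" using \<zeta>(3) by (simp add: power_divide)
    then have "p dvd dlog s"
      using power_eq_1_dvd[OF prime_p character_pow_p[OF \<chi>'(1)]] u(3) by blast
    then have "nmul (dlog s) ((N ^^ h) u) = 0"
      by (elim dvdE) (simp add: mult.commute[of p] nmul_mult)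
    then show False using s_sum s(1) by simp
  qed
  have "inj l"
  proof (rule injI)
    fix a b assume "l a = l b"
    then have "l (a - b) = 0" using l_add[of "a - b" b] by simp
    then show "a = b" using ker by fastforce
  qed
  then have "bij l" by (simp add: bij_def finite_UNIV_inj_surj)
  then have "l \<in> carrier (aut_group act)"
    using l_add equivariantI[of l, OF l_N l_add] by (simp add: aut_group_def group_auts_def)
  moreover have "\<chi>' a = \<chi> (l a)" for a
  proof -
    \<comment> \<open>Since \<open>\<chi>\<close> is trivial on the range of \<open>N\<close>, only
      the term for \<open>i = h\<close> contributes to \<open>\<chi> (T a)\<close>; it equals
      \<open>\<theta> ((N ^^ h) a)\<close>, the required quotient of the two characters.\<close>
    have \<chi>N: "\<chi> ((N ^^ i) u) = 1" if "i \<noteq> 0" for i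
      using that \<chi>(2) by (cases i) simp_all
    have "\<chi> (T a) = (\<Prod>i\<le>h. if i = h then \<zeta> ^ dlog ((N ^^ h) a) else 1)"
      unfolding T_def character_sum[OF \<chi>(1)] L_def character_nmul[OF \<chi>(1)]
      by (intro prod.cong refl) (auto simp: \<chi>N \<zeta>_def)
    then have "\<chi> (T a) = \<chi>' a / \<chi> a" by (simp add: dlog \<theta>N)
    then show ?thesis using characterD(3)[OF \<chi>(1)] by (simp add: l_def characterD(2)[OF \<chi>(1)])
  qed
  ultimately show ?thesis by (intro that[of l]) auto
qed

end

section \<open>Group-like elements and Hopf algebra isomorphisms\<close>

primrec hpow :: "('b, 'k) hopf \<Rightarrow> nat \<Rightarrow> ('b \<Rightarrow> 'k) \<Rightarrow> 'b \<Rightarrow> 'k" where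
  "hpow H 0 u = hone H"
| "hpow H (Suc n) u = hmul H u (hpow H n u)"

lemma hpow_add:
  assumes "is_algebra H"
  shows "hpow H (m + n) u = hmul H (hpow H m u) (hpow H n u)"
  by (induction m) (use assms in \<open>simp_all add: is_algebra_def\<close>)

lemma hpow_mult:
  assumes "is_algebra H"
  shows "hpow H (m * n) u = hpow H m (hpow H n u)"
  by (induction m) (simp_all add: hpow_add[OF assms])

lemma hpow_hopf_iso: "F \<in> hopf_iso H H' \<Longrightarrow> F (hpow H n u) = hpow H' n (F u)"
  by (induction n) (simp_all add: hopf_isoD)

lemma bar_eq_iff:
  assumes "w 0 = 1" "w' 0 = 1"
  shows "bar w x = (bar w' x' :: 'c \<times> 'g::zero \<Rightarrow> 'k::field) \<longleftrightarrow> w = w' \<and> x = x'"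
proof
  assume eq: "bar w x = (bar w' x' :: 'c \<times> 'g \<Rightarrow> 'k)"
  have *: "bar w x (x, a) = (bar w' x' :: 'c \<times> 'g \<Rightarrow> 'k) (x, a)" for a by (simp only: eq)
  have "x = x'" using *[of 0] assms by (auto simp: bar_apply split: if_splits)
  then show "w = w' \<and> x = x'" using * by (auto simp: bar_apply)
qed simp

text \<open>Coefficients over distinct \<open>x\<close> and \<open>y\<close> multiply to zero, so a
  group-like element lives over a single \<open>x\<close>, found from the nonzero counit. On that
  component the coproduct condition is the one in \<open>grouplike_fun\<close>.\<close>

lemma grouplike_crossed_iff:
  fixes \<tau> :: "'c::{finite, ab_group_add} \<Rightarrow> 'g::{finite, ab_group_add} \<Rightarrow> 'g \<Rightarrow> 'k::field"
  shows "hcomul (crossed_hopf \<tau> act) u = tensor u u \<and> hcounit (crossed_hopf \<tau> act) u = 1 \<longleftrightarrow>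
    (\<exists>x w. u = bar w x \<and> grouplike_fun (\<tau> x) w)" (is "?l \<longleftrightarrow> ?r")
proof
  assume l: ?l
  then have mult: "u (x, a) * u (y, b) = (if x = y then \<tau> x a b * u (x, a + b) else 0)" for x y a b
    using hcomul_crossed[of \<tau> act u x a y b] by (simp add: tensor_def)
  have sum: "(\<Sum>x\<in>UNIV. u (x, 0)) = 1" using l by (simp add: hcounit_crossed)
  have "\<exists>x. u (x, 0) \<noteq> 0"
  proof (rule ccontr)
    assume "\<not> ?thesis"
    then show False using sum by simp
  qed
  then obtain x where x: "u (x, 0) \<noteq> 0" by blast
  have zero: "u (y, b) = 0" if "y \<noteq> x" for y b
    using mult[of x 0 y b] x that by simp
  then have u: "u = bar (\<lambda>a. u (x, a)) x"
    by (intro tensor_eqI) (simp add: bar_apply)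
  have "(\<Sum>y\<in>UNIV. u (y, 0)) = (\<Sum>y\<in>UNIV. if y = x then u (x, 0) else 0)"
    by (intro sum.cong refl) (auto simp: zero)
  then have "u (x, 0) = 1" using sum by simp
  then have "grouplike_fun (\<tau> x) (\<lambda>a. u (x, a))"
    using mult[of x _ x] by (simp add: grouplike_fun_def)
  then show ?r using u by blast
next
  assume ?r
  then obtain x w where u: "u = bar w x" and w: "grouplike_fun (\<tau> x) w" by blast
  have "(\<Sum>y\<in>UNIV. bar w x (y, 0)) = (\<Sum>y\<in>UNIV. if y = x then w 0 else 0)"
    by (intro sum.cong refl) (auto simp: bar_apply)
  then have "hcounit (crossed_hopf \<tau> act) u = 1"
    by (simp add: u hcounit_crossed grouplike_funD(1)[OF w])
  moreover have "hcomul (crossed_hopf \<tau> act) u (k, l) = tensor u u (k, l)" for k l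
    by (cases k; cases l) (use grouplike_funD(2)[OF w] in \<open>simp add: u hcomul_crossed tensor_def bar_apply\<close>)
  ultimately show ?l by (intro conjI tensor_eqI)
qed

lemma hopf_iso_bar:
  fixes \<tau> \<tau>' :: "'c::{finite, ab_group_add} \<Rightarrow> 'g::{finite, ab_group_add} \<Rightarrow> 'g \<Rightarrow> 'k::field"
  assumes F: "F \<in> hopf_iso (crossed_hopf \<tau> act) (crossed_hopf \<tau>' act')" and w: "grouplike_fun (\<tau> x) w"
  obtains x' w' where "F (bar w x) = bar w' x'" "grouplike_fun (\<tau>' x') w'"
proof -
  let ?u = "bar w x" and ?H = "crossed_hopf \<tau> act" and ?H' = "crossed_hopf \<tau>' act'"
  have "hcomul ?H ?u = tensor ?u ?u \<and> hcounit ?H ?u = 1"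
    unfolding grouplike_crossed_iff using w by blast
  then have "hcomul ?H' (F ?u) = tensor (F ?u) (F ?u) \<and> hcounit ?H' (F ?u) = 1"
    using hopf_isoD[OF F] by (simp add: tensor_map_tensor)
  then show ?thesis unfolding grouplike_crossed_iff using that by blast
qed

context right_action
begin

lemma hpow_bar: "hpow (crossed_hopf \<tau> act) n (bar w x) = bar (act_prod act n x w) (nmul n x)"
proof (induction n)
  case 0
  show ?case by (simp add: hone_crossed bar_def act_prod_def fun_eq_iff)
next
  case (Suc n)
  have "w * bullet act x (act_prod act n x w) = act_prod act (Suc n) x w"
    using act_prod_add[of 1 n x w] by (simp add: fun_eq_iff bullet_def)
  then show ?case by (simp add: Suc hmul_bar nmul_Suc add.commute)
qed

end

section \<open>Powers of lifts of the generator under Hopf algebra isomorphisms\<close>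

context prime_action
begin

text \<open>Two elements of this set differ by the norm of a character. When nonempty it is thus a
  class of invariant characters modulo norms, the usual form of the second cohomology of a cyclic
  group.\<close>

definition norms :: "('c \<Rightarrow> 'g \<Rightarrow> 'g \<Rightarrow> 'k::field) \<Rightarrow> ('g \<Rightarrow> 'k) set" where
  "norms \<tau> = {act_prod act p g w | w. grouplike_fun (\<tau> g) w}"

lemma characters_iff: "\<tau> \<in> Z2c act \<Longrightarrow> grouplike_fun (\<tau> 0) \<chi> \<longleftrightarrow> \<chi> \<in> characters"
  by (simp add: characters_def grouplike_fun_def crossed_cocycle.tau_1(1)[OF crossed_cocycleI])

text \<open>The \<open>p\<close>-th power lies over zero, so it is a character. It commutes with the
  lift itself; comparing the two orders of multiplication shows that the action of \<open>g\<close>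
  fixes it.\<close>

lemma norms_invariant:
  fixes \<tau> :: "'c \<Rightarrow> 'g \<Rightarrow> 'g \<Rightarrow> 'k::field"
  assumes \<tau>: "\<tau> \<in> Z2c act" and m: "m \<in> norms \<tau>"
  shows "m \<in> characters" "m (N a) = 1"
proof -
  interpret crossed_cocycle act \<tau> by (rule crossed_cocycleI[OF \<tau>])
  obtain w where m: "m = act_prod act p g w" and w: "grouplike_fun (\<tau> g) w"
    using m by (auto simp: norms_def)
  show ch: "m \<in> characters"
    using act_prod_grouplike[OF w, of p] characters_iff[OF \<tau>] by (simp add: m)
  have "m a * w a = w a * m (act a g)"
    using act_prod_add[of p 1 g w a] act_prod_add[of 1 p g w a] by (simp add: m add.commute)
  moreover have "w a \<noteq> 0" by (rule grouplike_fun_nonzero[OF w tau_nonzero])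
  ultimately show "m (N a) = 1"
    using characterD(3)[OF ch] by (simp add: N_def character_diff[OF ch])
qed

text \<open>The quotient \<open>V n\<close> of the \<open>n\<close>-th powers of two lifts with
  equal \<open>p\<close>-th power depends on \<open>n\<close> only modulo \<open>p\<close>. It
  therefore defines a function \<open>\<eta>\<close> on C_p, which is a crossed homomorphism because
  powers add, and whose coboundary is the quotient of the cocycles.\<close>

lemma norms_common:
  fixes \<tau> \<tau>' :: "'c \<Rightarrow> 'g \<Rightarrow> 'g \<Rightarrow> 'k::field"
  assumes \<tau>: "\<tau> \<in> Z2c act" and \<tau>': "\<tau>' \<in> Z2c act" and m: "m \<in> norms \<tau>" "m \<in> norms \<tau>'"
  obtains h where "h \<in> B2c act" "\<tau>' = h * \<tau>"
proof -
  interpret \<tau>: crossed_cocycle act \<tau> by (rule crossed_cocycleI[OF \<tau>])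
  interpret \<tau>': crossed_cocycle act \<tau>' by (rule crossed_cocycleI[OF \<tau>'])
  obtain w where w: "m = act_prod act p g w" "grouplike_fun (\<tau> g) w"
    using m by (auto simp: norms_def)
  obtain w' where w': "m = act_prod act p g w'" "grouplike_fun (\<tau>' g) w'"
    using m by (auto simp: norms_def)
  define W W' where "W n = act_prod act n g w" and "W' n = act_prod act n g w'" for n
  have W: "grouplike_fun (\<tau> (nmul n g)) (W n)" and W': "grouplike_fun (\<tau>' (nmul n g)) (W' n)" for n
    unfolding W_def W'_def by (rule \<tau>.act_prod_grouplike[OF w(2)], rule \<tau>'.act_prod_grouplike[OF w'(2)])
  have W0: "W n a \<noteq> 0" "W' n a \<noteq> 0" for n a
    using grouplike_fun_nonzero[OF W \<tau>.tau_nonzero] grouplike_fun_nonzero[OF W' \<tau>'.tau_nonzero] by blast+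
  define V where "V n a = W' n a / W n a" for n a
  have V_add: "V (k + n) a = V k a * V n (act a (nmul k g))" for k n a
    by (simp add: V_def W_def W'_def act_prod_add)
  have Vp: "V (n * p) a = 1" for n a
  proof (induction n)
    case 0
    then show ?case by (simp add: V_def W_def W'_def)
  next
    case (Suc n)
    have "V p a = 1"
      using W0[of p a] w(1) w'(1) by (simp add: V_def W_def W'_def)
    then show ?case using Suc V_add[of p "n * p" a] by simp
  qed
  have V_mod: "V n a = V (n mod p) a" for n a
  proof -
    have "V n a = V (n div p * p + n mod p) a" by simp
    also have "\<dots> = V (n mod p) a" by (simp only: V_add Vp nmul_mult nmul_p_zero nmul_zero act_0 mult_1)
    finally show ?thesis .
  qed
  define \<eta> where "\<eta> x = V (SOME n. nmul n g = x)" for x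
  have \<eta>: "\<eta> (nmul n g) = V n" for n
  proof
    fix a
    let ?k = "SOME k. nmul k g = nmul n g"
    have "nmul ?k g = nmul n g" by (rule someI) (rule refl)
    then have "?k mod p = n mod p"
      by (rule nmul_eq_imp_mod_eq[OF prime_p nmul_p_zero(2) g_nonzero])
    then show "\<eta> (nmul n g) a = V n a" unfolding \<eta>_def by (metis V_mod)
  qed
  have "\<eta> \<in> cochains1"
    unfolding cochains1_def mem_Collect_eq
  proof (intro conjI allI impI)
    fix x a
    obtain n where n: "nmul n g = x" using generated_by_g .
    show "\<eta> x a \<noteq> 0" using \<eta>[of n] W0 by (simp add: n V_def)
    have "\<eta> 0 a = 1" using \<eta>[of 0] by (simp add: V_def W_def W'_def)
    moreover have "\<eta> x 0 = 1"
      using \<eta>[of n] grouplike_funD(1)[OF W[of n]] grouplike_funD(1)[OF W'[of n]] by (simp add: n V_def)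
    moreover assume "x = 0 \<or> a = 0"
    ultimately show "\<eta> x a = 1" by blast
  qed
  moreover have "\<eta> (x + y) a = \<eta> x a * \<eta> y (act a x)" for x y a
  proof -
    obtain k n where "nmul k g = x" "nmul n g = y" using generated_by_g by metis
    then show ?thesis using \<eta>[of "k + n"] V_add[of k n a] \<eta>[of k] \<eta>[of n] by (simp add: nmul_plus_left)
  qed
  ultimately have "delta_G \<eta> \<in> B2c act" unfolding B2c_def by blast
  moreover have "\<tau>' x a b = delta_G \<eta> x a b * \<tau> x a b" for x a b
  proof -
    obtain n where n: "nmul n g = x" using generated_by_g .
    have "\<eta> x = V n" using \<eta>[of n] n by simp
    moreover have "W n a * W n b = \<tau> x a b * W n (a + b)" "W' n a * W' n b = \<tau>' x a b * W' n (a + b)"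
      using grouplike_funD(2)[OF W[of n]] grouplike_funD(2)[OF W'[of n]] by (simp_all only: n)
    moreover have "\<tau>' x a b = W' n a * W' n b / W' n (a + b)" "\<tau> x a b = W n a * W n b / W n (a + b)"
      using calculation W0 by simp_all
    ultimately show ?thesis using W0 by (simp add: delta_G_def V_def field_simps)
  qed
  then have "\<tau>' = delta_G \<eta> * \<tau>" by (simp add: fun_eq_iff)
  ultimately show ?thesis by (rule that)
qed

lemma B2cc_grouplike:
  assumes "\<tau> \<in> B2cc act"
  obtains w where "grouplike_fun (\<tau> x) w"
proof -
  obtain \<eta> where \<eta>: "\<eta> \<in> cochains1" "\<tau> = delta_G \<eta>" using assms by (auto simp: B2cc_def)
  then have "grouplike_fun (\<tau> x) (\<eta> x)"
    by (auto simp: grouplike_fun_def cochains1_def delta_G_def)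
  then show ?thesis by (rule that)
qed

lemma N_act: "N (act a x) = act (N a) x"
proof -
  have "act (act a x) g = act (act a g) x" by (simp add: add.commute flip: act_plus)
  then show ?thesis using act_add[of "N a" a x] by (simp add: N_def)
qed

lemma N_pow_act: "(N ^^ n) (act a x) = act ((N ^^ n) a) x"
  by (induction n) (simp_all add: N_act)

lemma act_prod_character:
  assumes "\<xi> \<in> characters"
  shows "act_prod act n x \<xi> \<in> characters"
  by (rule charactersI) (simp_all add: act_prod_def act_add characterD[OF assms] prod.distrib)

definition preserves_characters :: "(('c \<times> 'g \<Rightarrow> 'k::field) \<Rightarrow> 'c \<times> 'g \<Rightarrow> 'k) \<Rightarrow> bool" where
  "preserves_characters F \<longleftrightarrow> F ` (\<lambda>\<chi>. bar \<chi> 0) ` characters \<subseteq> (\<lambda>\<chi>. bar \<chi> 0) ` characters"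

lemma preserves_charactersD:
  assumes "preserves_characters F" "\<chi> \<in> characters"
  obtains \<chi>' where "\<chi>' \<in> characters" "F (bar \<chi> 0) = bar \<chi>' 0"
  using assms by (auto simp: preserves_characters_def)

lemma finite_characters: "finite (characters :: ('g \<Rightarrow> 'k::field) set)"
proof (rule finite_subset)
  have "0 < p" using prime_p prime_gt_0_nat by blast
  then show "finite (PiE UNIV (\<lambda>_ :: 'g. {z :: 'k. z ^ p = 1}))"
    by (intro finite_PiE finite finite_roots_of_unity)
  show "characters \<subseteq> PiE UNIV (\<lambda>_ :: 'g. {z :: 'k. z ^ p = 1})"
    by (auto simp: character_pow_p)
qed

text \<open>There are finitely many characters, their values being \<open>p\<close>-th roots of
  unity, so an injective map of this set into itself is onto. This lets the condition pass to the
  inverse isomorphism.\<close>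

lemma preserves_characters_image:
  assumes "bij F" "preserves_characters F"
  shows "F ` (\<lambda>\<chi>. bar \<chi> 0) ` characters = (\<lambda>\<chi>. bar \<chi> 0) ` characters"
  using assms finite_characters
  by (intro endo_inj_surj) (auto simp: preserves_characters_def bij_def intro: inj_on_subset)

lemma preserves_characters_inv:
  assumes "bij F" "preserves_characters F"
  shows "preserves_characters (inv_into UNIV F)"
  unfolding preserves_characters_def
proof -
  have "inv_into UNIV F ` F ` A = A" for A
    using assms(1) by (simp add: bij_def image_inv_f_f)
  then show "inv_into UNIV F ` (\<lambda>\<chi>. bar \<chi> 0) ` characters \<subseteq> (\<lambda>\<chi>. bar \<chi> 0) ` characters"
    by (metis order_refl preserves_characters_image[OF assms])
qed

text \<open>Conjugation by a lift of \<open>g\<close> acts on the characters as \<open>g\<close>, and \<open>F\<close> sends that lift to a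
  lift of some \<open>k g\<close>; the operator of \<open>k g\<close> is a multiple of that of \<open>g\<close>.\<close>

lemma hopf_iso_height:
  fixes \<tau> \<tau>' :: "'c \<Rightarrow> 'g \<Rightarrow> 'g \<Rightarrow> 'k::field"
  assumes \<tau>: "\<tau> \<in> Z2c act" and \<tau>': "\<tau>' \<in> Z2c act"
    and F: "F \<in> hopf_iso (crossed_hopf \<tau> act) (crossed_hopf \<tau>' act)" "preserves_characters F"
    and w: "grouplike_fun (\<tau> g) w"
    and "\<chi> \<in> height_ge h" "F (bar \<chi> 0) = bar \<chi>' 0" "\<chi>' 0 = 1"
  shows "\<chi>' \<in> height_ge h"
  using assms(6-)
proof (induction h arbitrary: \<chi> \<chi>')
  case 0
  then have "\<chi> \<in> characters" by (simp add: height_ge_0)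
  from preserves_charactersD[OF F(2) this]
  obtain \<chi>'' where "\<chi>'' \<in> characters" "F (bar \<chi> 0) = bar \<chi>'' 0" .
  then show ?case using 0 bar_eq_iff[where 'c = 'c, of \<chi>' \<chi>'' 0 0] by (simp add: height_ge_0 characterD)
next
  case (Suc h)
  let ?H = "crossed_hopf \<tau> act" and ?H' = "crossed_hopf \<tau>' act"
  interpret \<tau>': crossed_cocycle act \<tau>' by (rule crossed_cocycleI[OF \<tau>'])
  obtain \<xi> where \<xi>: "\<xi> \<in> characters" "\<chi> = \<xi> \<circ> (N ^^ Suc h)"
    using Suc.prems(1) by (auto simp: height_ge_def)
  define \<rho> where "\<rho> = \<xi> \<circ> (N ^^ h)"
  have \<rho>: "\<rho> \<in> characters" "\<rho> \<in> height_ge h"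
    using \<xi>(1) by (auto simp: \<rho>_def height_ge_def characterD N_pow_add intro!: charactersI)
  \<comment> \<open>Multiplicatively, \<open>\<chi>\<close> is g - 1 applied to
    \<open>\<rho>\<close>, to which the induction hypothesis applies.\<close>
  have \<chi>\<rho>: "\<chi> a * \<rho> a = \<rho> (act a g)" for a
    using characterD(2)[OF \<rho>(1), of a "N a"] by (simp add: \<xi>(2) \<rho>_def act_g funpow_swap1 mult.commute)
  obtain \<rho>' where \<rho>': "\<rho>' \<in> characters" "F (bar \<rho> 0) = bar \<rho>' 0"
    using preserves_charactersD[OF F(2) \<rho>(1)] .
  have \<rho>'h: "\<rho>' \<in> height_ge h"
    using Suc.IH[OF \<rho>(2) \<rho>'(2)] characterD(1)[OF \<rho>'(1)] .
  obtain w' x' where w': "F (bar w g) = bar w' x'" "grouplike_fun (\<tau>' x') w'"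
    using hopf_iso_bar[OF F(1) w] by metis
  \<comment> \<open>The conjugation relation is written without inverses, so that \<open>F\<close>
    carries it over by multiplicativity alone.\<close>
  have "hmul ?H (bar w g) (bar \<rho> 0) = hmul ?H (hmul ?H (bar \<chi> 0) (bar \<rho> 0)) (bar w g)"
    unfolding hmul_bar by (simp add: bar_def fun_eq_iff bullet_def \<chi>\<rho> mult.commute)
  then have "F (hmul ?H (bar w g) (bar \<rho> 0)) = F (hmul ?H (hmul ?H (bar \<chi> 0) (bar \<rho> 0)) (bar w g))"
    by simp
  then have "hmul ?H' (bar w' x') (bar \<rho>' 0) = hmul ?H' (hmul ?H' (bar \<chi>' 0) (bar \<rho>' 0)) (bar w' x')"
    by (simp only: hopf_isoD(2)[OF F(1)] w'(1) \<rho>'(2) Suc.prems(2))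
  then have "bar (w' * bullet act x' \<rho>') (x' + 0) (x', a) =
      bar (\<chi>' * bullet act 0 \<rho>' * bullet act (0 + 0) w') (0 + 0 + x') (x', a)" for a
    by (simp only: hmul_bar)
  then have "w' a * \<rho>' (act a x') = \<chi>' a * \<rho>' a * w' a" for a
    by (simp add: bar_apply bullet_def)
  moreover have "w' a \<noteq> 0" for a by (rule grouplike_fun_nonzero[OF w'(2) \<tau>'.tau_nonzero])
  ultimately have \<chi>': "\<chi>' a * \<rho>' a = \<rho>' (act a x')" for a
    by (metis mult.commute mult_right_cancel)
  obtain k where k: "nmul k g = x'" using generated_by_g .
  obtain \<xi>' where \<xi>': "\<xi>' \<in> characters" "\<rho>' = \<xi>' \<circ> (N ^^ h)"
    using \<rho>'h by (auto simp: height_ge_def)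
  \<comment> \<open>This is g^k - 1 = (1 + g + ... + g^(k-1)) (g - 1) applied to
    \<open>\<rho>'\<close>, with \<open>act_prod\<close> as the first factor.\<close>
  have step: "act_prod act n g \<rho>' (N a) * \<rho>' a = \<rho>' (act a (nmul n g))" for n a
  proof (induction n)
    case (Suc n)
    let ?b = "act a (nmul n g)"
    have "act_prod act (Suc n) g \<rho>' (N a) = act_prod act n g \<rho>' (N a) * \<rho>' (N ?b)"
      using act_prod_add[of n 1 g \<rho>' "N a"] by (simp add: N_act)
    then have "act_prod act (Suc n) g \<rho>' (N a) * \<rho>' a = \<rho>' ?b * \<rho>' (N ?b)"
      by (simp add: Suc.IH[symmetric] mult.assoc mult.commute)
    also have "\<dots> = \<rho>' (act ?b g)" by (simp add: act_g characterD(2)[OF \<rho>'(1)])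
    finally show ?case by (simp add: nmul_Suc act_plus)
  qed simp
  have "\<chi>' a = act_prod act k g \<rho>' (N a)" for a
    using step[of k a] \<chi>'[of a] k characterD(3)[OF \<rho>'(1), of a] by (metis mult_right_cancel)
  \<comment> \<open>\<open>N\<close> commutes with the action, so its powers can be moved past the
    product; what remains in front is the character \<open>act_prod act k g \<xi>'\<close>.\<close>
  also have "act_prod act k g \<rho>' (N a) = act_prod act k g \<xi>' ((N ^^ Suc h) a)" for a
    by (simp add: act_prod_def \<xi>'(2) N_pow_act N_act funpow_swap1)
  finally have "\<chi>' = act_prod act k g \<xi>' \<circ> (N ^^ Suc h)" by (simp add: fun_eq_iff)
  then show ?case unfolding height_ge_def using act_prod_character[OF \<xi>'(1)] by blast
qed

lemma height_ge_power:
  assumes "\<chi> \<in> height_ge h"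
  shows "(\<lambda>a. \<chi> a ^ n) \<in> height_ge h"
proof -
  obtain \<xi> where "\<xi> \<in> characters" "\<chi> = \<xi> \<circ> (N ^^ h)" using assms by (auto simp: height_ge_def)
  moreover from this have "(\<lambda>a. \<xi> a ^ n) \<in> characters"
    by (intro charactersI) (simp_all add: characterD power_mult_distrib)
  ultimately show ?thesis unfolding height_ge_def by (auto simp: fun_eq_iff)
qed

text \<open>As \<open>x\<close> generates C_p, some multiple \<open>k\<close> of it is
  \<open>g\<close>, and the \<open>k\<close>-th power of a lift of \<open>x\<close> is a lift of
  \<open>g\<close>. The exponent is prime to \<open>p\<close> because \<open>g\<close> is not
  zero.\<close>

lemma lift_of_g:
  assumes \<tau>: "\<tau> \<in> Z2c act" and w: "grouplike_fun (\<tau> x) w" and x: "x \<noteq> 0"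
  obtains k where "\<not> p dvd k" "(\<lambda>a. act_prod act p x w a ^ k) \<in> norms \<tau>"
proof -
  interpret crossed_cocycle act \<tau> by (rule crossed_cocycleI[OF \<tau>])
  obtain k where k: "nmul k x = g"
    using prime_card_generated[OF _ x] prime_p card_p by blast
  have "\<not> p dvd k"
  proof
    assume "p dvd k"
    then have "nmul k x = 0" by (elim dvdE) (simp add: mult.commute[of p] nmul_mult)
    then show False using k g_nonzero by simp
  qed
  moreover have "act_prod act p g (act_prod act k x w) = (\<lambda>a. act_prod act p x w a ^ k)"
  proof -
    \<comment> \<open>Powers of one element commute; the coefficients over zero then give the
      identity between functions.\<close>
    have "hpow H p (hpow H k (bar w x)) = hpow H k (hpow H p (bar w x))"
      by (simp only: hpow_mult[OF crossed_algebra, symmetric] mult.commute)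
    then have "bar (act_prod act p g (act_prod act k x w)) 0 (0 :: 'c, a) =
        bar (act_prod act k 0 (act_prod act p x w)) (nmul k 0) (0 :: 'c, a)" for a
      by (simp only: hpow_bar k nmul_p_zero)
    then show ?thesis by (simp add: bar_apply act_prod_trivial fun_eq_iff)
  qed
  moreover have "grouplike_fun (\<tau> g) (act_prod act k x w)"
    using act_prod_grouplike[OF w, of k] by (simp add: k)
  ultimately show ?thesis by (intro that[of k]) (auto simp: norms_def intro!: exI[of _ "act_prod act k x w"])
qed

lemma one_in_norms_if_not_preserves:
  fixes \<tau> \<tau>' :: "'c \<Rightarrow> 'g \<Rightarrow> 'g \<Rightarrow> 'k::field"
  assumes \<tau>: "\<tau> \<in> Z2c act" and \<tau>': "\<tau>' \<in> Z2c act"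
    and F: "F \<in> hopf_iso (crossed_hopf \<tau> act) (crossed_hopf \<tau>' act)" "\<not> preserves_characters F"
  shows "(\<lambda>_. 1) \<in> norms \<tau>'"
proof -
  let ?H = "crossed_hopf \<tau> act" and ?H' = "crossed_hopf \<tau>' act"
  obtain \<chi> where \<chi>: "\<chi> \<in> characters" "F (bar \<chi> 0) \<notin> (\<lambda>\<chi>. bar \<chi> 0) ` characters"
    using F(2) by (auto simp: preserves_characters_def)
  obtain w x where w: "F (bar \<chi> 0) = bar w x" "grouplike_fun (\<tau>' x) w"
    using hopf_iso_bar[OF F(1)] characters_iff[OF \<tau>] \<chi>(1) by metis
  have x: "x \<noteq> 0" using w \<chi>(2) characters_iff[OF \<tau>'] by auto
  \<comment> \<open>Characters have \<open>p\<close>-th power one because \<open>G\<close> has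
    exponent \<open>p\<close>, and \<open>F\<close> hands this on to the lift over
    \<open>x\<close>.\<close>
  have "act_prod act p 0 \<chi> = 1"
    by (simp add: fun_eq_iff act_prod_trivial character_pow_p[OF \<chi>(1)])
  then have "hpow ?H p (bar \<chi> 0) = hone ?H" by (simp add: hpow_bar hone_crossed)
  then have "hpow ?H' p (bar w x) = hone ?H'"
    using hpow_hopf_iso[OF F(1), of p "bar \<chi> 0"] hopf_isoD(3)[OF F(1)] w(1) by simp
  then have "bar (act_prod act p x w) 0 (0 :: 'c, a) = bar 1 0 (0 :: 'c, a)" for a
    by (simp only: hpow_bar hone_crossed nmul_p_zero)
  then have "act_prod act p x w a = 1" for a by (simp add: bar_apply)
  then show ?thesis using lift_of_g[OF \<tau>' w(2) x] by (auto simp: power_one)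
qed

lemma twist_Z2c:
  assumes "\<tau> \<in> Z2c act" "l \<in> carrier (aut_group act)"
  shows "(\<lambda>x a b. \<tau> x (l a) (l b)) \<in> Z2c act"
proof -
  interpret crossed_cocycle act \<tau> by (rule crossed_cocycleI[OF assms(1)])
  have l: "l (a + b) = l a + l b" "l (act a x) = act (l a) x" for a b x
    using assms(2) by (auto simp: aut_group_def group_auts_def)
  then have "l 0 = 0" using l(1)[of 0 0] by simp
  then show ?thesis
    by (auto simp: Z2c_def tau_nonzero tau_cocycle tau_plus l)
qed

text \<open>\<open>F\<close> may send the lift of \<open>g\<close> to a lift of another generator
  \<open>x'\<close>. Returning to \<open>g\<close> raises the \<open>p\<close>-th power to an
  exponent prime to \<open>p\<close>, which leaves its height unchanged, so
  \<open>transvection\<close> still applies.\<close>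

lemma hopf_iso_imp_cohomologous_twist:
  fixes \<tau> \<tau>' :: "'c \<Rightarrow> 'g \<Rightarrow> 'g \<Rightarrow> 'k::alg_closed_field"
  assumes B: "\<tau> \<in> B2cc act" "\<tau>' \<in> B2cc act"
    and F: "F \<in> hopf_iso (crossed_hopf \<tau> act) (crossed_hopf \<tau>' act)"
  obtains l h where "l \<in> carrier (aut_group act)" "h \<in> B2c act"
    "\<tau>' = h * (\<lambda>x a b. \<tau> x (l a) (l b))"
proof -
  let ?H = "crossed_hopf \<tau> act" and ?H' = "crossed_hopf \<tau>' act"
  let ?G = "inv_into UNIV F"
  have \<tau>: "\<tau> \<in> Z2c act" and \<tau>': "\<tau>' \<in> Z2c act" using B by (auto simp: B2cc_def)
  interpret \<tau>': crossed_cocycle act \<tau>' by (rule crossed_cocycleI[OF \<tau>'])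
  have G: "?G \<in> hopf_iso ?H' ?H" by (rule hopf_iso_inv[OF F])
  have bij: "bij F" "bij ?G" using hopf_isoD(6)[OF F] hopf_isoD(6)[OF G] .
  have GF: "?G (F u) = u" for u by (simp add: bij bij_is_inj)
  show ?thesis
  proof (cases "preserves_characters F")
    \<comment> \<open>The inverse does not preserve the characters either, so both sets of norms
      contain the trivial character and the identity serves as \<open>l\<close>.\<close>
    case False
    have "inv_into UNIV ?G = F" by (rule inv_inv_eq[OF bij(1)])
    then have "\<not> preserves_characters ?G"
      using False preserves_characters_inv[OF bij(2)] by auto
    then have "(\<lambda>_. 1) \<in> norms \<tau>" by (rule one_in_norms_if_not_preserves[OF \<tau>' \<tau> G])
    moreover have "(\<lambda>_. 1) \<in> norms \<tau>'" by (rule one_in_norms_if_not_preserves[OF \<tau> \<tau>' F False])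
    ultimately obtain h where "h \<in> B2c act" "\<tau>' = h * \<tau>" by (rule norms_common[OF \<tau> \<tau>'])
    then show ?thesis by (intro that[of id h]) (simp_all add: aut_group_def group_auts_def)
  next
    case True
    obtain w where w: "grouplike_fun (\<tau> g) w" by (rule B2cc_grouplike[OF B(1)])
    obtain v where v: "grouplike_fun (\<tau>' g) v" by (rule B2cc_grouplike[OF B(2)])
    define m where "m = act_prod act p g w"
    have m: "m \<in> norms \<tau>" using w by (auto simp: norms_def m_def)
    obtain w' x' where w': "F (bar w g) = bar w' x'" "grouplike_fun (\<tau>' x') w'"
      using hopf_iso_bar[OF F w] by metis
    \<comment> \<open>\<open>F\<close> permutes the characters, so an element outside them stays
      outside.\<close>
    have x': "x' \<noteq> 0"
    proof
      assume "x' = 0"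
      then have "F (bar w g) \<in> F ` (\<lambda>\<chi>. bar \<chi> 0) ` characters"
        using w' characters_iff[OF \<tau>'] preserves_characters_image[OF bij(1) True] by simp
      then obtain \<chi> where \<chi>: "\<chi> \<in> characters" "bar w g = bar \<chi> 0"
        using bij(1) by (auto simp: bij_def dest: injD)
      then show False
        using bar_eq_iff[of w \<chi> g 0] g_nonzero grouplike_funD(1)[OF w] by (simp add: characterD(1))
    qed
    define m'' where "m'' = act_prod act p x' w'"
    have m'': "m'' \<in> characters"
      using \<tau>'.act_prod_grouplike[OF w'(2), of p] characters_iff[OF \<tau>'] by (simp add: m''_def)
    have Fm: "F (bar m 0) = bar m'' 0"
      using hpow_hopf_iso[OF F, of p "bar w g"] by (simp add: hpow_bar w'(1) m_def m''_def)
    obtain k where k: "\<not> p dvd k" "(\<lambda>a. m'' a ^ k) \<in> norms \<tau>'"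
      using lift_of_g[OF \<tau>' w'(2) x'] unfolding m''_def by blast
    define m' where "m' a = m'' a ^ k" for a
    have m': "m' \<in> norms \<tau>'" using k(2) by (simp add: m'_def[abs_def])
    \<comment> \<open>Inverting \<open>k\<close> modulo \<open>p\<close> recovers \<open>m''\<close>
      as a power of \<open>m'\<close>, so the two have the same height.\<close>
    obtain k' where k': "k' * k mod p = 1" by (rule inverse_mod_prime[OF prime_p k(1)])
    have m''_pow: "m'' = (\<lambda>a. m' a ^ k')"
    proof
      fix a
      have "m' a ^ k' = m'' a ^ (k' * k)" by (simp add: m'_def mult.commute[of k'] power_mult)
      also have "\<dots> = m'' a ^ (p * (k' * k div p) + 1)" using k' by (metis mult_div_mod_eq)
      also have "\<dots> = m'' a" by (simp add: power_add power_mult character_pow_p[OF m''])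
      finally show "m'' a = m' a ^ k'" ..
    qed
    have "m \<in> height_ge h \<longleftrightarrow> m' \<in> height_ge h" for h
    proof
      assume "m \<in> height_ge h"
      then have "m'' \<in> height_ge h"
        using hopf_iso_height[OF \<tau> \<tau>' F True w _ Fm] characterD(1)[OF m''] by blast
      then show "m' \<in> height_ge h" unfolding m'_def[abs_def] by (rule height_ge_power)
    next
      assume "m' \<in> height_ge h"
      then have "m'' \<in> height_ge h" unfolding m''_pow by (rule height_ge_power)
      moreover have "?G (bar m'' 0) = bar m 0" using GF[of "bar m 0"] by (simp add: Fm)
      ultimately show "m \<in> height_ge h"
        using hopf_iso_height[OF \<tau>' \<tau> G preserves_characters_inv[OF bij(1) True] v]
          characterD(1)[OF norms_invariant(1)[OF \<tau> m]] by blast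
    qed
    then obtain l where l: "l \<in> carrier (aut_group act)" "m' = m \<circ> l"
      using transvection[OF norms_invariant[OF \<tau> m] norms_invariant[OF \<tau>' m']] by metis
    have l': "l (a + b) = l a + l b" "l (act a x) = act (l a) x" "l 0 = 0" for a b x
      using l(1) additive_zero[of l] by (auto simp: aut_group_def group_auts_def)
    \<comment> \<open>Composition with \<open>l\<close> gives a lift for the twisted cocycle whose
      \<open>p\<close>-th power is \<open>m'\<close>, a norm that it shares with
      \<open>\<tau>'\<close>.\<close>
    have "grouplike_fun (\<lambda>a b. \<tau> g (l a) (l b)) (w \<circ> l)"
      using grouplike_funD[OF w] by (simp add: grouplike_fun_def l')
    moreover have "m' = act_prod act p g (w \<circ> l)"
      by (simp add: l(2) m_def act_prod_def fun_eq_iff l')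
    ultimately have "m' \<in> norms (\<lambda>x a b. \<tau> x (l a) (l b))" by (auto simp: norms_def)
    then obtain h where "h \<in> B2c act" "\<tau>' = h * (\<lambda>x a b. \<tau> x (l a) (l b))"
      using norms_common[OF twist_Z2c[OF \<tau> l(1)] \<tau>' _ m'] by metis
    then show ?thesis using l(1) by (intro that)
  qed
qed

end

section \<open>Orbits and isomorphism classes\<close>

text \<open>Orbits and isomorphism classes will both be presented as images of
  \<open>B2cc act\<close>; a bijection then amounts to equal fibres.\<close>

lemma ex_bij_betw_images:
  assumes "\<And>s t. s \<in> T \<Longrightarrow> t \<in> T \<Longrightarrow> f s = f t \<longleftrightarrow> k s = k t"
  shows "\<exists>\<Phi>. bij_betw \<Phi> (f ` T) (k ` T)"
proof -
  let ?\<Phi> = "\<lambda>x. k (inv_into T f x)"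
  have "?\<Phi> (f t) = k t" if "t \<in> T" for t
    using assms[of "inv_into T f (f t)" t] that by (simp add: inv_into_into f_inv_into_f)
  then have "?\<Phi> ` f ` T = k ` T" and "inj_on ?\<Phi> (f ` T)"
    using assms by (auto simp: image_image inj_on_def)
  then show ?thesis unfolding bij_betw_def by blast
qed

lemma group_auts_id: "id \<in> group_auts"
  by (simp add: group_auts_def)

lemma group_auts_inv:
  assumes "l \<in> group_auts"
  shows "inv_into UNIV l \<in> group_auts"
proof -
  have l: "bij l" "l (a + b) = l a + l b" for a b using assms by (auto simp: group_auts_def)
  have "inv_into UNIV l (a + b) = inv_into UNIV l a + inv_into UNIV l b" for a b
    by (rule inv_f_eq[OF bij_is_inj[OF l(1)]]) (simp add: l bij_is_surj surj_f_inv_f)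
  then show ?thesis by (simp add: group_auts_def bij_imp_bij_inv l(1))
qed

lemma group_auts_zero: "l \<in> group_auts \<Longrightarrow> l 0 = (0 :: 'a::ab_group_add)"
  by (rule additive_zero) (simp add: group_auts_def)

lemma delta_G_mult: "delta_G (\<lambda>x a. \<eta> x a * \<eta>' x a) = delta_G \<eta> * delta_G \<eta>'"
  by (simp add: fun_eq_iff delta_G_def algebra_simps)

lemma delta_G_inverse: "delta_G (\<lambda>x a. inverse (\<eta> x a)) = (\<lambda>x a b. inverse (delta_G \<eta> x a b))"
  by (simp add: fun_eq_iff delta_G_def)

lemma twist_mult: "twist l (\<sigma> * \<tau>) = twist l \<sigma> * (twist l \<tau> :: 'c \<Rightarrow> 'g \<Rightarrow> 'g \<Rightarrow> 'k::field)"
  by (simp add: twist_def fun_eq_iff)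

section \<open>Cosets of coboundaries and their orbits under automorphisms\<close>

context right_action
begin

abbreviation "\<A> \<equiv> carrier (aut_group act)"

lemma autsD:
  assumes "l \<in> \<A>"
  shows "l \<in> group_auts" "bij l" "l (act a x) = act (l a) x"
  using assms by (auto simp: aut_group_def group_auts_def)

lemma auts_id: "id \<in> \<A>"
  by (simp add: aut_group_def group_auts_id)

lemma auts_inv:
  assumes "l \<in> \<A>"
  shows "inv_into UNIV l \<in> \<A>"
proof -
  note l = autsD[OF assms]
  have "inv_into UNIV l (act a x) = act (inv_into UNIV l a) x" for a x
    by (rule inv_f_eq[OF bij_is_inj[OF l(2)]]) (simp add: l bij_is_surj surj_f_inv_f)
  then show ?thesis by (simp add: aut_group_def group_auts_inv[OF l(1)])
qed

lemma auts_comp: "l \<in> \<A> \<Longrightarrow> m \<in> \<A> \<Longrightarrow> l \<circ> m \<in> \<A>"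
  by (auto simp: aut_group_def group_auts_def bij_comp)

lemma twist_comp: "l \<in> \<A> \<Longrightarrow> m \<in> \<A> \<Longrightarrow> twist (l \<circ> m) \<tau> = twist l (twist m \<tau>)"
  by (simp add: twist_def fun_eq_iff o_inv_distrib autsD)

lemma twist_id: "twist id \<tau> = \<tau>"
  by (simp add: twist_def fun_eq_iff)

lemma twist_inv: "l \<in> \<A> \<Longrightarrow> twist (inv_into UNIV l) \<tau> = (\<lambda>x a b. \<tau> x (l a) (l b))"
  by (simp add: twist_def inv_inv_eq autsD fun_eq_iff)

lemma B2cE:
  assumes "h \<in> B2c act"
  obtains \<eta> where "h = delta_G \<eta>" "\<eta> \<in> cochains1" "\<forall>x y a. \<eta> (x + y) a = \<eta> x a * \<eta> y (act a x)"
  using assms by (auto simp: B2c_def)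

lemma B2cI:
  assumes "\<eta> \<in> cochains1" "\<And>x y a. \<eta> (x + y) a = \<eta> x a * \<eta> y (act a x)"
  shows "delta_G \<eta> \<in> B2c act"
  using assms by (auto simp: B2c_def)

lemma B2c_one: "(1 :: 'c \<Rightarrow> 'g \<Rightarrow> 'g \<Rightarrow> 'k::field) \<in> B2c act"
proof -
  have "delta_G (\<lambda>(_ :: 'c) (_ :: 'g). 1 :: 'k) \<in> B2c act" by (rule B2cI) (simp_all add: cochains1_def)
  moreover have "delta_G (\<lambda>(_ :: 'c) (_ :: 'g). 1 :: 'k) = (1 :: 'c \<Rightarrow> 'g \<Rightarrow> 'g \<Rightarrow> 'k)" by (simp add: fun_eq_iff delta_G_def)
  ultimately show ?thesis by simp
qed

lemma B2c_mult:
  assumes "h \<in> B2c act" "h' \<in> B2c act"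
  shows "h * h' \<in> B2c act"
proof -
  obtain \<eta> \<eta>' where "h = delta_G \<eta>" "\<eta> \<in> cochains1" "\<And>x y a. \<eta> (x + y) a = \<eta> x a * \<eta> y (act a x)"
    and "h' = delta_G \<eta>'" "\<eta>' \<in> cochains1" "\<And>x y a. \<eta>' (x + y) a = \<eta>' x a * \<eta>' y (act a x)"
    by (metis B2cE assms)
  then show ?thesis
    unfolding \<open>h = _\<close> \<open>h' = _\<close> delta_G_mult[symmetric] by (intro B2cI) (auto simp: cochains1_def)
qed

lemma B2c_nonzero:
  assumes "h \<in> B2c act"
  shows "h x a b \<noteq> 0"
  using assms by (elim B2cE) (simp add: delta_G_def cochains1_def)

lemma B2c_inverse:
  assumes "h \<in> B2c act"
  shows "(\<lambda>x a b. inverse (h x a b)) \<in> B2c act"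
proof -
  obtain \<eta> where \<eta>: "h = delta_G \<eta>" "\<eta> \<in> cochains1" "\<forall>x y a. \<eta> (x + y) a = \<eta> x a * \<eta> y (act a x)"
    by (rule B2cE[OF assms])
  show ?thesis
    unfolding \<eta>(1) delta_G_inverse[symmetric] by (rule B2cI) (use \<eta>(2) in \<open>auto simp: cochains1_def \<eta>(3)\<close>)
qed

lemma B2c_twist:
  assumes "h \<in> B2c act" "l \<in> \<A>"
  shows "twist l h \<in> B2c act"
proof -
  let ?m = "inv_into UNIV l"
  note m = autsD[OF auts_inv[OF assms(2)]]
  obtain \<eta> where \<eta>: "h = delta_G \<eta>" "\<eta> \<in> cochains1" "\<forall>x y a. \<eta> (x + y) a = \<eta> x a * \<eta> y (act a x)"
    by (rule B2cE[OF assms(1)])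
  have "twist l h = delta_G (\<lambda>x a. \<eta> x (?m a))"
    using m(1) by (simp add: twist_def \<eta>(1) delta_G_def fun_eq_iff group_auts_def)
  also have "\<dots> \<in> B2c act"
    by (rule B2cI) (use \<eta>(2) group_auts_zero[OF m(1)] in \<open>auto simp: cochains1_def \<eta>(3) m\<close>)
  finally show ?thesis .
qed

definition coset :: "('c \<Rightarrow> 'g \<Rightarrow> 'g \<Rightarrow> 'k::field) \<Rightarrow> ('c \<Rightarrow> 'g \<Rightarrow> 'g \<Rightarrow> 'k) set" where
  "coset \<tau> = (\<lambda>h. h * \<tau>) ` B2c act"

definition coset_orbit :: "('c \<Rightarrow> 'g \<Rightarrow> 'g \<Rightarrow> 'k::field) \<Rightarrow> ('c \<Rightarrow> 'g \<Rightarrow> 'g \<Rightarrow> 'k) set set" where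
  "coset_orbit \<tau> = (\<lambda>l. twist l ` coset \<tau>) ` \<A>"

lemma H2cc_orbits_eq:
  "(H2cc_orbits act :: ('c \<Rightarrow> 'g \<Rightarrow> 'g \<Rightarrow> 'k::field) set set set) = coset_orbit ` B2cc act"
proof -
  have "carrier (H2cc act :: ('c \<Rightarrow> 'g \<Rightarrow> 'g \<Rightarrow> 'k) set monoid) = coset ` B2cc act"
    by (auto simp: H2cc_def carrier_FactGroup r_coset_def Z2c_group_def coset_def)
  then show ?thesis
    by (simp add: H2cc_orbits_def orbits_def orbit_def coset_orbit_def Setcompr_eq_image image_image)
qed

lemma coset_mult:
  assumes "h \<in> B2c act"
  shows "coset (h * \<tau>) = coset \<tau>"
proof -
  have "k * \<tau> \<in> coset (h * \<tau>)" if "k \<in> B2c act" for k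
  proof -
    let ?h' = "\<lambda>x a b. inverse (h x a b)"
    have "k * \<tau> = (k * ?h') * (h * \<tau>)"
      using B2c_nonzero[OF assms] by (simp add: fun_eq_iff)
    then show ?thesis unfolding coset_def by (metis B2c_inverse B2c_mult assms image_eqI that)
  qed
  moreover have "k * (h * \<tau>) \<in> coset \<tau>" if "k \<in> B2c act" for k
    unfolding coset_def mult.assoc[symmetric] by (rule imageI[OF B2c_mult[OF that assms]])
  ultimately show ?thesis unfolding coset_def by blast
qed

lemma coset_twist:
  assumes l: "l \<in> \<A>"
  shows "coset (twist l \<tau>) = twist l ` coset \<tau>"
proof -
  have "h * twist l \<tau> \<in> twist l ` coset \<tau>" if h: "h \<in> B2c act" for h
  proof -
    let ?m = "inv_into UNIV l"
    have "l \<circ> ?m = id" by (rule surj_iff[THEN iffD1, OF bij_is_surj[OF autsD(2)[OF l]]])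
    then have "h = twist l (twist ?m h)"
      using twist_comp[OF l auts_inv[OF l], of h] by (simp add: twist_id)
    then have "h * twist l \<tau> = twist l (twist ?m h * \<tau>)" by (simp add: twist_mult)
    then show ?thesis unfolding coset_def using B2c_twist[OF h auts_inv[OF l]] by blast
  qed
  moreover have "twist l (h * \<tau>) \<in> coset (twist l \<tau>)" if "h \<in> B2c act" for h
    unfolding coset_def twist_mult by (rule imageI[OF B2c_twist[OF that l]])
  ultimately show ?thesis unfolding coset_def by blast
qed

text \<open>A coboundary factor leaves the coset unchanged, and twisting moves it within its orbit,
  since the automorphisms are closed under composition and inverses.\<close>

lemma coset_orbit_eqI:
  assumes l: "l \<in> \<A>" and h: "h \<in> B2c act"
  shows "coset_orbit (h * twist l \<tau>) = coset_orbit \<tau>"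
proof -
  have *: "coset (h * twist l \<tau>) = twist l ` coset \<tau>"
    by (simp add: coset_mult[OF h] coset_twist[OF l])
  have 1: "twist m ` twist l ` coset \<tau> \<in> coset_orbit \<tau>" if m: "m \<in> \<A>" for m
  proof -
    have "twist m ` twist l ` coset \<tau> = twist (m \<circ> l) ` coset \<tau>"
      by (simp add: image_image twist_comp[OF m l])
    then show ?thesis unfolding coset_orbit_def by (metis auts_comp[OF m l] image_eqI)
  qed
  have 2: "twist m ` coset \<tau> \<in> (\<lambda>m. twist m ` twist l ` coset \<tau>) ` \<A>" if m: "m \<in> \<A>" for m
  proof -
    let ?k = "m \<circ> inv_into UNIV l"
    have k: "?k \<in> \<A>" by (rule auts_comp[OF m auts_inv[OF l]])
    have "?k \<circ> l = m" using autsD(2)[OF l] by (simp add: bij_is_inj o_assoc[symmetric])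
    then have "twist m ` coset \<tau> = twist ?k ` twist l ` coset \<tau>"
      unfolding image_image twist_comp[OF k l, symmetric] by simp
    then show ?thesis using k by (rule image_eqI)
  qed
  show ?thesis
    using 1 2 unfolding coset_orbit_def * by blast
qed

lemma coset_orbit_eqD:
  fixes \<tau> \<tau>' :: "'c \<Rightarrow> 'g \<Rightarrow> 'g \<Rightarrow> 'k::field"
  assumes "coset_orbit \<tau> = coset_orbit \<tau>'"
  obtains l h where "l \<in> \<A>" "h \<in> B2c act" "\<tau>' = twist l (h * \<tau>)"
proof -
  have "\<tau>' \<in> coset \<tau>'"
    unfolding coset_def by (rule image_eqI[OF _ B2c_one]) simp
  moreover have "coset \<tau>' \<in> coset_orbit \<tau>'"
    unfolding coset_orbit_def by (rule image_eqI[OF _ auts_id]) (simp add: twist_id)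
  \<comment> \<open>\<open>\<tau>'\<close> belongs to its own coset and that coset to its own orbit;
    reading this membership in the orbit of \<open>\<tau>\<close> yields \<open>l\<close> and
    \<open>h\<close>.\<close>
  ultimately have "\<tau>' \<in> \<Union> (coset_orbit \<tau>)" unfolding assms by blast
  then show ?thesis using that by (auto simp: coset_orbit_def coset_def)
qed

lemma hopf_iso_twist:
  fixes \<tau> :: "'c \<Rightarrow> 'g \<Rightarrow> 'g \<Rightarrow> 'k::field"
  assumes l: "l \<in> \<A>" and h: "h \<in> B2c act"
  shows "\<exists>F. F \<in> hopf_iso (crossed_hopf \<tau> act) (crossed_hopf (twist l (h * \<tau>)) act)"
proof -
  let ?m = "inv_into UNIV l"
  note m = autsD[OF auts_inv[OF l]]
  obtain \<eta> where \<eta>: "twist l h = delta_G \<eta>" "\<eta> \<in> cochains1"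
    "\<And>x y a. \<eta> (x + y) a = \<eta> x a * \<eta> y (act a x)"
    using B2cE[OF B2c_twist[OF h l]] by metis
  have "(\<lambda>u (x, a). \<eta> x a * u (id x, ?m a)) \<in>
      hopf_iso (crossed_hopf \<tau> act) (crossed_hopf (twist l (h * \<tau>)) act)"
  proof (rule hopf_iso_crossed[OF group_auts_id m(1) _ \<eta>(2,3)])
    show "?m (act a x) = act (?m a) (id x)" for a x by (simp add: m)
    show "twist l (h * \<tau>) x a b = delta_G \<eta> x a b * \<tau> (id x) (?m a) (?m b)" for x a b
      unfolding twist_mult \<eta>(1) by (simp add: twist_def)
  qed
  then show ?thesis by blast
qed

text \<open>Coboundaries on the abelian group \<open>G\<close> are symmetric. Conversely, each slice
  over \<open>x\<close> is a symmetric cocycle and is trivialized by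
  \<open>symmetric_cocycle_extension\<close>; the slices can be treated separately because
  \<open>B2cc\<close> puts no condition on \<open>\<eta>\<close> across different
  \<open>x\<close>.\<close>

lemma B2cc_iff_symmetric:
  fixes \<tau> :: "'c \<Rightarrow> 'g \<Rightarrow> 'g \<Rightarrow> 'k::alg_closed_field"
  assumes \<tau>: "\<tau> \<in> Z2c act"
  shows "\<tau> \<in> B2cc act \<longleftrightarrow> (\<forall>x a b. \<tau> x a b = \<tau> x b a)"
proof
  assume "\<tau> \<in> B2cc act"
  then show "\<forall>x a b. \<tau> x a b = \<tau> x b a" by (auto simp: B2cc_def delta_G_def algebra_simps)
next
  assume sym: "\<forall>x a b. \<tau> x a b = \<tau> x b a"
  interpret crossed_cocycle act \<tau>
    by (rule crossed_cocycleI[OF \<tau>])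
  have "\<exists>w. grouplike_fun (\<tau> x) w" for x
  proof -
    have "symmetric_cocycle (\<tau> x)"
      using sym tau_nonzero tau_1(2) tau_cocycle unfolding symmetric_cocycle_def by blast
    \<comment> \<open>The trivial subgroup prescribes nothing beyond the normalization at
      zero.\<close>
    then obtain w where "w 0 = 1" "\<And>a b. w a * w b = \<tau> x a b * w (a + b)"
      by (rule symmetric_cocycle_extension[where S = "{0}" and \<psi> = "\<lambda>_. 1"]) auto
    then show ?thesis by (auto simp: grouplike_fun_def)
  qed
  then obtain W where W: "\<And>x. grouplike_fun (\<tau> x) (W x)" by metis
  \<comment> \<open>Over zero \<open>W\<close> is only some character, whereas a normalized cochain
    must be constantly one there.\<close>
  define \<eta> where "\<eta> x = (if x = 0 then (\<lambda>_. 1) else W x)" for x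
  have \<eta>: "grouplike_fun (\<tau> x) (\<eta> x)" for x
    using W by (auto simp: \<eta>_def grouplike_fun_def)
  have nz: "\<eta> x a \<noteq> 0" for x a by (rule grouplike_fun_nonzero[OF \<eta> tau_nonzero])
  have "\<eta> \<in> cochains1"
    using nz grouplike_funD(1)[OF \<eta>] by (auto simp: cochains1_def \<eta>_def)
  moreover have "\<tau> = delta_G \<eta>"
    using nz grouplike_funD(2)[OF \<eta>] by (simp add: fun_eq_iff delta_G_def)
  ultimately show "\<tau> \<in> B2cc act" using \<tau> by (auto simp: B2cc_def)
qed

lemma cocommutative_crossed_iff:
  fixes \<tau> :: "'c \<Rightarrow> 'g \<Rightarrow> 'g \<Rightarrow> 'k::field"
  shows "cocommutative (crossed_hopf \<tau> act) \<longleftrightarrow> (\<forall>x a b. \<tau> x a b = \<tau> x b a)"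
proof
  assume c: "cocommutative (crossed_hopf \<tau> act)"
  show "\<forall>x a b. \<tau> x a b = \<tau> x b a"
  proof (intro allI)
    fix x :: 'c and a b :: 'g
    \<comment> \<open>The coproduct of this vector has coefficient \<open>\<tau> x a b\<close> at
      \<open>((x, a), (x, b))\<close>, and \<open>\<tau> x b a\<close> after the swap.\<close>
    let ?u = "basis_vec (x, a + b) :: 'c \<times> 'g \<Rightarrow> 'k"
    have "tensor_swap (hcomul (crossed_hopf \<tau> act) ?u) ((x, a), (x, b)) =
        hcomul (crossed_hopf \<tau> act) ?u ((x, a), (x, b))"
      using c by (simp add: cocommutative_def)
    then show "\<tau> x a b = \<tau> x b a"
      by (simp add: tensor_swap_def hcomul_crossed basis_vec_def add.commute)
  qed
next
  assume sym: "\<forall>x a b. \<tau> x a b = \<tau> x b a"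
  have "tensor_swap (hcomul (crossed_hopf \<tau> act) u) (k, l) = hcomul (crossed_hopf \<tau> act) u (k, l)" for u k l
    by (cases k; cases l) (use sym in \<open>simp add: tensor_swap_def hcomul_crossed add.commute\<close>)
  then show "cocommutative (crossed_hopf \<tau> act)"
    unfolding cocommutative_def by (intro allI tensor_eqI)
qed

end

section \<open>Equivalence classes of extensions and isomorphisms between them\<close>

definition crossed_class ::
  "('c::{finite, ab_group_add} \<Rightarrow> 'g::{finite, ab_group_add} \<Rightarrow> 'g \<Rightarrow> 'k::field) \<Rightarrow>
     ('g \<Rightarrow> 'c \<Rightarrow> 'g) \<Rightarrow> ('c, 'g, 'k) hopf_ext set" where
  "crossed_class \<tau> act = ext_equiv `` {crossed_ext \<tau> act}"

lemma crossed_class_hopf_iso: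
  assumes "E \<in> crossed_class \<tau> act"
  obtains F where "F \<in> hopf_iso (crossed_hopf \<tau> act) (ext_hopf E)"
  using assms by (auto simp: crossed_class_def ext_equiv_def crossed_ext_def)

context crossed_cocycle
begin

text \<open>\<open>ext_equiv\<close> relates only genuine extensions, so reflexivity at a crossed
  product rests on the extension axioms proved for it.\<close>

lemma crossed_ext_in_class: "crossed_ext \<tau> act \<in> crossed_class \<tau> act"
  unfolding crossed_class_def ext_equiv_def
  using crossed_is_extension by (auto intro!: bexI[OF _ hopf_iso_id])

end

text \<open>Every member of a class is isomorphic as a Hopf algebra to its crossed product, so any
  isomorphism between members can be moved to the crossed products.\<close>

lemma ext_isomorphic_crossed_iff:
  assumes "crossed_cocycle act \<tau>" "crossed_cocycle act' \<tau>'"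
  shows "(crossed_class \<tau> act, crossed_class \<tau>' act') \<in> ext_isomorphic \<longleftrightarrow>
    (\<exists>F. F \<in> hopf_iso (crossed_hopf \<tau> act) (crossed_hopf \<tau>' act'))"
proof
  assume "(crossed_class \<tau> act, crossed_class \<tau>' act') \<in> ext_isomorphic"
  then obtain E E' F where E: "E \<in> crossed_class \<tau> act" "E' \<in> crossed_class \<tau>' act'"
    and F: "F \<in> hopf_iso (ext_hopf E) (ext_hopf E')"
    by (auto simp: ext_isomorphic_def)
  obtain F1 where F1: "F1 \<in> hopf_iso (crossed_hopf \<tau> act) (ext_hopf E)"
    using crossed_class_hopf_iso[OF E(1)] .
  obtain F2 where F2: "F2 \<in> hopf_iso (crossed_hopf \<tau>' act') (ext_hopf E')"
    using crossed_class_hopf_iso[OF E(2)] .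
  show "\<exists>F. F \<in> hopf_iso (crossed_hopf \<tau> act) (crossed_hopf \<tau>' act')"
    using hopf_iso_comp[OF hopf_iso_comp[OF F1 F] hopf_iso_inv[OF F2]] by blast
next
  assume "\<exists>F. F \<in> hopf_iso (crossed_hopf \<tau> act) (crossed_hopf \<tau>' act')"
  then have "hopf_iso (ext_hopf (crossed_ext \<tau> act)) (ext_hopf (crossed_ext \<tau>' act')) \<noteq> {}"
    by (auto simp: crossed_ext_def)
  then show "(crossed_class \<tau> act, crossed_class \<tau>' act') \<in> ext_isomorphic"
    unfolding ext_isomorphic_def
    using crossed_cocycle.crossed_ext_in_class[OF assms(1)] crossed_cocycle.crossed_ext_in_class[OF assms(2)]
    by blast
qed

lemma module_isomorphic_refl: "module_isomorphic act act"
  unfolding module_isomorphic_def by (rule bexI[OF _ group_auts_id]) simp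

context right_action
begin

lemma act_in_class: "act \<in> act_class act"
  unfolding act_class_def
  using act module_isomorphic_refl[of act]
  by (auto simp: act_twist_def[abs_def] intro!: bexI[OF _ group_auts_id])

lemma cocomm_Ext_class_iff:
  "X \<in> cocomm_Ext_class act \<longleftrightarrow>
    (\<exists>\<tau> act'. act' \<in> act_class act \<and> \<tau> \<in> Z2c act' \<and> cocommutative (crossed_hopf \<tau> act') \<and>
      X = crossed_class \<tau> act')"
proof
  assume "X \<in> cocomm_Ext_class act"
  then obtain \<tau> act' E where X: "act' \<in> act_class act" "\<tau> \<in> Z2c act'" "X = crossed_class \<tau> act'"
    and E: "E \<in> X" "cocommutative (ext_hopf E)"
    by (auto simp: cocomm_Ext_class_def Ext_class_def crossed_class_def)
  obtain F where "F \<in> hopf_iso (crossed_hopf \<tau> act') (ext_hopf E)"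
    using crossed_class_hopf_iso E(1) X(3) by metis
  then have "cocommutative (crossed_hopf \<tau> act')" by (rule cocommutative_hopf_iso[OF _ E(2)])
  then show "\<exists>\<tau> act'. act' \<in> act_class act \<and> \<tau> \<in> Z2c act' \<and> cocommutative (crossed_hopf \<tau> act') \<and>
      X = crossed_class \<tau> act'"
    using X by blast
next
  assume "\<exists>\<tau> act'. act' \<in> act_class act \<and> \<tau> \<in> Z2c act' \<and> cocommutative (crossed_hopf \<tau> act') \<and>
      X = crossed_class \<tau> act'"
  then obtain \<tau> act' where X: "act' \<in> act_class act" "\<tau> \<in> Z2c act'" "X = crossed_class \<tau> act'"
    and c: "cocommutative (crossed_hopf \<tau> act')"
    by blast
  interpret X: right_action act' using X(1) by (intro right_action.intro) (simp add: act_class_def)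
  interpret X: crossed_cocycle act' \<tau> by (rule X.crossed_cocycleI[OF X(2)])
  have "cocommutative (ext_hopf (crossed_ext \<tau> act'))" using c by (simp add: crossed_ext_def)
  then have "\<exists>E\<in>X. cocommutative (ext_hopf E)"
    unfolding X(3) by (rule bexI[OF _ X.crossed_ext_in_class])
  moreover have "X \<in> Ext_class act" using X by (auto simp: Ext_class_def crossed_class_def)
  ultimately show "X \<in> cocomm_Ext_class act" by (simp add: cocomm_Ext_class_def)
qed

definition cocomm_isomorphic :: "(('c, 'g, 'k::field) hopf_ext set \<times> ('c, 'g, 'k) hopf_ext set) set" where
  "cocomm_isomorphic = ext_isomorphic \<inter> cocomm_Ext_class act \<times> cocomm_Ext_class act"

text \<open>\<open>ext_isomorphic\<close> allows arbitrary representatives, so transitivity is not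
  immediate. Fixing one crossed product per class turns the relation into the existence of an
  isomorphism between fixed Hopf algebras.\<close>

lemma cocomm_isomorphic_equiv:
  "equiv (cocomm_Ext_class act) (cocomm_isomorphic :: (('c, 'g, 'k::field) hopf_ext set \<times> _) set)"
proof -
  let ?C = "cocomm_Ext_class act :: ('c, 'g, 'k) hopf_ext set set"
  have "\<exists>\<tau> act'. crossed_cocycle act' \<tau> \<and> X = crossed_class \<tau> act'" if X: "X \<in> ?C" for X
  proof -
    obtain \<tau> act' where *: "act' \<in> act_class act" "\<tau> \<in> Z2c act'" "X = crossed_class \<tau> act'"
      using X unfolding cocomm_Ext_class_iff by blast
    interpret X: right_action act' using *(1) by (intro right_action.intro) (simp add: act_class_def)
    show ?thesis using X.crossed_cocycleI[OF *(2)] *(3) by blast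
  qed
  then obtain t A where tA: "\<And>X. X \<in> ?C \<Longrightarrow> crossed_cocycle (A X) (t X)"
    "\<And>X. X \<in> ?C \<Longrightarrow> X = crossed_class (t X) (A X)"
    by metis
  let ?H = "\<lambda>X. crossed_hopf (t X) (A X)"
  have iso: "(X, Y) \<in> cocomm_isomorphic \<longleftrightarrow> X \<in> ?C \<and> Y \<in> ?C \<and> (\<exists>F. F \<in> hopf_iso (?H X) (?H Y))" for X Y
    using ext_isomorphic_crossed_iff[OF tA(1) tA(1), of X Y] tA(2)[symmetric]
    by (auto simp: cocomm_isomorphic_def)
  show ?thesis
  proof (rule equivI)
    show "cocomm_isomorphic \<subseteq> ?C \<times> ?C" by (auto simp: cocomm_isomorphic_def)
    show "refl_on ?C cocomm_isomorphic"
      by (rule refl_onI, unfold iso) (use hopf_iso_id in blast)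
    show "sym (cocomm_isomorphic :: (('c, 'g, 'k) hopf_ext set \<times> _) set)"
      by (rule symI, unfold iso) (use hopf_iso_inv in blast)
    show "trans (cocomm_isomorphic :: (('c, 'g, 'k) hopf_ext set \<times> _) set)"
      by (rule transI, unfold iso) (use hopf_iso_comp in blast)
  qed
qed

text \<open>Transport of structure along \<open>\<alpha>\<close> and \<open>\<psi>\<close> moves the
  cocycle to the action \<open>act\<close> itself; it stays symmetric, hence lies in
  \<open>B2cc act\<close>.\<close>

lemma hopf_iso_act_class:
  fixes \<tau>' :: "'c \<Rightarrow> 'g \<Rightarrow> 'g \<Rightarrow> 'k::alg_closed_field"
  assumes act': "act' \<in> act_class act" and \<tau>': "\<tau>' \<in> Z2c act'" "cocommutative (crossed_hopf \<tau>' act')"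
  obtains \<tau> F where "\<tau> \<in> B2cc act" "F \<in> hopf_iso (crossed_hopf \<tau> act) (crossed_hopf \<tau>' act')"
proof -
  interpret X: right_action act' using act' by (intro right_action.intro) (simp add: act_class_def)
  interpret X: crossed_cocycle act' \<tau>' by (rule X.crossed_cocycleI[OF \<tau>'(1)])
  obtain \<alpha> \<psi> where \<alpha>: "\<alpha> \<in> group_auts" and \<psi>: "\<psi> \<in> group_auts"
    and eq: "\<And>a x. \<psi> (act' a x) = act (\<psi> a) (\<alpha> x)"
    using act' by (auto simp: act_class_def module_isomorphic_def act_twist_def)
  let ?\<beta> = "inv_into UNIV \<alpha>" and ?\<phi> = "inv_into UNIV \<psi>"
  have bij: "bij \<alpha>" "bij \<psi>" using \<alpha> \<psi> by (auto simp: group_auts_def)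
  have inv: "\<psi> (?\<phi> a) = a" "\<alpha> (?\<beta> x) = x" "?\<phi> (\<psi> a) = a" "?\<beta> (\<alpha> x) = x" for a x
    using bij by (simp_all add: bij_is_surj surj_f_inv_f bij_is_inj)
  have \<beta>: "?\<beta> (x + y) = ?\<beta> x + ?\<beta> y" "?\<beta> 0 = 0" and \<phi>: "?\<phi> (a + b) = ?\<phi> a + ?\<phi> b" "?\<phi> 0 = 0" for x y a b
    using group_auts_inv[OF \<alpha>] group_auts_inv[OF \<psi>]
    by (simp_all add: group_auts_zero) (simp_all add: group_auts_def)
  have \<phi>_act: "?\<phi> (act a x) = act' (?\<phi> a) (?\<beta> x)" for a x
    by (rule inv_f_eq[OF bij_is_inj[OF bij(2)]]) (simp add: eq inv)
  define \<tau> where "\<tau> x a b = \<tau>' (?\<beta> x) (?\<phi> a) (?\<phi> b)" for x a b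
  have "\<tau> \<in> Z2c act"
    by (auto simp: Z2c_def \<tau>_def X.tau_nonzero X.tau_cocycle X.tau_plus \<beta> \<phi> \<phi>_act)
  moreover have "\<tau> x a b = \<tau> x b a" for x a b
    using \<tau>'(2) by (auto simp: X.cocommutative_crossed_iff \<tau>_def)
  ultimately have "\<tau> \<in> B2cc act" by (simp add: B2cc_iff_symmetric)
  moreover have "(\<lambda>u (x, a). 1 * u (\<alpha> x, \<psi> a)) \<in> hopf_iso (crossed_hopf \<tau> act) (crossed_hopf \<tau>' act')"
    by (rule hopf_iso_crossed[where \<eta> = "\<lambda>_ _. 1", OF \<alpha> \<psi>])
      (simp_all add: eq cochains1_def delta_G_def \<tau>_def inv)
  ultimately show ?thesis by (rule that)
qed

lemma crossed_class_cocomm: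
  fixes \<tau> :: "'c \<Rightarrow> 'g \<Rightarrow> 'g \<Rightarrow> 'k::alg_closed_field"
  assumes "\<tau> \<in> B2cc act"
  shows "crossed_class \<tau> act \<in> cocomm_Ext_class act"
proof -
  have \<tau>: "\<tau> \<in> Z2c act" using assms by (simp add: B2cc_def)
  then have "cocommutative (crossed_hopf \<tau> act)"
    using assms by (simp add: B2cc_iff_symmetric cocommutative_crossed_iff)
  then show ?thesis unfolding cocomm_Ext_class_iff using \<tau> act_in_class by blast
qed

lemma crossed_class_isomorphic_iff:
  fixes \<tau> \<tau>' :: "'c \<Rightarrow> 'g \<Rightarrow> 'g \<Rightarrow> 'k::alg_closed_field"
  assumes "\<tau> \<in> B2cc act" "\<tau>' \<in> B2cc act"
  shows "cocomm_isomorphic `` {crossed_class \<tau> act} = cocomm_isomorphic `` {crossed_class \<tau>' act} \<longleftrightarrow>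
    (\<exists>F. F \<in> hopf_iso (crossed_hopf \<tau> act) (crossed_hopf \<tau>' act))"
proof -
  have Z: "crossed_cocycle act \<tau>" "crossed_cocycle act \<tau>'"
    using assms by (auto simp: B2cc_def intro: crossed_cocycleI)
  have "cocomm_isomorphic `` {crossed_class \<tau> act} = cocomm_isomorphic `` {crossed_class \<tau>' act} \<longleftrightarrow>
      (crossed_class \<tau> act, crossed_class \<tau>' act) \<in> cocomm_isomorphic"
    by (rule eq_equiv_class_iff[OF cocomm_isomorphic_equiv])
      (simp_all add: crossed_class_cocomm assms)
  also have "\<dots> \<longleftrightarrow> (crossed_class \<tau> act, crossed_class \<tau>' act) \<in> ext_isomorphic"
    by (simp add: cocomm_isomorphic_def crossed_class_cocomm assms)
  also have "\<dots> \<longleftrightarrow> (\<exists>F. F \<in> hopf_iso (crossed_hopf \<tau> act) (crossed_hopf \<tau>' act))"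
    by (rule ext_isomorphic_crossed_iff[OF Z])
  finally show ?thesis .
qed

lemma cocomm_iso_classes_eq:
  "(cocomm_iso_classes act :: ('c, 'g, 'k::alg_closed_field) hopf_ext set set set) =
     (\<lambda>\<tau>. cocomm_isomorphic `` {crossed_class \<tau> act}) ` B2cc act"
proof -
  let ?C = "cocomm_Ext_class act :: ('c, 'g, 'k) hopf_ext set set"
  have "cocomm_isomorphic `` {X} \<in> (\<lambda>\<tau>. cocomm_isomorphic `` {crossed_class \<tau> act}) ` B2cc act"
    if X: "X \<in> ?C" for X
  proof -
    obtain \<tau>' act' where X': "act' \<in> act_class act" "\<tau>' \<in> Z2c act'" "X = crossed_class \<tau>' act'"
      and c: "cocommutative (crossed_hopf \<tau>' act')"
      using X unfolding cocomm_Ext_class_iff by blast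
    interpret X: right_action act' using X'(1) by (intro right_action.intro) (simp add: act_class_def)
    obtain \<tau> F where \<tau>: "\<tau> \<in> B2cc act" and F: "F \<in> hopf_iso (crossed_hopf \<tau> act) (crossed_hopf \<tau>' act')"
      by (rule hopf_iso_act_class[OF X'(1,2) c])
    have "\<tau> \<in> Z2c act" using \<tau> by (simp add: B2cc_def)
    then have "(crossed_class \<tau> act, X) \<in> ext_isomorphic"
      unfolding X'(3)
      using ext_isomorphic_crossed_iff[OF crossed_cocycleI X.crossed_cocycleI[OF X'(2)]] F by blast
    then have "(crossed_class \<tau> act, X) \<in> cocomm_isomorphic"
      using X crossed_class_cocomm[OF \<tau>] by (simp add: cocomm_isomorphic_def)
    then have "cocomm_isomorphic `` {crossed_class \<tau> act} = cocomm_isomorphic `` {X}"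
      by (rule equiv_class_eq[OF cocomm_isomorphic_equiv])
    then show ?thesis using \<tau> by (metis (no_types, lifting) image_eqI)
  qed
  then show ?thesis
    unfolding cocomm_iso_classes_def cocomm_isomorphic_def[symmetric] quotient_def
    using crossed_class_cocomm by blast
qed

end

theorem theorem4p14:
  fixes p :: nat
    and act :: "'g::{finite, ab_group_add} \<Rightarrow> 'c::{finite, ab_group_add} \<Rightarrow> 'g"
  assumes "prime p"
    and "CARD('c) = p"
    and "elementary_abelian p TYPE('g)"
    and "is_action act"
  shows "\<exists>\<Phi>. bij_betw \<Phi>
    (H2cc_orbits act :: ('c \<Rightarrow> 'g \<Rightarrow> 'g \<Rightarrow> 'k::{alg_closed_field, field_char_0}) set set set)
    (cocomm_iso_classes act :: ('c, 'g, 'k) hopf_ext set set set)"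
proof -
  have "\<exists>g :: 'c. g \<noteq> 0"
  proof (rule ccontr)
    assume "\<not> ?thesis"
    then have "UNIV = {0 :: 'c}" by auto
    then have "CARD('c) = card {0 :: 'c}" by (rule arg_cong)
    then show False using assms(1,2) prime_gt_1_nat by simp
  qed
  then obtain g :: 'c where g: "g \<noteq> 0" by blast
  interpret prime_action act g p
    using assms g by unfold_locales
  have "coset_orbit \<tau> = coset_orbit \<tau>' \<longleftrightarrow>
      cocomm_isomorphic `` {crossed_class \<tau> act} = cocomm_isomorphic `` {crossed_class \<tau>' act}"
    if \<tau>: "\<tau> \<in> B2cc act" "\<tau>' \<in> B2cc act" for \<tau> \<tau>' :: "'c \<Rightarrow> 'g \<Rightarrow> 'g \<Rightarrow> 'k"
    unfolding crossed_class_isomorphic_iff[OF \<tau>]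
  proof
    assume "coset_orbit \<tau> = coset_orbit \<tau>'"
    then obtain l h where "l \<in> \<A>" "h \<in> B2c act" "\<tau>' = twist l (h * \<tau>)"
      by (rule coset_orbit_eqD)
    then show "\<exists>F. F \<in> hopf_iso (crossed_hopf \<tau> act) (crossed_hopf \<tau>' act)"
      using hopf_iso_twist by blast
  next
    assume "\<exists>F. F \<in> hopf_iso (crossed_hopf \<tau> act) (crossed_hopf \<tau>' act)"
    then obtain l h where l: "l \<in> \<A>" and h: "h \<in> B2c act" and \<tau>': "\<tau>' = h * (\<lambda>x a b. \<tau> x (l a) (l b))"
      using hopf_iso_imp_cohomologous_twist[OF \<tau>] by metis
    \<comment> \<open>\<open>twist\<close> composes with the inverse automorphism, so composition
      with \<open>l\<close> is the twist by the inverse of \<open>l\<close>.\<close>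
    show "coset_orbit \<tau> = coset_orbit \<tau>'"
      using coset_orbit_eqI[OF auts_inv[OF l] h, of \<tau>] by (simp add: \<tau>' twist_inv[OF l])
  qed
  then show ?thesis
    unfolding H2cc_orbits_eq cocomm_iso_classes_eq by (rule ex_bij_betw_images)
qed

end
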